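(* Let $f(t)=\sum_{i\ge 1}f_i\frac{t^i}{i!}\in\mathbb{R}[[t]]$ with $f_1\ne 0$, and let $g(t)=\exp(\lambda f(t))$, where $\lambda$ (and $q$) are indeterminates unless specialized. If $1/\bar f'(t)$ is a PF function, then: (i) both $(S_n(f,g;q))_{n\ge 0}$ and $(S_n^*(f,g;q))_{n\ge 0}$ are $(\lambda,q)$-SM and $3$-$(\lambda,q)$-log-convex; (ii) $(f_{n+1})_{n\ge 0}$ is SM and $3$-log-convex; (iii) $[S_{n,k}(f,g)]_{n,k}$ is $\lambda$-TP; (iv) the triangular matrices $[L_{n,k}(f)]_{n,k}$, $[\widetilde L_{n,k}(f)]_{n,k}$, $[(-1)^{n-k}S_{n,k}(\bar f,1)]_{n,k}$, $[(-1)^{n-k}L_{n,k}(\bar f)]_{n,k}$ and $[(-1)^{n-k}\widetilde L_{n,k}(\bar f)]_{n,k}$ are all TP; (v) the $A$-convolution preserves the SM property if $A$ is any of the triangles $[S_{n,k}(f,g)]_{n,k}$ with real $\lambda\ge 0$, $[S_{n+1,k+1}(f,1)]_{n,k}$ and $[\widetilde L_{n,k}(f)]_{n,k}$; (vi) if $1/\bar f'(t)=\prod_{i=1}^m(1+x_it)$ for some $m\geq 1$, then $\sum_{n\ge 0}S_n(f,g;q)t^n$ equals the $m$-branched Stieltjes-type continued fraction with coefficients $$(\alpha_i)_{i\ge m}=(\lambda+q,\underbrace{x_1,\ldots,x_m}_{m},\lambda+q,\underbrace{2x_1,\ldots,2x_m}_{m},\lambda+q,\underbrace{3x_1,\ldots,3x_m}_{m},\ldots),$$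 and $\sum_{n\ge 0}S^*_n(f,g;q)t^n$ equals the $m$-branched Stieltjes-type continued fraction with coefficients $$(\beta_i)_{i\ge m}=(q\lambda+1,\underbrace{qx_1,\ldots,qx_m}_{m},q\lambda+1,\underbrace{2qx_1,\ldots,2qx_m}_{m},q\lambda+1,\underbrace{3qx_1,\ldots,3qx_m}_{m},\ldots).$$
   Context: Total positivity. A real matrix is TP if all its minors are nonnegative. For a set $\mathbf{x}$ of indeterminates, a matrix with entries in $\mathbb{R}[\mathbf{x}]$ is $\mathbf{x}$-TP if all its minors are polynomials with nonnegative coefficients in $\mathbf{x}$. A series $\sum_{n\ge 0}a_nt^n\in\mathbb{R}[[t]]$ is a PF function if $[a_{i-j}]_{i,j\ge 0}$ (with $a_m=0$ for $m<0$) is TP. Stieltjes moment (SM). A real sequence $(a_k)_{k\ge 0}$ is SM if $a_k=\int_0^{+\infty}x^k\,d\mu(x)$ for a nonnegative measure $\mu$ on $[0,+\infty)$; equivalently $[a_{i+j}]_{i,j\ge 0}$ is TP. A sequence $(\alpha_n)_{n\ge 0}$ in $\mathbb{R}[\mathbf{x}]$ is $\mathbf{x}$-SM if its Hankel matrix $[\alpha_{i+j}]_{i,j\ge 0}$ is $\mathbf{x}$-TP. $k$-log-convexity. Let $\mathcal{L}[\alpha_i]=\alpha_{i-1}\alpha_{i+1}-\alpha_i^2$ for $i\ge 1$ and $\mathcal{L}^m=\mathcal{L}(\mathcal{L}^{m-1})$ (so $\mathcal{L}^m[\alpha_i]$ is defined for $i\ge m$). The sequence $(\alpha_i)_{i\ge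 0}$ in $\mathbb{R}[\mathbf{x}]$ is $k$-$\mathbf{x}$-log-convex if for all $1\le m\le k$ all the $\mathcal{L}^m[\alpha_i]$ are polynomials with nonnegative coefficients; for real sequences ($k$-log-convex) this means they are nonnegative. $\bar f$ is the compositional inverse of $f$ and $\bar f'$ its derivative. For $h,u\in\mathbb{R}[[t]]$ (or with coefficients polynomial in $\lambda$), with $h(0)=0$, $h'(0)u(0)\ne 0$, define $S_n(h,u;q)=\sum_{k=0}^nS_{n,k}(h,u)q^k$ by $\sum_{n\ge 0}S_n(h,u;q)\frac{t^n}{n!}=u(t)\exp(qh(t))$, and $S_n^*(h,u;q)=q^nS_n(h,u;1/q)$. Define lower-triangular arrays by $$\log(1-qh(t))=-\sum_{n\ge 1}\Big(\sum_{k=1}^nL_{n,k}(h)q^k\Big)\frac{t^n}{n!},\qquad \frac{1}{1-qh(t)}=1+\sum_{n\ge 1}\Big(\sum_{k=1}^n\widetilde L_{n,k}(h)q^k\Big)\frac{t^n}{n!},$$ with $L_{0,0}(h)=\widetilde L_{0,0}(h)=1$ and $L_{n,0}(h)=\widetilde L_{n,0}(h)=0$ for $n\ge 1$. Matrices are indexed by $n,k\ge 0$. Convolution. For $A=[a_{n,k}]_{n,k\ge 0}$, the $A$-convolution of $(x_n)$ and $(y_n)$ is $z_n=\sum_{k=0}^na_{n,k}x_ky_{n-k}$, $n\ge 0$; it preserves the SM property if $(z_n)_{n\ge 0}$ is SM whenever the real sequences $(x_n)_{n\ge 0}$ and $(y_n)_{n\ge 0}$ are both SM. The $m$-branched Stieltjes-type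 continued fraction with coefficients $(\alpha_i)_{i\ge m}$ is the formal power series $$\cfrac{1}{1-\alpha_mt\prod\limits_{i_1=1}^m\cfrac{1}{1-\alpha_{m+i_1}t\prod\limits_{i_2=1}^m\cfrac{1}{1-\alpha_{m+i_1+i_2}t\prod\limits_{i_3=1}^m\cfrac{1}{1-\cdots}}}},$$ i.e. $F_0(t)$, where $(F_k(t))_{k\ge 0}$ is the unique family of formal power series with constant term $1$ satisfying $F_k(t)=1/\big(1-\alpha_{k+m}\,t\,F_{k+1}(t)\cdots F_{k+m}(t)\big)$ for all $k\ge 0$. *)

theory Defs
  imports
    "HOL-Analysis.Analysis"
    "HOL-Computational_Algebra.Formal_Power_Series"
    "HOL-Computational_Algebra.Polynomial"
    "Jordan_Normal_Form.Determinant"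
begin

text \<open>
  The ring of real polynomials in \<open>\<lambda>\<close> is \<^typ>\<open>real poly\<close>, and the ring of real polynomials in
  \<open>\<lambda>\<close> and \<open>q\<close> is \<^typ>\<open>real poly poly\<close>: the outer variable is \<open>q\<close> and the inner one is \<open>\<lambda>\<close>.
  The library's order on polynomials compares leading coefficients only and is not used here.
\<close>

abbreviation lam1 :: "real poly" where "lam1 \<equiv> [:0, 1:]"
abbreviation lam2 :: "real poly poly" where "lam2 \<equiv> [:[:0, 1:]:]"
abbreviation q2 :: "real poly poly" where "q2 \<equiv> [:0, 1:]"

definition coeffs_nonneg1 :: "real poly \<Rightarrow> bool" where
  "coeffs_nonneg1 p \<longleftrightarrow> (\<forall>i. coeff p i \<ge> 0)"

definition coeffs_nonneg2 :: "real poly poly \<Rightarrow> bool" where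
  "coeffs_nonneg2 p \<longleftrightarrow> (\<forall>i j. coeff (coeff p i) j \<ge> 0)"

definition minor :: "(nat \<Rightarrow> nat \<Rightarrow> 'a::comm_ring_1) \<Rightarrow> nat \<Rightarrow> (nat \<Rightarrow> nat) \<Rightarrow> (nat \<Rightarrow> nat) \<Rightarrow> 'a" where
  "minor A n r c = Determinant.det (Matrix.mat n n (\<lambda>(i, j). A (r i) (c j)))"

text \<open>
  All minors satisfy the predicate \<open>P\<close>, which is nonnegativity for real matrices and coefficientwise
  nonnegativity for polynomial ones.
\<close>

definition all_minors :: "('a::comm_ring_1 \<Rightarrow> bool) \<Rightarrow> (nat \<Rightarrow> nat \<Rightarrow> 'a) \<Rightarrow> bool" where
  "all_minors P A \<longleftrightarrow>
     (\<forall>n r c. strict_mono_on {..<n} r \<and> strict_mono_on {..<n} c \<longrightarrow> P (minor A n r c))"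

definition TP :: "(nat \<Rightarrow> nat \<Rightarrow> real) \<Rightarrow> bool" where
  "TP A \<longleftrightarrow> all_minors (\<lambda>x. x \<ge> 0) A"

definition TP1 :: "(nat \<Rightarrow> nat \<Rightarrow> real poly) \<Rightarrow> bool" where
  "TP1 A \<longleftrightarrow> all_minors coeffs_nonneg1 A"

definition TP2 :: "(nat \<Rightarrow> nat \<Rightarrow> real poly poly) \<Rightarrow> bool" where
  "TP2 A \<longleftrightarrow> all_minors coeffs_nonneg2 A"

definition PF_function :: "real fps \<Rightarrow> bool" where
  "PF_function a \<longleftrightarrow> TP (\<lambda>i j. if j \<le> i then fps_nth a (i - j) else 0)"

definition SM :: "(nat \<Rightarrow> real) \<Rightarrow> bool" where
  "SM a \<longleftrightarrow> (\<exists>\<mu> :: real measure. sets \<mu> = sets (restrict_space borel {0..}) \<and>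
     (\<forall>k. has_bochner_integral \<mu> (\<lambda>x. x ^ k) (a k)))"

definition SM2 :: "(nat \<Rightarrow> real poly poly) \<Rightarrow> bool" where
  "SM2 \<alpha> \<longleftrightarrow> TP2 (\<lambda>i j. \<alpha> (i + j))"

text \<open>
  The \<open>m\<close>-th iterate of \<open>logconv_op\<close> is meaningful at indices \<open>i \<ge> m\<close> only; there it does not
  depend on the junk value of \<open>logconv_op\<close> at index \<open>0\<close>.
\<close>

definition logconv_op :: "(nat \<Rightarrow> 'a::comm_ring_1) \<Rightarrow> nat \<Rightarrow> 'a" where
  "logconv_op \<alpha> i = \<alpha> (i - 1) * \<alpha> (i + 1) - (\<alpha> i)\<^sup>2"

definition iter_log_convex :: "('a::comm_ring_1 \<Rightarrow> bool) \<Rightarrow> nat \<Rightarrow> (nat \<Rightarrow> 'a) \<Rightarrow> bool" where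
  "iter_log_convex P k \<alpha> \<longleftrightarrow> (\<forall>m\<in>{1..k}. \<forall>i\<ge>m. P ((logconv_op ^^ m) \<alpha> i))"

definition log_convex :: "nat \<Rightarrow> (nat \<Rightarrow> real) \<Rightarrow> bool" where
  "log_convex k a \<longleftrightarrow> iter_log_convex (\<lambda>x. x \<ge> 0) k a"

definition log_convex2 :: "nat \<Rightarrow> (nat \<Rightarrow> real poly poly) \<Rightarrow> bool" where
  "log_convex2 k \<alpha> \<longleftrightarrow> iter_log_convex coeffs_nonneg2 k \<alpha>"

text \<open>
  The library's \<^const>\<open>fps_exp\<close>, \<^const>\<open>fps_ln\<close> and \<^const>\<open>inverse\<close> require a field of coefficients.
  The versions below make sense over the real numbers and over real polynomial rings alike. The
  divisions are exact since the positive integers are units in these rings; \<open>exp_fps F\<close> and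
  \<open>log_fps F\<close> are meant for \<open>F\<close> with constant term \<open>0\<close> and \<open>1\<close> respectively, \<open>recip_fps F\<close> for
  constant term \<open>1\<close>.
\<close>

definition exp_fps :: "'a::{idom_divide,ring_char_0} fps \<Rightarrow> 'a fps" where
  "exp_fps F = Abs_fps (\<lambda>n. 1 div fact n) oo F"

definition log_fps :: "'a::{idom_divide,ring_char_0} fps \<Rightarrow> 'a fps" where
  "log_fps F = Abs_fps (\<lambda>n. if n = 0 then 0 else (- 1) ^ (n - 1) div of_nat n) oo (F - 1)"

definition recip_fps :: "'a::comm_ring_1 fps \<Rightarrow> 'a fps" where
  "recip_fps F = fps_right_inverse F 1"

definition const_fps :: "'a::zero fps \<Rightarrow> 'a poly fps" where
  "const_fps F = Abs_fps (\<lambda>n. [:fps_nth F n:])"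

lemma exp_fps_real: "exp_fps (F :: real fps) = fps_exp 1 oo F"
  by (simp add: exp_fps_def fps_exp_def)

lemma log_fps_real: "log_fps (F :: real fps) = fps_ln 1 oo (F - 1)"
  by (simp add: log_fps_def fps_ln_def)

lemma one_div_fact_poly: "1 div (fact n :: real poly) = [:1 / fact n:]"
proof -
  have "(fact n :: real poly) = [:fact n:]"
    by (metis of_nat_fact of_nat_poly)
  then have "(1 :: real poly) = [:1 / fact n:] * fact n" by (simp add: one_pCons)
  then show ?thesis by (metis fact_nonzero nonzero_mult_div_cancel_right)
qed

lemma one_div_fact_poly_poly: "1 div (fact n :: real poly poly) = [:[:1 / fact n:]:]"
proof -
  have "(fact n :: real poly poly) = [:[:fact n:]:]"
    by (metis of_nat_fact of_nat_poly)
  then have "(1 :: real poly poly) = [:[:1 / fact n:]:] * fact n" by (simp add: one_pCons)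
  then show ?thesis by (metis fact_nonzero nonzero_mult_div_cancel_right)
qed

lemma recip_fps: "fps_nth F 0 = 1 \<Longrightarrow> F * recip_fps F = 1"
  by (simp add: recip_fps_def fps_right_inverse)

definition egf_coeff :: "'a::semiring_char_0 fps \<Rightarrow> nat \<Rightarrow> 'a" where
  "egf_coeff F n = fact n * fps_nth F n"

definition S_poly :: "'a::{idom_divide,ring_char_0} fps \<Rightarrow> 'a fps \<Rightarrow> nat \<Rightarrow> 'a poly" where
  "S_poly h u n = egf_coeff (const_fps u * exp_fps (fps_const [:0, 1:] * const_fps h)) n"

definition S_tri :: "'a::{idom_divide,ring_char_0} fps \<Rightarrow> 'a fps \<Rightarrow> nat \<Rightarrow> nat \<Rightarrow> 'a" where
  "S_tri h u n k = coeff (S_poly h u n) k"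

definition S_star_poly :: "'a::{idom_divide,ring_char_0} fps \<Rightarrow> 'a fps \<Rightarrow> nat \<Rightarrow> 'a poly" where
  "S_star_poly h u n = (\<Sum>k\<le>n. monom (S_tri h u n k) (n - k))"

definition L_tri :: "real fps \<Rightarrow> nat \<Rightarrow> nat \<Rightarrow> real" where
  "L_tri h n k = (if n = 0 \<and> k = 0 then 1
     else coeff (egf_coeff (- log_fps (1 - fps_const [:0, 1:] * const_fps h)) n) k)"

definition Lt_tri :: "real fps \<Rightarrow> nat \<Rightarrow> nat \<Rightarrow> real" where
  "Lt_tri h n k = coeff (egf_coeff (recip_fps (1 - fps_const [:0, 1:] * const_fps h)) n) k"

definition convolution :: "(nat \<Rightarrow> nat \<Rightarrow> real) \<Rightarrow> (nat \<Rightarrow> real) \<Rightarrow> (nat \<Rightarrow> real) \<Rightarrow> nat \<Rightarrow> real" where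
  "convolution A x y n = (\<Sum>k\<le>n. A n k * x k * y (n - k))"

definition convolution_preserves_SM :: "(nat \<Rightarrow> nat \<Rightarrow> real) \<Rightarrow> bool" where
  "convolution_preserves_SM A \<longleftrightarrow> (\<forall>x y. SM x \<and> SM y \<longrightarrow> SM (convolution A x y))"

definition branched_cf_family ::
  "nat \<Rightarrow> (nat \<Rightarrow> 'a::comm_ring_1) \<Rightarrow> (nat \<Rightarrow> 'a fps) \<Rightarrow> bool" where
  "branched_cf_family m \<alpha> F \<longleftrightarrow>
     (\<forall>k. fps_nth (F k) 0 = 1 \<and>
          F k = recip_fps (1 - fps_const (\<alpha> (k + m)) * fps_X * (\<Prod>i=1..m. F (k + i))))"

definition branched_cf :: "nat \<Rightarrow> (nat \<Rightarrow> 'a::comm_ring_1) \<Rightarrow> 'a fps" where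
  "branched_cf m \<alpha> = (THE F. branched_cf_family m \<alpha> F) 0"

text \<open>The sequence \<open>(\<alpha>\<^sub>i)\<close>, \<open>i \<ge> m\<close>, given by \<open>c, d 1, ..., d m, c, 2 d 1, ..., 2 d m, c, 3 d 1, ...\<close>.\<close>

definition cf_coeffs :: "nat \<Rightarrow> 'a::comm_ring_1 \<Rightarrow> (nat \<Rightarrow> 'a) \<Rightarrow> nat \<Rightarrow> 'a" where
  "cf_coeffs m c d i =
     (let j = (i - m) div (m + 1); r = (i - m) mod (m + 1)
      in if r = 0 then c else of_nat (j + 1) * d r)"

lemma X_power_dvd_iff: "fps_X ^ n dvd (A :: 'a::comm_ring_1 fps) \<longleftrightarrow> (\<forall>j<n. fps_nth A j = 0)"
proof
  assume "fps_X ^ n dvd A"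
  then show "\<forall>j<n. fps_nth A j = 0"
    by (auto simp: fps_X_power_mult_nth dvd_def)
next
  assume "\<forall>j<n. fps_nth A j = 0"
  then have "A = fps_X ^ n * fps_shift n A"
    by (auto simp: fps_eq_iff fps_X_power_mult_nth)
  then show "fps_X ^ n dvd A" by (metis dvd_triv_left)
qed

lemma dvd_prod_diff:
  fixes F G :: "nat \<Rightarrow> 'a::comm_ring_1"
  assumes "\<And>i. i \<in> I \<Longrightarrow> d dvd F i - G i"
  shows "d dvd prod F I - prod G I"
  using assms
proof (induction I rule: infinite_finite_induct)
  case (insert x I)
  have "prod F (insert x I) - prod G (insert x I) =
      (F x - G x) * prod F I + G x * (prod F I - prod G I)"
    using insert.hyps by (simp add: algebra_simps)
  then show ?case using insert by (metis dvd_add dvd_mult dvd_mult2 insertCI)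
qed auto

lemma ex1_branched_cf_family:
  fixes \<alpha> :: "nat \<Rightarrow> 'a::comm_ring_1"
  shows "\<exists>!F. branched_cf_family m \<alpha> F"
proof -
  define D where "D F k = 1 - fps_const (\<alpha> (k + m)) * fps_X * (\<Prod>i=1..m. F (k + i))"
    for F :: "nat \<Rightarrow> 'a fps" and k
  define \<Phi> where "\<Phi> F k = recip_fps (D F k)" for F k
  define agree where "agree n F G \<longleftrightarrow> (\<forall>k. fps_X ^ n dvd F k - G k)"
    for n and F G :: "nat \<Rightarrow> 'a fps"
  have \<Phi>0: "fps_nth (\<Phi> F k) 0 = 1" for F k by (simp add: \<Phi>_def recip_fps_def)
  have D0: "fps_nth (D F k) 0 = 1" for F k by (simp add: D_def)
  have inv: "D F k * \<Phi> F k = 1" for F k by (simp add: \<Phi>_def recip_fps D0)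
  have fam: "branched_cf_family m \<alpha> F \<longleftrightarrow> F = \<Phi> F" for F
  proof -
    have "branched_cf_family m \<alpha> F \<longleftrightarrow> (\<forall>k. fps_nth (F k) 0 = 1 \<and> F k = \<Phi> F k)"
      unfolding branched_cf_family_def \<Phi>_def D_def by (rule refl)
    also have "\<dots> \<longleftrightarrow> F = \<Phi> F"
    proof
      assume "\<forall>k. fps_nth (F k) 0 = 1 \<and> F k = \<Phi> F k"
      then show "F = \<Phi> F" by blast
    next
      assume F: "F = \<Phi> F"
      show "\<forall>k. fps_nth (F k) 0 = 1 \<and> F k = \<Phi> F k"
      proof (intro allI conjI)
        fix k
        show "F k = \<Phi> F k" by (rule fun_cong[OF F])
        show "fps_nth (F k) 0 = 1" by (rule ssubst[OF fun_cong[OF F, of k]]) (rule \<Phi>0)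
      qed
    qed
    finally show ?thesis .
  qed
  have step: "agree (Suc n) (\<Phi> F) (\<Phi> G)" if "agree n F G" for n F G
    unfolding agree_def
  proof
    fix k
    have P: "fps_X ^ n dvd (\<Prod>i=1..m. F (k + i)) - (\<Prod>i=1..m. G (k + i))"
      using that by (intro dvd_prod_diff) (auto simp: agree_def)
    have "\<Phi> F k - \<Phi> G k = \<Phi> F k * (D G k * \<Phi> G k) - (D F k * \<Phi> F k) * \<Phi> G k"
      by (simp add: inv)
    also have "\<dots> = (\<Phi> F k * \<Phi> G k) * (D G k - D F k)" by (simp add: algebra_simps)
    also have "D G k - D F k = fps_const (\<alpha> (k + m)) *
        (fps_X * ((\<Prod>i=1..m. F (k + i)) - (\<Prod>i=1..m. G (k + i))))"
      by (simp add: D_def algebra_simps)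
    finally show "fps_X ^ Suc n dvd \<Phi> F k - \<Phi> G k"
      using P by (simp add: dvd_mult mult_dvd_mono)
  qed
  have eqI: "F = G" if "\<And>n. agree n F G" for F G
  proof (intro ext fps_ext)
    fix k j
    have "fps_X ^ Suc j dvd F k - G k" using that[of "Suc j"] by (simp add: agree_def)
    then show "fps_nth (F k) j = fps_nth (G k) j" unfolding X_power_dvd_iff by auto
  qed
  have trans: "agree n F H" if "agree n F G" "agree n G H" for n F G H
    unfolding agree_def
  proof
    fix k
    have "fps_X ^ n dvd (F k - G k) + (G k - H k)"
      using that unfolding agree_def by (intro dvd_add) blast+
    then show "fps_X ^ n dvd F k - H k" by simp
  qed
  have sym: "agree n G F" if "agree n F G" for n F G
    unfolding agree_def
  proof
    fix k
    have "fps_X ^ n dvd F k - G k" using that unfolding agree_def by blast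
    then show "fps_X ^ n dvd G k - F k" by (subst minus_diff_eq[symmetric], subst dvd_minus_iff)
  qed
  define G where "G n = (\<Phi> ^^ n) (\<lambda>_. 1)" for n
  have GS: "G (Suc n) = \<Phi> (G n)" for n by (simp add: G_def)
  have G1: "agree n (G n) (G (n + p))" for n p
    by (induction n) (auto simp: GS intro: step, simp add: agree_def)
  define F where "F k = Abs_fps (\<lambda>j. fps_nth (G (Suc j) k) j)" for k
  have FG: "agree n F (G n)" for n
    unfolding agree_def X_power_dvd_iff
  proof (intro allI impI)
    fix k j assume "j < n"
    then obtain p where n: "n = Suc j + p" using less_iff_Suc_add by auto
    have "fps_X ^ Suc j dvd G (Suc j) k - G n k"
      using G1[of "Suc j" p] by (simp add: agree_def n)
    then show "fps_nth (F k - G n k) j = 0" unfolding X_power_dvd_iff by (simp add: F_def)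
  qed
  have "agree n F (\<Phi> F)" for n
  proof (cases n)
    case (Suc n')
    show ?thesis unfolding Suc
      using trans[OF FG[of "Suc n'"] sym[OF step[OF FG[of n']], folded GS]] .
  qed (simp add: agree_def)
  then have ex: "F = \<Phi> F" by (rule eqI)
  show ?thesis
  proof (rule ex1I[of _ F])
    show "branched_cf_family m \<alpha> F" using ex fam by blast
    fix H assume "branched_cf_family m \<alpha> H"
    then have H: "H = \<Phi> H" using fam by blast
    have "agree n H F" for n
    proof (induction n)
      case (Suc n)
      from step[OF this] show ?case by (simp only: H[symmetric] ex[symmetric])
    qed (simp add: agree_def)
    then show "H = F" by (rule eqI)
  qed
qed

lemma branched_cf_eq: "branched_cf_family m \<alpha> F \<Longrightarrow> branched_cf m \<alpha> = F 0"
  unfolding branched_cf_def by (simp add: the1_equality[OF ex1_branched_cf_family])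

end

theory Submission
  imports Defs "HOL-Probability.Helly_Selection" "HOL-Probability.Distributions"
begin

text \<open>
  Put \<open>\<Phi> = 1 / (f\<^sup>-\<^sup>1)'\<close>, so that \<open>f' = \<Phi> \<circ> f\<close>, and let \<open>S\<close> be the triangle \<open>n! [t\<^sup>n] f\<^sup>k / k!\<close>.
  Since \<open>g = exp (\<lambda> f)\<close>, all polynomials in question are the homogeneous row polynomials
  \<open>h\<^sub>n(x, y) = \<Sum>\<^sub>k S\<^sub>n\<^sub>k x\<^sup>k y\<^sup>n\<^sup>-\<^sup>k\<close> of \<open>S\<close> at nonnegative arguments: \<open>S\<^sub>n\<close> is \<open>h\<^sub>n(\<lambda> + q, 1)\<close> and
  \<open>S\<^sub>n\<^sup>*\<close> is \<open>h\<^sub>n(1 + q \<lambda>, q)\<close>. They form the column \<open>0\<close> of an array \<open>G\<close> whose rows are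
  \<open>e\<^sub>0, e\<^sub>0 P, e\<^sub>0 P\<^sup>2, \<dots>\<close> for a production matrix \<open>P = T W\<close>. Here \<open>T\<close> is the Toeplitz matrix of \<open>\<Phi>\<close>,
  conjugated by factorials and graded by \<open>y\<close>, and \<open>W\<close> has \<open>x\<close> on the diagonal and \<open>1\<close> just
  above it. The hypothesis on \<open>\<Phi>\<close> says that \<open>T\<close> is totally positive, and \<open>W\<close> obviously is. By
  Cauchy--Binet the same holds for \<open>P\<close>, for \<open>G\<close> (\<open>all_minors_G\<close>), and for the Hankel matrix of the
  \<open>h\<^sub>n\<close>, whose entry \<open>e\<^sub>0 P\<^sup>i\<^sup>+\<^sup>j e\<^sub>0\<close> factors as a row of \<open>G\<close> times a column \<open>P\<^sup>j e\<^sub>0\<close>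
  (\<open>all_minors_hankel_G\<close>; \<open>all_minors_hankel_shifted\<close> is the analogue for \<open>h\<^sub>n\<^sub>+\<^sub>1 / x\<close>, which is
  the sequence of the coefficients of \<open>f\<close> at \<open>x = 0\<close>). All of this is done over a commutative
  ring with a cone of nonnegative elements, and so covers coefficientwise positivity as well.

  The remaining assertions follow from these positivity results. Log-convexity of order three
  expresses the iterated operator through Hankel minors by the Desnanot--Jacobi identity. The
  triangles of \<open>f\<close> are column scalings of \<open>S\<close>, and those of the inverse series are column scalings
  of the inverse matrix, whose minors are complementary minors of \<open>S\<close> up to sign
  (\<open>TP_signed_inverse\<close>). A measure with prescribed moments comes from Stieltjes' theorem
  (\<open>Stieltjes_moment_theorem\<close>): the moment functional is nonnegative on polynomials that are
  nonnegative on the half-line, hence finitely many moments are approximated by atomic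
  measures, and Helly's selection theorem supplies a limit. For the convolutions, the Hankel
  forms of the homogeneous row polynomials are integrated against both given measures. When
  \<open>\<Phi>\<close> is a product of \<open>m\<close> linear factors, \<open>T\<close> is a product of \<open>m\<close> bidiagonal matrices, and one
  application of \<open>P\<close> is \<open>m + 1\<close> steps of the lattice paths that the branched continued fraction
  counts (\<open>branched_cf_path_weight\<close>, \<open>path_weight_G\<close>).
\<close>

section \<open>Minors\<close>

lemma minor_leibniz:
  "minor A n r c = (\<Sum>p | p permutes {0..<n}. signof p * (\<Prod>i=0..<n. A (r i) (c (p i))))"
  unfolding minor_def
  by (subst det_def'[of _ n])
     (auto intro!: sum.cong arg_cong2[of _ _ _ _ "(*)"] prod.cong dest: permutes_in_image)

lemma minor_cong:
  assumes "\<And>i j. i < n \<Longrightarrow> j < n \<Longrightarrow> A (r i) (c j) = B (r' i) (c' j)"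
  shows "minor A n r c = minor B n r' c'"
  unfolding minor_def by (intro arg_cong[of _ _ Determinant.det] eq_matI) (auto simp: assms)

lemma minor_0 [simp]: "minor A 0 r c = 1"
  by (simp add: minor_def)

lemma minor_transpose: "minor (\<lambda>i j. A j i) n r c = minor A n c r"
proof -
  have "minor A n c r = Determinant.det (transpose_mat (Matrix.mat n n (\<lambda>(i, j). A (c i) (r j))))"
    unfolding minor_def by (subst det_transpose[of _ n]) auto
  also have "\<dots> = minor (\<lambda>i j. A j i) n r c"
    unfolding minor_def by (intro arg_cong[of _ _ Determinant.det] eq_matI) auto
  finally show ?thesis ..
qed

lemma minor_permute_rows:
  assumes "p permutes {0..<n}"
  shows "minor A n (\<lambda>i. r (p i)) c = signof p * minor A n r c"
proof -
  have "Determinant.det (Matrix.mat n n (\<lambda>(i, j). Matrix.mat n n (\<lambda>(i, j). A (r i) (c j)) $$ (p i, j)))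
      = signof p * minor A n r c"
    unfolding minor_def by (subst det_permute_rows[of _ n]) (use assms in auto)
  also have "Matrix.mat n n (\<lambda>(i, j). Matrix.mat n n (\<lambda>(i, j). A (r i) (c j)) $$ (p i, j)) =
      Matrix.mat n n (\<lambda>(i, j). A (r (p i)) (c j))"
    by (rule eq_matI) (use permutes_in_image[OF assms] in auto)
  finally show ?thesis by (simp add: minor_def)
qed

lemma minor_eq_rows:
  assumes "i < n" "j < n" "i \<noteq> j" "r i = r j"
  shows "minor A n r c = 0"
  unfolding minor_def
  by (rule det_identical_rows[of _ n i j]) (use assms in \<open>auto intro: eq_vecI\<close>)

lemma minor_zero_row:
  assumes "i < n" "\<And>j. j < n \<Longrightarrow> A (r i) (c j) = 0"
  shows "minor A n r c = 0"
  unfolding minor_leibniz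
proof (intro sum.neutral ballI)
  fix p assume "p \<in> {p. p permutes {0..<n}}"
  then have "p i < n" using assms(1) permutes_in_image[of p "{0..<n}" i] by simp
  then show "signof p * (\<Prod>i=0..<n. A (r i) (c (p i))) = 0"
    using assms by (subst prod_zero) (auto intro!: bexI[of _ i])
qed

text \<open>The increasing enumeration of the indices other than \<open>p\<close>.\<close>

definition skip :: "nat \<Rightarrow> nat \<Rightarrow> nat" where
  "skip p i = (if i < p then i else Suc i)"

lemma skip_less: "i < n \<Longrightarrow> skip p i < Suc n" and skip_neq: "skip p i \<noteq> p"
  by (auto simp: skip_def)

lemma skip_strict_mono: "strict_mono (skip p)"
  by (auto simp: strict_mono_def skip_def)

lemma minor_laplace_column:
  assumes "j \<le> n"
  shows "minor A (Suc n) r c =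
    (\<Sum>i\<le>n. (-1) ^ (i + j) * A (r i) (c j) * minor A n (\<lambda>k. r (skip i k)) (\<lambda>k. c (skip j k)))"
proof -
  let ?M = "Matrix.mat (Suc n) (Suc n) (\<lambda>(i, j). A (r i) (c j))"
  have "minor A (Suc n) r c = (\<Sum>i<Suc n. ?M $$ (i, j) * cofactor ?M i j)"
    unfolding minor_def by (rule laplace_expansion_column) (use assms in auto)
  also have "\<dots> = (\<Sum>i<Suc n. (-1) ^ (i + j) * A (r i) (c j) * minor A n (\<lambda>k. r (skip i k)) (\<lambda>k. c (skip j k)))"
  proof (intro sum.cong refl)
    fix i assume i: "i \<in> {..<Suc n}"
    have "mat_delete ?M i j = Matrix.mat n n (\<lambda>(i', j'). A (r (skip i i')) (c (skip j j')))"
      unfolding mat_delete_def by (rule eq_matI) (auto simp: skip_def)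
    then show "?M $$ (i, j) * cofactor ?M i j =
        (-1) ^ (i + j) * A (r i) (c j) * minor A n (\<lambda>k. r (skip i k)) (\<lambda>k. c (skip j k))"
      using i assms by (simp add: cofactor_def minor_def mult_ac)
  qed
  finally show ?thesis by (simp add: lessThan_Suc_atMost)
qed

lemma minor_unit_column:
  assumes "j \<le> n" "p \<le> n" "\<And>i. i \<le> n \<Longrightarrow> A (r i) (c j) = (if i = p then 1 else 0)"
  shows "minor A (Suc n) r c = (-1) ^ (p + j) * minor A n (\<lambda>k. r (skip p k)) (\<lambda>k. c (skip j k))"
proof -
  have "minor A (Suc n) r c = (\<Sum>i\<le>n. if i = p then
      (-1) ^ (p + j) * minor A n (\<lambda>k. r (skip p k)) (\<lambda>k. c (skip j k)) else 0)"
    unfolding minor_laplace_column[OF assms(1)] by (intro sum.cong refl) (simp add: assms(3))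
  then show ?thesis using assms(2) by simp
qed

text \<open>
  Only the identity permutation contributes to a minor of a matrix whose nonzero entries
  move weakly to the right from one row to the next, as those of a bidiagonal matrix do.
\<close>

lemma minor_staircase:
  assumes stair: "\<And>i i' j j'. i < i' \<Longrightarrow> A i j \<noteq> 0 \<Longrightarrow> A i' j' \<noteq> 0 \<Longrightarrow> j \<le> j'"
    and r: "strict_mono_on {..<n} r" and c: "strict_mono_on {..<n} c"
  shows "minor A n r c = (\<Prod>i<n. A (r i) (c i))"
proof -
  have z: "(\<Prod>i=0..<n. A (r i) (c (p i))) = 0" if p: "p permutes {0..<n}" and "p \<noteq> id" for p
  proof (rule ccontr)
    assume nz: "(\<Prod>i=0..<n. A (r i) (c (p i))) \<noteq> 0"
    have nz': "A (r i) (c (p i)) \<noteq> 0" if "i < n" for i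
    proof
      assume "A (r i) (c (p i)) = 0"
      then have "(\<Prod>i=0..<n. A (r i) (c (p i))) = 0"
        using that by (intro prod_zero) (auto intro!: bexI[of _ i])
      with nz show False ..
    qed
    have pn: "p i < n" if "i < n" for i using permutes_in_image[OF p, of i] that by simp
    have "mono_on {0..<n} p"
    proof (rule mono_onI)
      fix i j assume ij: "i \<in> {0..<n}" "j \<in> {0..<n}" "i \<le> j"
      show "p i \<le> p j"
      proof (cases "i = j")
        case False
        with ij have "c (p i) \<le> c (p j)"
          by (intro stair[OF _ nz' nz']) (auto intro: strict_mono_onD[OF r])
        then show ?thesis
          using strict_mono_onD[OF c, of "p j" "p i"] pn[of i] pn[of j] ij by force
      qed simp
    qed
    moreover have "inj_on p {0..<n}" using p by (rule permutes_inj_on)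
    ultimately have sm: "strict_mono_on {0..<n} p"
      by (intro strict_mono_onI) (metis inj_onD mono_onD less_imp_le less_irrefl order_less_le)
    have ge: "i \<le> p i" if "i < n" for i using that
    proof (induction i)
      case (Suc i)
      then show ?case using strict_mono_onD[OF sm, of i "Suc i"] by simp
    qed simp
    have "p i = i" if "i < n" for i using that
    proof (induction i rule: less_induct)
      case (less i)
      obtain j where j: "p j = i" using permutes_surj[OF p] by (metis surjD)
      have "j < n" using permutes_in_image[OF p, of j] j less.prems by simp
      then show ?case using ge[of j] less.IH[of j] less.prems j by fastforce
    qed
    then have "p = id" using p by (auto simp: permutes_def fun_eq_iff)
    with \<open>p \<noteq> id\<close> show False ..
  qed
  have "minor A n r c = (\<Sum>p \<in> {id}. signof p * (\<Prod>i=0..<n. A (r i) (c (p i))))"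
    unfolding minor_leibniz
    by (rule sum.mono_neutral_right) (auto simp: z permutes_id finite_permutations)
  then show ?thesis by (simp add: atLeast0LessThan)
qed

subsection \<open>Cauchy--Binet\<close>

definition enum_set :: "nat set \<Rightarrow> nat \<Rightarrow> nat" where
  "enum_set R i = sorted_list_of_set R ! i"

lemma strict_mono_enum_set: "finite R \<Longrightarrow> strict_mono_on {..<card R} (enum_set R)"
  by (auto simp: strict_mono_on_def enum_set_def intro!: sorted_wrt_nth_less[OF sorted_list_of_set.strict_sorted_key_list_of_set])

lemma bij_betw_enum_set: "finite R \<Longrightarrow> bij_betw (enum_set R) {0..<card R} R"
  unfolding enum_set_def using bij_betw_nth[of "sorted_list_of_set R" "{..<card R}" R]
  by (simp add: atLeast0LessThan)

text \<open>
  Multiplying out the rows of the product gives a sum over all maps \<open>f\<close> from row positions to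
  inner indices. A map that is not injective contributes a minor with two equal rows, and the
  injective ones with image \<open>R\<close> are the enumeration of \<open>R\<close> after a permutation; summing over the
  permutations gives the Leibniz formula of a minor of \<open>A\<close>.
\<close>

theorem Cauchy_Binet:
  fixes A B :: "nat \<Rightarrow> nat \<Rightarrow> 'a::comm_ring_1"
  shows "minor (\<lambda>i j. \<Sum>l<M. A i l * B l j) n r c =
    (\<Sum>R | R \<subseteq> {..<M} \<and> card R = n. minor A n r (enum_set R) * minor B n (enum_set R) c)"
proof -
  let ?F = "{0..<n} \<rightarrow>\<^sub>E {..<M}"
  let ?I = "{f \<in> ?F. inj_on f {0..<n}}"
  define t where "t f = (\<Prod>i=0..<n. A (r i) (f i)) * minor B n f c" for f
  have finF: "finite ?F" by (intro finite_PiE) auto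
  have "minor (\<lambda>i j. \<Sum>l<M. A i l * B l j) n r c =
    (\<Sum>p | p permutes {0..<n}. \<Sum>f\<in>?F. signof p * (\<Prod>i=0..<n. A (r i) (f i) * B (f i) (c (p i))))"
    unfolding minor_leibniz by (subst prod_sum_PiE) (auto simp: sum_distrib_left)
  also have "\<dots> = (\<Sum>f\<in>?F. t f)"
    by (subst sum.swap) (simp add: t_def minor_leibniz sum_distrib_left prod.distrib mult_ac)
  also have "\<dots> = (\<Sum>f\<in>?I. t f)"
  proof (rule sum.mono_neutral_right)
    show "\<forall>f\<in>?F - ?I. t f = 0"
    proof
      fix f assume "f \<in> ?F - ?I"
      then obtain i j where "i < n" "j < n" "i \<noteq> j" "f i = f j" by (auto simp: inj_on_def)
      then show "t f = 0" unfolding t_def by (subst minor_eq_rows[of i n j]) auto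
    qed
  qed (use finF in auto)
  also have "\<dots> = (\<Sum>R | R \<subseteq> {..<M} \<and> card R = n. \<Sum>f | f \<in> ?I \<and> f ` {0..<n} = R. t f)"
  proof -
    have "(\<lambda>f. f ` {0..<n}) ` ?I \<subseteq> {R. R \<subseteq> {..<M} \<and> card R = n}"
      by (auto simp: card_image)
    from sum.group[OF _ _ this, of t] show ?thesis
      using finF by (auto simp: finite_subset[of "{R. R \<subseteq> {..<M} \<and> card R = n}" "Pow {..<M}"])
  qed
  also have "\<dots> = (\<Sum>R | R \<subseteq> {..<M} \<and> card R = n. minor A n r (enum_set R) * minor B n (enum_set R) c)"
  proof (intro sum.cong refl)
    fix R assume "R \<in> {R. R \<subseteq> {..<M} \<and> card R = n}"
    then have R: "R \<subseteq> {..<M}" "card R = n" by auto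
    then have finR: "finite R" by (auto intro: finite_subset)
    define K where "K = enum_set R"
    have K: "bij_betw K {0..<n} R" unfolding K_def using bij_betw_enum_set[OF finR] R by simp
    define g where "g p = restrict (K \<circ> p) {0..<n}" for p
    have inj: "inj_on g {p. p permutes {0..<n}}"
    proof (rule inj_onI)
      fix p p' assume p: "p \<in> {p. p permutes {0..<n}}" "p' \<in> {p. p permutes {0..<n}}" and eq: "g p = g p'"
      have "p i = p' i" for i
      proof (cases "i < n")
        case True
        then have "K (p i) = K (p' i)" using fun_cong[OF eq, of i] by (simp add: g_def)
        moreover have "p i \<in> {0..<n}" "p' i \<in> {0..<n}"
          using p True permutes_in_image[of _ "{0..<n}" i] by (metis atLeast0LessThan lessThan_iff mem_Collect_eq)+
        ultimately show ?thesis using K by (meson bij_betw_imp_inj_on inj_onD)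
      next
        case False
        then show ?thesis using p by (auto simp: permutes_def)
      qed
      then show "p = p'" by auto
    qed
    have img: "g ` {p. p permutes {0..<n}} = {f. f \<in> ?I \<and> f ` {0..<n} = R}"
    proof (intro equalityI subsetI)
      fix f assume "f \<in> g ` {p. p permutes {0..<n}}"
      then obtain p where p: "p permutes {0..<n}" and f: "f = g p" by auto
      have b: "bij_betw (K \<circ> p) {0..<n} R"
        using permutes_imp_bij[OF p] K by (rule bij_betw_trans)
      then have b': "bij_betw f {0..<n} R" unfolding f g_def by (rule bij_betw_cong[THEN iffD1, rotated]) simp
      then show "f \<in> {f. f \<in> ?I \<and> f ` {0..<n} = R}"
        using R by (auto simp: bij_betw_def) (auto simp: f g_def)
    next
      fix f assume f: "f \<in> {f. f \<in> ?I \<and> f ` {0..<n} = R}"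
      define p where "p i = (if i < n then inv_into {0..<n} K (f i) else i)" for i
      have "bij_betw f {0..<n} R" using f by (auto simp: bij_betw_def)
      then have "bij_betw (inv_into {0..<n} K \<circ> f) {0..<n} {0..<n}"
        using bij_betw_inv_into[OF K] by (rule bij_betw_trans)
      then have "bij_betw p {0..<n} {0..<n}" by (rule bij_betw_cong[THEN iffD1, rotated]) (auto simp: p_def)
      then have p: "p permutes {0..<n}" by (rule bij_imp_permutes) (auto simp: p_def)
      have "f = g p"
      proof
        fix i show "f i = g p i"
        proof (cases "i < n")
          case True
          then have "f i \<in> K ` {0..<n}" using f K by (auto simp: bij_betw_def)
          then show ?thesis using True by (simp add: g_def p_def f_inv_into_f)
        next
          case False
          then show ?thesis using f by (auto simp: g_def PiE_def extensional_def)
        qed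
      qed
      with p show "f \<in> g ` {p. p permutes {0..<n}}" by auto
    qed
    have "(\<Sum>f | f \<in> ?I \<and> f ` {0..<n} = R. t f) = (\<Sum>p | p permutes {0..<n}. t (g p))"
      unfolding img[symmetric] using inj by (simp add: sum.reindex)
    also have "\<dots> = (\<Sum>p | p permutes {0..<n}. signof p * (\<Prod>i=0..<n. A (r i) (K (p i))) * minor B n K c)"
    proof (intro sum.cong refl)
      fix p assume "p \<in> {p. p permutes {0..<n}}"
      then have p: "p permutes {0..<n}" by simp
      have "minor B n (g p) c = minor B n (\<lambda>i. K (p i)) c" by (rule minor_cong) (simp add: g_def)
      then show "t (g p) = signof p * (\<Prod>i=0..<n. A (r i) (K (p i))) * minor B n K c"
        using minor_permute_rows[OF p, of B K c] by (simp add: t_def g_def mult_ac)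
    qed
    also have "\<dots> = minor A n r K * minor B n K c"
      by (simp add: minor_leibniz[of A] sum_distrib_right)
    finally show "(\<Sum>f | f \<in> ?I \<and> f ` {0..<n} = R. t f) =
        minor A n r (enum_set R) * minor B n (enum_set R) c" by (simp add: K_def)
  qed
  finally show ?thesis .
qed


section \<open>Positivity of all minors\<close>

text \<open>
  The cone is that of the nonnegative numbers or of the polynomials with nonnegative
  coefficients. All matrices below are totally positive because they arise from simpler ones
  by steps that express minors by sums and products of minors.
\<close>

locale pos_cone =
  fixes Pos :: "'a::comm_ring_1 \<Rightarrow> bool"
  assumes Pos_0: "Pos 0" and Pos_1: "Pos 1"
    and Pos_add: "Pos a \<Longrightarrow> Pos b \<Longrightarrow> Pos (a + b)"
    and Pos_mult: "Pos a \<Longrightarrow> Pos b \<Longrightarrow> Pos (a * b)"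
begin

lemma Pos_sum: "(\<And>i. i \<in> I \<Longrightarrow> Pos (h i)) \<Longrightarrow> Pos (sum h I)"
  by (induction I rule: infinite_finite_induct) (auto intro: Pos_0 Pos_add)

lemma Pos_prod: "(\<And>i. i \<in> I \<Longrightarrow> Pos (h i)) \<Longrightarrow> Pos (prod h I)"
  by (induction I rule: infinite_finite_induct) (auto intro: Pos_1 Pos_mult)

lemma Pos_power: "Pos a \<Longrightarrow> Pos (a ^ n)"
  by (induction n) (auto intro: Pos_1 Pos_mult)

text \<open>
  The condition on \<open>C\<close> is that \<open>C = A B\<close> where each entry is a sum with finitely many nonzero
  terms; a single minor then only sees a finite number of inner indices.
\<close>

lemma all_minors_product:
  assumes A: "all_minors Pos A" and B: "all_minors Pos B"
    and C: "\<And>n k. \<exists>M0. \<forall>M\<ge>M0. C n k = (\<Sum>l<M. A n l * B l k)"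
  shows "all_minors Pos C"
  unfolding all_minors_def
proof (intro allI impI, elim conjE)
  fix n :: nat and r c :: "nat \<Rightarrow> nat" assume r: "strict_mono_on {..<n} r" and c: "strict_mono_on {..<n} c"
  obtain M0 where M0: "\<And>n k M. M \<ge> M0 n k \<Longrightarrow> C n k = (\<Sum>l<M. A n l * B l k)"
    using C by metis
  define M where "M = (\<Sum>i<n. \<Sum>j<n. M0 (r i) (c j))"
  have "M0 (r i) (c j) \<le> M" if "i < n" "j < n" for i j
  proof -
    have "M0 (r i) (c j) \<le> (\<Sum>j<n. M0 (r i) (c j))" using that by (intro member_le_sum) auto
    also have "\<dots> \<le> M" unfolding M_def using that by (intro member_le_sum) auto
    finally show ?thesis .
  qed
  then have "minor C n r c = minor (\<lambda>i j. \<Sum>l<M. A i l * B l j) n r c"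
    by (intro minor_cong M0) auto
  also have "Pos \<dots>"
    unfolding Cauchy_Binet
  proof (intro Pos_sum Pos_mult)
    fix R assume "R \<in> {R. R \<subseteq> {..<M} \<and> card R = n}"
    then have "strict_mono_on {..<n} (enum_set R)"
      using strict_mono_enum_set[of R] by (auto dest: finite_subset)
    then show "Pos (minor A n r (enum_set R))" "Pos (minor B n (enum_set R) c)"
      using A B r c by (auto simp: all_minors_def)
  qed
  finally show "Pos (minor C n r c)" .
qed

text \<open>
  A minor containing the new row \<open>0\<close> vanishes unless it contains the column \<open>0\<close>, too, and then its
  expansion along that row is a minor of \<open>B\<close>.
\<close>

lemma all_minors_unit_first_row:
  assumes B: "all_minors Pos B" and A0: "\<And>k. A 0 k = (if k = 0 then 1 else 0)"
    and AS: "\<And>n k. A (Suc n) k = B n k"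
  shows "all_minors Pos A"
  unfolding all_minors_def
proof (intro allI impI, elim conjE)
  fix n :: nat and r c :: "nat \<Rightarrow> nat" assume r: "strict_mono_on {..<n} r" and c: "strict_mono_on {..<n} c"
  show "Pos (minor A n r c)"
  proof (cases n)
    case 0
    then show ?thesis by (simp add: Pos_1)
  next
    case (Suc m)
    have r_pos: "r i > 0" if "i < n" "r 0 > 0 \<or> i > 0" for i
      using strict_mono_onD[OF r, of 0 i] that by (cases "i = 0") auto
    have c_pos: "c i > 0" if "i < n" "c 0 > 0 \<or> i > 0" for i
      using strict_mono_onD[OF c, of 0 i] that by (cases "i = 0") auto
    have shift: "strict_mono_on {..<k} (\<lambda>i. r (i + s) - 1)"
      if "k + s \<le> n" "r 0 > 0 \<or> s > 0" for k s
    proof (rule strict_mono_onI)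
      fix i j assume "i \<in> {..<k}" "j \<in> {..<k}" "i < j"
      then show "r (i + s) - 1 < r (j + s) - 1"
        using strict_mono_onD[OF r, of "i + s" "j + s"] r_pos[of "i + s"] that by force
    qed
    consider "r 0 > 0" | "r 0 = 0" "c 0 > 0" | "r 0 = 0" "c 0 = 0" by auto
    then show ?thesis
    proof cases
      case 1
      have "minor A n r c = minor B n (\<lambda>i. r (i + 0) - 1) c"
        by (rule minor_cong) (use 1 in \<open>auto simp: AS[symmetric] r_pos\<close>)
      then show ?thesis using B c shift[of n 0] 1 by (auto simp: all_minors_def)
    next
      case 2
      then have "minor A n r c = 0"
        using c_pos by (intro minor_zero_row[of 0]) (auto simp: A0 Suc)
      then show ?thesis by (simp add: Pos_0)
    next
      case 3
      have "A (r 0) (c i) = (if i = 0 then 1 else 0)" if "i \<le> m" for i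
        using 3 c_pos[of i] that by (cases "i = 0") (auto simp: A0 Suc)
      then have "minor (\<lambda>i j. A j i) (Suc m) c r =
          minor (\<lambda>i j. A j i) m (\<lambda>k. c (skip 0 k)) (\<lambda>k. r (skip 0 k))"
        using minor_unit_column[of 0 m 0 "\<lambda>i j. A j i" c r] by simp
      then have "minor A n r c = minor A m (\<lambda>k. r (skip 0 k)) (\<lambda>k. c (skip 0 k))"
        by (simp only: minor_transpose[of A] Suc)
      also have "\<dots> = minor B m (\<lambda>i. r (i + 1) - 1) (\<lambda>i. c (i + 1))"
        by (rule minor_cong) (auto simp: AS[symmetric] r_pos skip_def Suc)
      also have "Pos \<dots>"
        using B c shift[of m 1] by (auto simp: all_minors_def Suc strict_mono_on_def)
      finally show ?thesis .
    qed
  qed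
qed

text \<open>
  The rows of \<open>G\<close> are those of \<open>e\<^sub>0, e\<^sub>0 P, e\<^sub>0 P\<^sup>2, \<dots>\<close>: total positivity of \<open>P\<close> is inherited by \<open>G\<close>
  since \<open>G\<close> is the product \<open>G P\<close> with the row \<open>e\<^sub>0\<close> put on top, which is not circular when
  the rows of \<open>G\<close> are switched on one at a time.
\<close>

lemma all_minors_iterated_rows:
  assumes P: "all_minors Pos P" and G0: "\<And>k. G 0 k = (if k = 0 then 1 else 0)"
    and GS: "\<And>n k. \<exists>M0. \<forall>M\<ge>M0. G (Suc n) k = (\<Sum>l<M. G n l * P l k)"
  shows "all_minors Pos G"
proof -
  have trunc: "all_minors Pos (\<lambda>n k. if n \<le> N then G n k else 0)" for N
  proof (induction N)
    case 0
    have "all_minors Pos (\<lambda>_ _. 0)"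
      unfolding all_minors_def
    proof (intro allI impI)
      fix n :: nat and r c
      show "Pos (minor (\<lambda>_ _. 0) n r c)"
        by (cases "n = 0") (auto simp: Pos_0 Pos_1 minor_zero_row[of 0])
    qed
    then show ?case by (rule all_minors_unit_first_row) (auto simp: G0)
  next
    case (Suc N)
    have "all_minors Pos (\<lambda>n k. if n \<le> N then G (Suc n) k else 0)"
    proof (rule all_minors_product[OF Suc P])
      fix n k
      show "\<exists>M0. \<forall>M\<ge>M0. (if n \<le> N then G (Suc n) k else 0) =
          (\<Sum>l<M. (if n \<le> N then G n l else 0) * P l k)"
        using GS[of n k] by auto
    qed
    then show ?case by (rule all_minors_unit_first_row) (auto simp: G0)
  qed
  show ?thesis
    unfolding all_minors_def
  proof (intro allI impI)
    fix n :: nat and r c :: "nat \<Rightarrow> nat" assume *: "strict_mono_on {..<n} r \<and> strict_mono_on {..<n} c"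
    define N where "N = (\<Sum>i<n. r i)"
    have "r i \<le> N" if "i < n" for i unfolding N_def using that by (intro member_le_sum) auto
    then have "minor G n r c = minor (\<lambda>n k. if n \<le> N then G n k else 0) n r c"
      by (intro minor_cong) auto
    then show "Pos (minor G n r c)" using trunc[of N] * by (auto simp: all_minors_def)
  qed
qed

lemma all_minors_transpose: "all_minors Pos A \<Longrightarrow> all_minors Pos (\<lambda>i j. A j i)"
  unfolding all_minors_def by (metis minor_transpose[of A])

lemma all_minors_staircase:
  assumes "\<And>i i' j j'. i < i' \<Longrightarrow> A i j \<noteq> 0 \<Longrightarrow> A i' j' \<noteq> 0 \<Longrightarrow> j \<le> j'" "\<And>i j. Pos (A i j)"
  shows "all_minors Pos A"
  unfolding all_minors_def using minor_staircase[of A] assms by (auto intro: Pos_prod)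

end

lemma minor_scale:
  "minor (\<lambda>n k. d n * A n k * e k) n r c = (\<Prod>i<n. d (r i)) * (\<Prod>i<n. e (c i)) * minor A n r c"
proof -
  have "(\<Prod>i=0..<n. d (r i) * A (r i) (c (p i)) * e (c (p i))) =
      (\<Prod>i<n. d (r i)) * (\<Prod>i<n. e (c i)) * (\<Prod>i=0..<n. A (r i) (c (p i)))"
    if "p permutes {0..<n}" for p
  proof -
    have "(\<Prod>i=0..<n. e (c (p i))) = (\<Prod>i=0..<n. e (c i))"
      using prod.permute[OF that, of "\<lambda>i. e (c i)"] by (simp add: o_def)
    then show ?thesis by (simp add: prod.distrib atLeast0LessThan mult_ac)
  qed
  then show ?thesis
    unfolding minor_leibniz sum_distrib_left by (intro sum.cong) (auto simp: mult_ac)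
qed

lemma TP_scale:
  assumes "TP A" "\<And>n. d n \<ge> 0" "\<And>n. e n \<ge> 0"
  shows "TP (\<lambda>n k. d n * A n k * e k)"
  using assms by (auto simp: TP_def all_minors_def minor_scale intro!: mult_nonneg_nonneg prod_nonneg)

text \<open>
  The embedding \<open>\<iota>\<close> of the scalars makes the real numbers and the rings of real polynomials in
  one and two variables instances of one development.
\<close>

locale real_algebra =
  fixes \<iota> :: "real \<Rightarrow> 'a::comm_ring_1"
  assumes \<iota>_1: "\<iota> 1 = 1" and \<iota>_add: "\<iota> (a + b) = \<iota> a + \<iota> b" and \<iota>_mult: "\<iota> (a * b) = \<iota> a * \<iota> b"
begin

lemma \<iota>_0: "\<iota> 0 = 0"
  using \<iota>_add[of 0 0] by simp

lemma \<iota>_minus: "\<iota> (- a) = - \<iota> a"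
  using \<iota>_add[of a "- a"] by (simp add: \<iota>_0 eq_neg_iff_add_eq_0 add.commute)

lemma \<iota>_sum: "\<iota> (sum h I) = (\<Sum>i\<in>I. \<iota> (h i))"
  by (induction I rule: infinite_finite_induct) (auto simp: \<iota>_0 \<iota>_add)

lemma \<iota>_prod: "\<iota> (prod h I) = (\<Prod>i\<in>I. \<iota> (h i))"
  by (induction I rule: infinite_finite_induct) (auto simp: \<iota>_1 \<iota>_mult)

lemma \<iota>_signof: "\<iota> (signof p) = signof p"
  by (simp add: sign_def \<iota>_1 \<iota>_minus)

lemma \<iota>_of_nat: "\<iota> (of_nat n) = of_nat n"
  by (induction n) (auto simp: \<iota>_0 \<iota>_1 \<iota>_add)

end

locale real_algebra_cone = pos_cone Pos + real_algebra \<iota>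
  for Pos :: "'a::comm_ring_1 \<Rightarrow> bool" and \<iota> :: "real \<Rightarrow> 'a" +
  assumes Pos_\<iota>: "a \<ge> 0 \<Longrightarrow> Pos (\<iota> a)"
begin

text \<open>Grading by \<open>y\<close> multiplies a minor by a power of \<open>y\<close>, by homogeneity.\<close>

lemma minor_graded:
  assumes low: "\<And>n k. n < k \<Longrightarrow> A n k = 0"
  shows "minor (\<lambda>n k. \<iota> (A n k) * y ^ (n - k)) n r c =
    y ^ ((\<Sum>i<n. r i) - (\<Sum>i<n. c i)) * \<iota> (minor A n r c)"
proof -
  let ?e = "(\<Sum>i<n. r i) - (\<Sum>i<n. c i)"
  have "(\<Prod>i=0..<n. \<iota> (A (r i) (c (p i))) * y ^ (r i - c (p i))) =
      y ^ ?e * \<iota> (\<Prod>i=0..<n. A (r i) (c (p i)))" if p: "p permutes {0..<n}" for p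
  proof (cases "\<forall>i<n. c (p i) \<le> r i")
    case True
    have "(\<Sum>i<n. c (p i)) = (\<Sum>i<n. c i)"
      using sum.permute[OF p, of c] by (simp add: o_def atLeast0LessThan)
    then have "(\<Sum>i<n. r i - c (p i)) = ?e"
      using True by (subst sum_subtractf_nat) auto
    then have "(\<Prod>i=0..<n. y ^ (r i - c (p i))) = y ^ ?e"
      by (simp add: power_sum[symmetric] atLeast0LessThan)
    then show ?thesis by (simp add: prod.distrib \<iota>_prod mult_ac)
  next
    case False
    then obtain i where i: "i < n" "A (r i) (c (p i)) = 0" using low by (meson not_le)
    then have "(\<Prod>i=0..<n. A (r i) (c (p i))) = 0"
        "(\<Prod>i=0..<n. \<iota> (A (r i) (c (p i))) * y ^ (r i - c (p i))) = 0"
      by (auto intro!: prod_zero bexI[of _ i] simp: \<iota>_0)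
    then show ?thesis by (simp only: \<iota>_0 mult_zero_right)
  qed
  then show ?thesis
    unfolding minor_leibniz by (simp add: \<iota>_sum sum_distrib_left \<iota>_mult \<iota>_signof mult_ac)
qed

lemma all_minors_graded:
  assumes "TP A" "\<And>n k. n < k \<Longrightarrow> A n k = 0" "Pos y"
  shows "all_minors Pos (\<lambda>n k. \<iota> (A n k) * y ^ (n - k))"
  using assms by (auto simp: all_minors_def TP_def minor_graded intro!: Pos_mult Pos_power Pos_\<iota>)

end

section \<open>Complementary minors\<close>

lemma minor_mult:
  "minor (\<lambda>i j. \<Sum>l<n. A i l * B l j) n id id = minor A n id id * minor B n id id"
proof -
  have "minor (\<lambda>i j. \<Sum>l<n. A i l * B l j) n id id =
      Determinant.det (Matrix.mat n n (\<lambda>(i, j). A i j) * Matrix.mat n n (\<lambda>(i, j). B i j))"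
    unfolding minor_def
    by (intro arg_cong[of _ _ Determinant.det] eq_matI)
       (auto simp: scalar_prod_def atLeast0LessThan)
  then show ?thesis unfolding minor_def by (subst (asm) det_mult[of _ n]) auto
qed

lemma minor_lower_triangular:
  assumes "\<And>i j. i < j \<Longrightarrow> A i j = 0"
  shows "minor A n id id = (\<Prod>i<n. A i i)"
proof -
  have "minor A n id id = prod_list (diag_mat (Matrix.mat n n (\<lambda>(i, j). A i j)))"
    unfolding minor_def using assms by (subst det_lower_triangular[of n]) auto
  also have "\<dots> = (\<Prod>i<n. A i i)"
    unfolding prod_list_diag_prod by (simp add: atLeast0LessThan)
  finally show ?thesis .
qed

text \<open>
  Striking out the last unit column first leaves the positions of the others unchanged, so that
  the signs of the successive Laplace expansions simply multiply up.
\<close>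

lemma minor_strike_unit_columns:
  assumes "strict_mono_on {..<k} r" "strict_mono_on {..<k} c"
    and "\<And>s. s < k \<Longrightarrow> r s < n" "\<And>s. s < k \<Longrightarrow> c s < n"
    and "\<And>i s. i < n \<Longrightarrow> s < k \<Longrightarrow> A i (c s) = (if i = r s then 1 else 0)"
  shows "\<exists>r' c'. strict_mono_on {..<n - k} r' \<and> strict_mono_on {..<n - k} c' \<and>
    (\<forall>i<n - k. r' i < n \<and> c' i < n \<and> r' i \<notin> r ` {..<k} \<and> c' i \<notin> c ` {..<k}) \<and>
    minor A n id id = (-1) ^ (\<Sum>s<k. r s + c s) * minor A (n - k) r' c'"
  using assms
proof (induction k arbitrary: n A)
  case 0
  show ?case by (intro exI[of _ id]) (auto simp: strict_mono_on_def)
next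
  case (Suc k)
  obtain m where n: "n = Suc m" using Suc.prems(3)[of k] by (cases n) auto
  let ?r = "skip (r k)" and ?c = "skip (c k)"
  define B where "B i j = A (?r i) (?c j)" for i j
  have lt: "r s < r k" "c s < c k" if "s < k" for s
    using that Suc.prems(1,2) by (auto intro: strict_mono_onD)
  have rk: "r k \<le> m" "c k \<le> m" using Suc.prems(3,4)[of k] n by auto
  have A: "minor A n id id = (-1) ^ (r k + c k) * minor B m id id"
  proof -
    have "minor A (Suc m) id id =
        (-1) ^ (r k + c k) * minor A m (\<lambda>i. id (?r i)) (\<lambda>i. id (?c i))"
      by (rule minor_unit_column) (use rk n Suc.prems(5) in auto)
    also have "minor A m (\<lambda>i. id (?r i)) (\<lambda>i. id (?c i)) = minor B m id id"
      by (rule minor_cong) (simp add: B_def)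
    finally show ?thesis by (simp only: n)
  qed
  have "B i (c s) = (if i = r s then 1 else 0)" if "i < m" "s < k" for i s
  proof -
    have "B i (c s) = A (?r i) (c s)" using lt[OF that(2)] by (simp add: B_def skip_def)
    also have "\<dots> = (if ?r i = r s then 1 else 0)"
      using that n by (intro Suc.prems(5)) (auto simp: skip_less)
    also have "?r i = r s \<longleftrightarrow> i = r s" using lt[OF that(2)] by (auto simp: skip_def)
    finally show ?thesis .
  qed
  moreover have "strict_mono_on {..<k} r" "strict_mono_on {..<k} c"
    using Suc.prems(1,2) by (auto simp: strict_mono_on_def)
  moreover have "r s < m" "c s < m" if "s < k" for s
    using lt[OF that] rk by auto
  ultimately have "\<exists>r' c'. strict_mono_on {..<m - k} r' \<and> strict_mono_on {..<m - k} c' \<and>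
      (\<forall>i<m - k. r' i < m \<and> c' i < m \<and> r' i \<notin> r ` {..<k} \<and> c' i \<notin> c ` {..<k}) \<and>
      minor B m id id = (-1) ^ (\<Sum>s<k. r s + c s) * minor B (m - k) r' c'"
    by (intro Suc.IH) auto
  then obtain r' c' where IH: "strict_mono_on {..<m - k} r'" "strict_mono_on {..<m - k} c'"
      "\<And>i. i < m - k \<Longrightarrow> r' i < m \<and> c' i < m \<and> r' i \<notin> r ` {..<k} \<and> c' i \<notin> c ` {..<k}"
      "minor B m id id = (-1) ^ (\<Sum>s<k. r s + c s) * minor B (m - k) r' c'"
    by blast
  have notin: "?r (r' i) \<notin> r ` {..<Suc k}" "?c (c' i) \<notin> c ` {..<Suc k}" if "i < m - k" for i
  proof -
    have "?r (r' i) \<noteq> r s" "?c (c' i) \<noteq> c s" if "s < k" for s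
      using lt[OF that] IH(3)[OF \<open>i < m - k\<close>] that by (auto simp: skip_def)
    then show "?r (r' i) \<notin> r ` {..<Suc k}" "?c (c' i) \<notin> c ` {..<Suc k}"
      unfolding lessThan_Suc image_insert by (metis imageE insertE lessThan_iff skip_neq)+
  qed
  have "strict_mono_on {..<m - k} (\<lambda>i. ?r (r' i))" "strict_mono_on {..<m - k} (\<lambda>i. ?c (c' i))"
    using IH(1,2) skip_strict_mono by (auto simp: strict_mono_on_def strict_mono_def)
  moreover have "minor A n id id =
      (-1) ^ (\<Sum>s<Suc k. r s + c s) * minor A (m - k) (\<lambda>i. ?r (r' i)) (\<lambda>i. ?c (c' i))"
    unfolding A IH(4) by (simp add: power_add B_def minor_def)
  moreover have "n - Suc k = m - k" using n by simp
  moreover have "\<forall>i<m - k. ?r (r' i) < n \<and> ?c (c' i) < n \<and>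
      ?r (r' i) \<notin> r ` {..<Suc k} \<and> ?c (c' i) \<notin> c ` {..<Suc k}"
    using IH(3) notin n by (auto simp: skip_less)
  ultimately show ?case
    by (intro exI[of _ "\<lambda>i. ?r (r' i)"] exI[of _ "\<lambda>i. ?c (c' i)"] conjI) (simp_all only: id_def)
qed

text \<open>
  No signs occur when a row and a column of the same index are struck out.
\<close>

lemma minor_strike_diagonal_units:
  assumes "strict_mono_on {..<k} r" "\<And>s. s < k \<Longrightarrow> r s < n"
    and "\<And>i p. i < n \<Longrightarrow> p < n \<Longrightarrow> p \<notin> r ` {..<k} \<Longrightarrow> A i p = (if i = p then 1 else 0)"
  shows "minor A n id id = minor A k r r"
  using assms
proof (induction n arbitrary: A r)
  case 0
  then have "k = 0" by (cases k) auto
  then show ?case by simp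
next
  case (Suc m)
  show ?case
  proof (cases "r ` {..<k} = {..<Suc m}")
    case True
    have "sorted_wrt (<) (map r [0..<k])"
      unfolding sorted_wrt_map
      by (rule sorted_wrt_mono_rel[of _ "(<)"]) (auto intro: strict_mono_onD[OF Suc.prems(1)])
    then have eq: "map r [0..<k] = [0..<Suc m]"
      by (intro strict_sorted_equal) (use True in \<open>auto simp: atLeast0LessThan simp del: upt_Suc\<close>)
    have k: "k = Suc m" using arg_cong[OF eq, of length] by simp
    have "r i = i" if "i < k" for i
      using arg_cong[OF eq, of "\<lambda>xs. xs ! i"] that k by (simp del: upt_Suc)
    then show ?thesis unfolding k by (intro minor_cong) auto
  next
    case False
    then obtain p where p: "p < Suc m" "p \<notin> r ` {..<k}" using Suc.prems(2) by auto
    define B where "B i j = A (skip p i) (skip p j)" for i j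
    define r' where "r' s = (if r s < p then r s else r s - 1)" for s
    have r': "skip p (r' s) = r s" if "s < k" for s
    proof -
      have "r s \<noteq> p" using that p by auto
      then show ?thesis by (auto simp: r'_def skip_def)
    qed
    have "minor A (Suc m) id id = (-1) ^ (p + p) * minor A m (\<lambda>i. id (skip p i)) (\<lambda>i. id (skip p i))"
      by (rule minor_unit_column) (use p Suc.prems(3) in auto)
    also have "\<dots> = minor B m id id" by (simp add: B_def minor_def)
    also have "\<dots> = minor B k r' r'"
    proof (rule Suc.IH)
      show "strict_mono_on {..<k} r'"
      proof (rule strict_mono_onI)
        fix i j assume ij: "i \<in> {..<k}" "j \<in> {..<k}" "i < j"
        have "skip p (r' i) < skip p (r' j)"
          using ij strict_mono_onD[OF Suc.prems(1), of i j] by (simp add: r')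
        then show "r' i < r' j" by (auto simp: skip_def split: if_splits)
      qed
      show "r' s < m" if "s < k" for s
        using r'[OF that] Suc.prems(2)[OF that] p by (auto simp: skip_def split: if_splits)
      fix i q assume iq: "i < m" "q < m" "q \<notin> r' ` {..<k}"
      have "skip p q \<notin> r ` {..<k}"
      proof
        assume "skip p q \<in> r ` {..<k}"
        then obtain s where "s < k" "skip p q = skip p (r' s)" using r' by force
        then have "q = r' s" using strict_mono_eq[OF skip_strict_mono] by blast
        with \<open>s < k\<close> iq show False by blast
      qed
      then show "B i q = (if i = q then 1 else 0)"
        using iq strict_mono_eq[OF skip_strict_mono] by (simp add: B_def Suc.prems(3) skip_less)
    qed
    also have "\<dots> = minor A k r r" by (rule minor_cong) (simp add: B_def r')
    finally show ?thesis .
  qed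
qed

text \<open>
  Jacobi's complementary minor formula: replacing columns of the identity by columns of \<open>B\<close> gives
  a matrix \<open>C\<close> whose determinant is the minor of \<open>B\<close>, while \<open>A C\<close> consists of columns of \<open>A\<close> and
  of unit columns and thus has a minor of \<open>A\<close> as its determinant, up to sign.
\<close>

theorem TP_signed_inverse:
  assumes A: "TP A" and lowA: "\<And>n k. n < k \<Longrightarrow> A n k = 0" and diag: "\<And>n. A n n > 0"
    and AB: "\<And>n k. (\<Sum>j\<le>n. A n j * B j k) = (if n = k then 1 else 0)"
  shows "TP (\<lambda>n k. (-1) ^ n * B n k * (-1) ^ k)"
  unfolding TP_def all_minors_def
proof (intro allI impI, elim conjE)
  fix k :: nat and r c :: "nat \<Rightarrow> nat"
  assume r: "strict_mono_on {..<k} r" and c: "strict_mono_on {..<k} c"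
  define N where "N = Suc ((\<Sum>i<k. r i) + (\<Sum>i<k. c i))"
  have N: "r s < N" "c s < N" if "s < k" for s
    using that member_le_sum[of s "{..<k}" r] member_le_sum[of s "{..<k}" c] by (auto simp: N_def)
  \<comment> \<open>The columns listed by \<open>r\<close> of the identity matrix are replaced by the columns \<open>c\<close> of \<open>B\<close>.\<close>
  define C where "C i p = (if p \<in> r ` {..<k} then B i (c (inv_into {..<k} r p))
      else if i = p then 1 else 0)" for i p
  have Cr: "C i (r s) = B i (c s)" if "s < k" for i s
    using that inv_into_f_f[OF strict_mono_on_imp_inj_on[OF r], of s] by (simp add: C_def)
  define D where "D i p = (\<Sum>l<N. A i l * C l p)" for i p
  have detC: "minor C N id id = minor B k r c"
  proof -
    have "minor C N id id = minor C k r r"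
      by (rule minor_strike_diagonal_units[OF r]) (auto simp: N C_def)
    also have "\<dots> = minor B k r c" by (rule minor_cong) (simp add: Cr)
    finally show ?thesis .
  qed
  have "D i (r s) = (if i = c s then 1 else 0)" if "i < N" "s < k" for i s
  proof -
    have "D i (r s) = (\<Sum>l\<le>i. A i l * B l (c s))"
      unfolding D_def by (rule sum.mono_neutral_cong_right) (use that in \<open>auto simp: Cr lowA\<close>)
    then show ?thesis by (simp add: AB)
  qed
  then have "\<exists>r' c'. strict_mono_on {..<N - k} r' \<and> strict_mono_on {..<N - k} c' \<and>
      (\<forall>i<N - k. r' i < N \<and> c' i < N \<and> r' i \<notin> c ` {..<k} \<and> c' i \<notin> r ` {..<k}) \<and>
      minor D N id id = (-1) ^ (\<Sum>s<k. c s + r s) * minor D (N - k) r' c'"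
    by (intro minor_strike_unit_columns[OF c r] N)
  then obtain r' c' where rc': "strict_mono_on {..<N - k} r'" "strict_mono_on {..<N - k} c'"
      "\<And>i. i < N - k \<Longrightarrow> c' i < N \<and> c' i \<notin> r ` {..<k}"
      "minor D N id id = (-1) ^ (\<Sum>s<k. c s + r s) * minor D (N - k) r' c'"
    by blast
  have "D i (c' j) = A i (c' j)" if "j < N - k" for i j
    using rc'(3)[OF that] by (simp add: D_def C_def if_distrib cong: if_cong)
  then have "minor D (N - k) r' c' = minor A (N - k) r' c'" by (intro minor_cong) auto
  then have nonneg: "minor D (N - k) r' c' \<ge> 0" using A rc'(1,2) by (auto simp: TP_def all_minors_def)
  define e :: real where "e = (-1) ^ (\<Sum>s<k. c s + r s)"
  have e: "e * e = 1" by (simp add: e_def flip: power_add)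
  have "minor D N id id = (\<Prod>i<N. A i i) * minor B k r c"
    unfolding D_def minor_mult detC by (simp add: minor_lower_triangular lowA)
  then have PB: "(\<Prod>i<N. A i i) * minor B k r c = e * minor D (N - k) r' c'"
    unfolding rc'(4) e_def by simp
  have "minor (\<lambda>n k. (-1) ^ n * B n k * (-1) ^ k) k r c = e * minor B k r c"
    unfolding minor_scale by (simp add: e_def power_sum[symmetric] sum.distrib power_add)
  then have "(\<Prod>i<N. A i i) * minor (\<lambda>n k. (-1) ^ n * B n k * (-1) ^ k) k r c =
      e * ((\<Prod>i<N. A i i) * minor B k r c)" by simp
  also have "\<dots> = minor D (N - k) r' c'" unfolding PB by (simp add: e flip: mult.assoc)
  finally have "(\<Prod>i<N. A i i) * minor (\<lambda>n k. (-1) ^ n * B n k * (-1) ^ k) k r c \<ge> 0"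
    using nonneg by simp
  moreover have "(\<Prod>i<N. A i i) > 0" using diag by (intro prod_pos) auto
  ultimately show "minor (\<lambda>n k. (-1) ^ n * B n k * (-1) ^ k) k r c \<ge> 0"
    by (intro mult_left_le_imp_le[of "\<Prod>i<N. A i i" 0]) simp_all
qed

section \<open>Principal minors and positive semidefiniteness\<close>

text \<open>
  One step of Gaussian elimination with the pivot \<open>A 0 0\<close>.
\<close>

lemma minor_Schur_complement:
  fixes A :: "nat \<Rightarrow> nat \<Rightarrow> real"
  assumes "A 0 0 \<noteq> 0"
  shows "minor A (Suc n) (case_nat 0 (\<lambda>i. Suc (r i))) (case_nat 0 (\<lambda>i. Suc (c i))) =
    A 0 0 * minor (\<lambda>i j. A (Suc i) (Suc j) - A (Suc i) 0 * A 0 (Suc j) / A 0 0) n r c"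
proof -
  let ?r = "case_nat 0 (\<lambda>i. Suc (r i))" and ?c = "case_nat 0 (\<lambda>i. Suc (c i))"
  define E where "E i l = (if i = l then 1 else if l = 0 then - A (?r i) 0 / A 0 0 else 0)" for i l :: nat
  define M where "M i j = A (?r i) (?c j)" for i j
  define D where "D i j = (\<Sum>l<Suc n. E i l * M l j)" for i j
  have D: "D i j = (if i = 0 then M 0 j else M i j - A (?r i) 0 / A 0 0 * M 0 j)" if "i \<le> n" for i j
  proof -
    have "E i l * M l j = (if l = i then M i j else 0) +
        (if l = 0 then if i = 0 then 0 else - A (?r i) 0 / A 0 0 * M 0 j else 0)" for l
      by (auto simp: E_def)
    then have "D i j = M i j + (if i = 0 then 0 else - A (?r i) 0 / A 0 0 * M 0 j)"
      unfolding D_def using that by (simp only: sum.distrib) (simp add: less_Suc_eq_le del: sum.lessThan_Suc)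
    then show ?thesis using that by auto
  qed
  have "minor D (Suc n) id id = minor E (Suc n) id id * minor M (Suc n) id id"
    unfolding D_def by (rule minor_mult)
  also have "minor E (Suc n) id id = 1" by (subst minor_lower_triangular) (auto simp: E_def)
  also have "minor M (Suc n) id id = minor A (Suc n) ?r ?c" by (simp add: M_def minor_def)
  also have "minor D (Suc n) id id = (\<Sum>i\<le>n. if i = 0 then A 0 0 * minor D n (\<lambda>k. id (skip 0 k)) (\<lambda>k. id (skip 0 k)) else 0)"
    by (subst minor_laplace_column[of 0])
       (auto intro!: sum.cong simp del: sum.atMost_Suc sum.delta sum.delta' simp: D M_def assms split: nat.split)
  also have "minor D n (\<lambda>k. id (skip 0 k)) (\<lambda>k. id (skip 0 k)) =
      minor (\<lambda>i j. A (Suc i) (Suc j) - A (Suc i) 0 * A 0 (Suc j) / A 0 0) n r c"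
    by (rule minor_cong) (simp add: D skip_def M_def)
  finally show ?thesis by simp
qed

lemma minor_1: "minor A (Suc 0) r c = A (r 0) (c 0)"
  by (subst minor_laplace_column[of 0]) auto

lemma minor_2: "minor A (Suc (Suc 0)) r c = A (r 0) (c 0) * A (r 1) (c 1) - A (r 1) (c 0) * A (r 0) (c 1)"
  by (subst minor_laplace_column[of 0]) (auto simp: minor_1 skip_def)

text \<open>
  By induction on the number of variables. If \<open>A 0 0 > 0\<close>, completing the square in \<open>c 0\<close> leaves
  the form of the Schur complement, whose principal minors are those of \<open>A\<close> through the index \<open>0\<close>
  divided by \<open>A 0 0\<close>. If \<open>A 0 0 = 0\<close>, the principal minors of order two force row \<open>0\<close> to vanish.
\<close>

lemma principal_minors_imp_psd:
  fixes A :: "nat \<Rightarrow> nat \<Rightarrow> real"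
  assumes "\<And>i j. A i j = A j i"
    and "\<And>n r. strict_mono_on {..<n} r \<Longrightarrow> minor A n r r \<ge> 0"
  shows "(\<Sum>i<N. \<Sum>j<N. c i * c j * A i j) \<ge> 0"
  using assms
proof (induction N arbitrary: A c)
  case (Suc N)
  have a0: "A 0 0 \<ge> 0"
  proof -
    have "minor A (Suc 0) (\<lambda>_. 0) (\<lambda>_. 0) \<ge> 0"
      by (rule Suc.prems(2)) (auto simp: strict_mono_on_def)
    then show ?thesis by (simp add: minor_1)
  qed
  define c' where "c' i = c (Suc i)" for i
  define u where "u = (\<Sum>j<N. c' j * A 0 (Suc j))"
  have "(\<Sum>i<Suc N. \<Sum>j<Suc N. c i * c j * A i j) =
      c 0 * c 0 * A 0 0 + (\<Sum>j<N. c 0 * c' j * A 0 (Suc j)) +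
      ((\<Sum>i<N. c' i * c 0 * A (Suc i) 0) + (\<Sum>i<N. \<Sum>j<N. c' i * c' j * A (Suc i) (Suc j)))"
    unfolding sum.lessThan_Suc_shift by (simp add: c'_def sum.distrib)
  also have "(\<Sum>j<N. c 0 * c' j * A 0 (Suc j)) = c 0 * u"
    by (simp add: u_def sum_distrib_left mult_ac)
  also have "(\<Sum>i<N. c' i * c 0 * A (Suc i) 0) = c 0 * u"
    unfolding Suc.prems(1)[of "Suc _" 0] by (simp add: u_def sum_distrib_left mult_ac)
  finally have expand: "(\<Sum>i<Suc N. \<Sum>j<Suc N. c i * c j * A i j) =
      c 0 * c 0 * A 0 0 + 2 * (c 0 * u) + (\<Sum>i<N. \<Sum>j<N. c' i * c' j * A (Suc i) (Suc j))" by simp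
  show ?case
  proof (cases "A 0 0 = 0")
    case True
    have "A 0 (Suc j) = 0" for j
    proof -
      have "minor A (Suc (Suc 0)) (case_nat 0 (\<lambda>_. Suc j)) (case_nat 0 (\<lambda>_. Suc j)) \<ge> 0"
        by (rule Suc.prems(2)) (auto simp: strict_mono_on_def split: nat.split)
      then have "(A 0 (Suc j))\<^sup>2 \<le> 0"
        using True Suc.prems(1)[of "Suc j" 0] by (simp add: minor_2 power2_eq_square)
      then show ?thesis by simp
    qed
    then have "u = 0" by (simp add: u_def)
    moreover have "(\<Sum>i<N. \<Sum>j<N. c' i * c' j * A (Suc i) (Suc j)) \<ge> 0"
    proof (rule Suc.IH)
      fix n and r :: "nat \<Rightarrow> nat" assume "strict_mono_on {..<n} r"
      then have "minor A n (\<lambda>i. Suc (r i)) (\<lambda>i. Suc (r i)) \<ge> 0"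
        by (intro Suc.prems(2)) (auto simp: strict_mono_on_def)
      then show "minor (\<lambda>i j. A (Suc i) (Suc j)) n r r \<ge> 0" by (simp add: minor_def)
    qed (use Suc.prems(1) in auto)
    ultimately show ?thesis using expand True by simp
  next
    case False
    define B where "B i j = A (Suc i) (Suc j) - A (Suc i) 0 * A 0 (Suc j) / A 0 0" for i j
    have "(\<Sum>i<N. \<Sum>j<N. c' i * c' j * B i j) \<ge> 0"
    proof (rule Suc.IH)
      fix n and r :: "nat \<Rightarrow> nat" assume "strict_mono_on {..<n} r"
      then have "minor A (Suc n) (case_nat 0 (\<lambda>i. Suc (r i))) (case_nat 0 (\<lambda>i. Suc (r i))) \<ge> 0"
        by (intro Suc.prems(2)) (auto simp: strict_mono_on_def split: nat.split)
      then show "minor B n r r \<ge> 0"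
        using False a0 unfolding minor_Schur_complement[of A n r r, OF False]
        by (simp add: B_def[abs_def] zero_le_mult_iff)
    next
      show "B i j = B j i" for i j
        unfolding B_def Suc.prems(1)[of "Suc i"] Suc.prems(1)[of 0 "Suc j"] by simp
    qed
    moreover have "(\<Sum>i<N. \<Sum>j<N. c' i * c' j * A (Suc i) (Suc j)) =
        (\<Sum>i<N. \<Sum>j<N. c' i * c' j * B i j) + u * u / A 0 0"
      unfolding B_def u_def sum_product sum_divide_distrib sum.distrib[symmetric]
        Suc.prems(1)[of "Suc _" 0]
      by (intro sum.cong refl) (simp add: algebra_simps)
    moreover have "c 0 * c 0 * A 0 0 + 2 * (c 0 * u) + u * u / A 0 0 = (c 0 * A 0 0 + u)\<^sup>2 / A 0 0"
      using False by (simp add: field_simps power2_eq_square)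
    moreover have "(c 0 * A 0 0 + u)\<^sup>2 / A 0 0 \<ge> 0" using a0 by simp
    ultimately show ?thesis using expand by linarith
  qed
qed simp

section \<open>Log-convexity of order three\<close>

lemma minor_3: "minor A (Suc (Suc (Suc 0))) r c =
    A (r 0) (c 0) * (A (r 1) (c 1) * A (r 2) (c 2) - A (r 2) (c 1) * A (r 1) (c 2))
  - A (r 1) (c 0) * (A (r 0) (c 1) * A (r 2) (c 2) - A (r 2) (c 1) * A (r 0) (c 2))
  + A (r 2) (c 0) * (A (r 0) (c 1) * A (r 1) (c 2) - A (r 1) (c 1) * A (r 0) (c 2))"
  by (subst minor_laplace_column[of 0])
     (auto simp: minor_2 skip_def numeral_2_eq_2 algebra_simps)

definition hankel3 :: "(nat \<Rightarrow> 'a::comm_ring_1) \<Rightarrow> nat \<Rightarrow> 'a" where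
  "hankel3 \<alpha> i = \<alpha> i * (\<alpha> (i+2) * \<alpha> (i+4) - (\<alpha> (i+3))\<^sup>2)
    - \<alpha> (i+1) * (\<alpha> (i+1) * \<alpha> (i+4) - \<alpha> (i+3) * \<alpha> (i+2))
    + \<alpha> (i+2) * (\<alpha> (i+1) * \<alpha> (i+3) - (\<alpha> (i+2))\<^sup>2)"

definition hankel4 :: "(nat \<Rightarrow> 'a::comm_ring_1) \<Rightarrow> nat \<Rightarrow> 'a" where
  "hankel4 \<alpha> i = minor (\<lambda>i j. \<alpha> (i + j)) (Suc (Suc (Suc (Suc 0)))) (\<lambda>k. i + k) (\<lambda>k. k)"

lemma hankel3_minor:
  "hankel3 \<alpha> i = minor (\<lambda>i j. \<alpha> (i + j)) (Suc (Suc (Suc 0))) (\<lambda>k. i + k) (\<lambda>k. k)"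
  by (simp add: minor_3 hankel3_def power2_eq_square algebra_simps numeral_eq_Suc)

lemma logconv_op_minor:
  "logconv_op \<alpha> (Suc i) = minor (\<lambda>i j. \<alpha> (i + j)) (Suc (Suc 0)) (\<lambda>k. i + k) (\<lambda>k. k)"
  by (simp add: minor_2 logconv_op_def power2_eq_square numeral_eq_Suc)

text \<open>
  This and the next lemma are the Desnanot--Jacobi identity for Hankel matrices of size three
  and four: their four corner minors are values of the preceding Hankel minor.
\<close>

lemma logconv_op_2: "logconv_op (logconv_op \<alpha>) (Suc (Suc i)) = \<alpha> (Suc (Suc i)) * hankel3 \<alpha> i"
  by (simp add: logconv_op_def hankel3_def power2_eq_square algebra_simps numeral_eq_Suc)

lemma hankel3_log_convex:
  "hankel3 \<alpha> i * hankel3 \<alpha> (i + 2) - (hankel3 \<alpha> (i + 1))\<^sup>2 = hankel4 \<alpha> i * logconv_op \<alpha> (i + 3)"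
proof -
  define a b c d e f g where defs: "a = \<alpha> i" "b = \<alpha> (i+1)" "c = \<alpha> (i+2)" "d = \<alpha> (i+3)"
    "e = \<alpha> (i+4)" "f = \<alpha> (i+5)" "g = \<alpha> (i+6)"
  have h4: "hankel4 \<alpha> i =
      a * (c * (e * g - f\<^sup>2) - d * (d * g - f * e) + e * (d * f - e\<^sup>2))
    - b * (b * (e * g - f\<^sup>2) - d * (c * g - f * d) + e * (c * f - e * d))
    + c * (b * (d * g - f * e) - c * (c * g - f * d) + e * (c * e - d\<^sup>2))
    - d * (b * (d * f - e\<^sup>2) - c * (c * f - e * d) + d * (c * e - d\<^sup>2))"
    unfolding hankel4_def
    by (subst minor_laplace_column[of 0])
       (auto simp: minor_3 skip_def defs numeral_eq_Suc power2_eq_square algebra_simps)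
  have lc: "logconv_op \<alpha> (i + 3) = c * e - d\<^sup>2"
    by (simp add: logconv_op_def defs numeral_eq_Suc)
  have h3a: "hankel3 \<alpha> i = a * (c * e - d\<^sup>2) - b * (b * e - d * c) + c * (b * d - c\<^sup>2)"
    by (simp add: hankel3_def defs)
  have h3b: "hankel3 \<alpha> (i + 1) = b * (d * f - e\<^sup>2) - c * (c * f - e * d) + d * (c * e - d\<^sup>2)"
    by (simp add: hankel3_def defs numeral_eq_Suc)
  have h3c: "hankel3 \<alpha> (i + 2) = c * (e * g - f\<^sup>2) - d * (d * g - f * e) + e * (d * f - e\<^sup>2)"
    by (simp add: hankel3_def defs numeral_eq_Suc)
  show ?thesis unfolding h4 lc h3a h3b h3c by (simp add: power2_eq_square algebra_simps)
qed

text \<open>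
  The operator acts on a product by \<open>L[\<alpha> h] = L[\<alpha>] h\<^sub>- h\<^sub>+ + \<alpha>\<^sup>2 L[h]\<close>, where \<open>h\<^sub>-\<close> and \<open>h\<^sub>+\<close> are the
  neighbours of \<open>h\<close>; by the two previous lemmas this expresses the third iterate by Hankel minors.
\<close>

lemma logconv_op_3:
  "logconv_op (logconv_op (logconv_op \<alpha>)) (Suc (Suc (Suc i))) =
    logconv_op \<alpha> (Suc (Suc (Suc i))) * (hankel3 \<alpha> i * hankel3 \<alpha> (i + 2)) +
    (\<alpha> (Suc (Suc (Suc i))))\<^sup>2 * (hankel4 \<alpha> i * logconv_op \<alpha> (Suc (Suc (Suc i))))"
proof -
  have "logconv_op (logconv_op (logconv_op \<alpha>)) (Suc (Suc (Suc i))) =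
      logconv_op (logconv_op \<alpha>) (Suc (Suc i)) * logconv_op (logconv_op \<alpha>) (Suc (Suc (Suc (Suc i)))) -
      (logconv_op (logconv_op \<alpha>) (Suc (Suc (Suc i))))\<^sup>2"
    by (subst logconv_op_def) simp
  also have "\<dots> = (\<alpha> (Suc (Suc i)) * \<alpha> (Suc (Suc (Suc (Suc i)))) - (\<alpha> (Suc (Suc (Suc i))))\<^sup>2) *
        (hankel3 \<alpha> i * hankel3 \<alpha> (Suc (Suc i))) +
      (\<alpha> (Suc (Suc (Suc i))))\<^sup>2 * (hankel3 \<alpha> i * hankel3 \<alpha> (Suc (Suc i)) - (hankel3 \<alpha> (Suc i))\<^sup>2)"
    unfolding logconv_op_2 by (simp add: power2_eq_square algebra_simps)
  also have "hankel3 \<alpha> i * hankel3 \<alpha> (Suc (Suc i)) - (hankel3 \<alpha> (Suc i))\<^sup>2 =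
      hankel4 \<alpha> i * logconv_op \<alpha> (Suc (Suc (Suc i)))"
    using hankel3_log_convex[of \<alpha> i] by (simp add: numeral_eq_Suc)
  finally show ?thesis by (simp add: logconv_op_def)
qed

lemma (in pos_cone) log_convex_3_if_hankel_positive:
  assumes "all_minors Pos (\<lambda>i j. \<alpha> (i + j))"
  shows "iter_log_convex Pos 3 \<alpha>"
  unfolding iter_log_convex_def
proof (intro ballI allI impI)
  have m: "Pos (minor (\<lambda>i j. \<alpha> (i + j)) n (\<lambda>k. i + k) (\<lambda>k. k))" for n i
    using assms by (auto simp: all_minors_def strict_mono_on_def)
  have "minor (\<lambda>i j. \<alpha> (i + j)) (Suc 0) (\<lambda>k. i + k) (\<lambda>k. k) = \<alpha> i" for i by (simp add: minor_1)
  then have \<alpha>: "Pos (\<alpha> i)" for i by (metis m)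
  have h: "Pos (logconv_op \<alpha> (Suc i))" "Pos (hankel3 \<alpha> i)" "Pos (hankel4 \<alpha> i)" for i
    by (auto simp: logconv_op_minor hankel3_minor hankel4_def m)
  fix k i :: nat assume k: "k \<in> {1..3}" and i: "i \<ge> k"
  from k consider "k = 1" | "k = 2" | "k = 3" by force
  then show "Pos ((logconv_op ^^ k) \<alpha> i)"
  proof cases
    case 1
    with i obtain j where "i = Suc j" by (cases i) auto
    then show ?thesis using 1 h by simp
  next
    case 2
    with i obtain j where "i = Suc (Suc j)" by (auto simp: numeral_2_eq_2 dest!: le_Suc_ex)
    then show ?thesis using 2 h \<alpha> by (simp add: logconv_op_2 numeral_2_eq_2 Pos_mult)
  next
    case 3
    with i obtain j where "i = Suc (Suc (Suc j))" by (auto simp: numeral_3_eq_3 dest!: le_Suc_ex)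
    then show ?thesis using 3 h \<alpha>
      by (simp add: logconv_op_3 numeral_3_eq_3 Pos_mult Pos_add Pos_power)
  qed
qed

section \<open>Branched continued fractions and lattice paths\<close>

text \<open>
  The total weight of the lattice paths of \<open>N\<close> steps from height \<open>0\<close> to height \<open>h\<close> that stay at
  nonnegative heights, with rises by \<open>1\<close> of weight \<open>1\<close> and falls by \<open>m\<close> of weight \<open>\<alpha> i\<close> when
  they start at height \<open>i\<close>.
\<close>

fun path_weight :: "nat \<Rightarrow> (nat \<Rightarrow> 'a::comm_ring_1) \<Rightarrow> nat \<Rightarrow> nat \<Rightarrow> 'a" where
  "path_weight m \<alpha> 0 h = (if h = 0 then 1 else 0)"
| "path_weight m \<alpha> (Suc N) h =
    (if h = 0 then 0 else path_weight m \<alpha> N (h - 1)) + \<alpha> (h + m) * path_weight m \<alpha> N (h + m)"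

lemma path_weight_high: "N < h \<Longrightarrow> path_weight m \<alpha> N h = 0"
  by (induction N arbitrary: h) auto

lemma path_weight_diag: "path_weight m \<alpha> h h = 1"
proof (induction h)
  case (Suc h)
  then show ?case by (simp add: path_weight_high)
qed simp

text \<open>
  Let \<open>W\<^sub>h(t)\<close> count the paths to height \<open>h\<close> by their number of falls. Cutting a path at its last
  visits to the heights \<open>0, \<dots>, h\<close> suggests \<open>W\<^sub>h = F\<^sub>0 \<cdots> F\<^sub>h\<close>, so the family is defined by
  \<open>F\<^sub>h = W\<^sub>h / W\<^sub>h\<^sub>-\<^sub>1\<close>. Inspecting the last step of a path gives
  \<open>W\<^sub>h = W\<^sub>h\<^sub>-\<^sub>1 + \<alpha>\<^sub>h\<^sub>+\<^sub>m t W\<^sub>h\<^sub>+\<^sub>m\<close>, which divided by \<open>W\<^sub>h\<close> is the recursion of the continued fraction.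
\<close>

lemma branched_cf_path_weight:
  fixes \<alpha> :: "nat \<Rightarrow> 'a::comm_ring_1"
  shows "branched_cf m \<alpha> = Abs_fps (\<lambda>s. path_weight m \<alpha> ((m + 1) * s) 0)"
proof -
  \<comment> \<open>A path to height \<open>h\<close> with \<open>s\<close> falls has \<open>h + (m + 1) s\<close> steps.\<close>
  define W where "W h = Abs_fps (\<lambda>s. path_weight m \<alpha> (h + (m + 1) * s) h)" for h
  \<comment> \<open>The series \<open>W\<^sub>h\<^sub>-\<^sub>1\<close>, read as \<open>1\<close> for \<open>h = 0\<close>.\<close>
  define W' where "W' h = (if h = 0 then 1 else W (h - 1))" for h
  define F where "F h = W h * recip_fps (W' h)" for h
  have W0: "fps_nth (W h) 0 = 1" for h by (simp add: W_def path_weight_diag)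
  have W'0: "fps_nth (W' h) 0 = 1" for h by (simp add: W'_def W0)
  have W_rec: "W h - fps_const (\<alpha> (h + m)) * fps_X * W (h + m) = W' h" for h
  proof (rule fps_ext)
    fix s
    show "fps_nth (W h - fps_const (\<alpha> (h + m)) * fps_X * W (h + m)) s = fps_nth (W' h) s"
    proof (cases s)
      case 0
      then show ?thesis by (simp add: W0 W'0)
    next
      case (Suc s')
      have "h + (m + 1) * s = Suc (h + m + (m + 1) * s')" by (simp add: Suc)
      moreover have "h - 1 + (m + 1) * s = h + m + (m + 1) * s'" if "h \<noteq> 0" using that by (simp add: Suc)
      ultimately have pw: "path_weight m \<alpha> (h + (m + 1) * s) h =
          (if h = 0 then 0 else path_weight m \<alpha> (h - 1 + (m + 1) * s) (h - 1)) +
          \<alpha> (h + m) * path_weight m \<alpha> (h + m + (m + 1) * s') (h + m)"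
        by (cases "h = 0") (simp_all only: path_weight.simps if_True if_False not_False_eq_True refl if_P)
      have "fps_nth (fps_const (\<alpha> (h + m)) * fps_X * W (h + m)) s =
          \<alpha> (h + m) * path_weight m \<alpha> (h + m + (m + 1) * s') (h + m)"
        by (simp add: W_def Suc mult.assoc)
      moreover have "fps_nth (W h) s = path_weight m \<alpha> (h + (m + 1) * s) h" by (simp add: W_def)
      moreover have "fps_nth (W' h) s = (if h = 0 then 0 else path_weight m \<alpha> (h - 1 + (m + 1) * s) (h - 1))"
        by (cases h) (simp_all add: W_def W'_def Suc add_ac)
      ultimately show ?thesis using pw by (simp only: fps_sub_nth add_diff_cancel_right')
    qed
  qed
  have prod_F: "(\<Prod>i=1..j. F (k + i)) = W (k + j) * recip_fps (W k)" for j k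
  proof (induction j)
    case 0
    then show ?case by (simp add: recip_fps W0)
  next
    case (Suc j)
    have "(\<Prod>i=1..Suc j. F (k + i)) =
        W (k + j) * recip_fps (W k) * (W (k + Suc j) * recip_fps (W (k + j)))"
      using Suc by (simp add: F_def W'_def)
    also have "\<dots> = W (k + Suc j) * recip_fps (W k) * (W (k + j) * recip_fps (W (k + j)))"
      by (simp only: mult_ac)
    finally show ?case by (simp add: recip_fps W0)
  qed
  have "branched_cf_family m \<alpha> F"
    unfolding branched_cf_family_def
  proof (intro allI conjI)
    fix k
    show "fps_nth (F k) 0 = 1" by (simp add: F_def W0 recip_fps_def)
    define D where "D = 1 - fps_const (\<alpha> (k + m)) * fps_X * (\<Prod>i=1..m. F (k + i))"
    have D0: "fps_nth D 0 = 1" by (simp add: D_def)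
    have "D * W k = W k * 1 -
        fps_const (\<alpha> (k + m)) * fps_X * W (k + m) * (W k * recip_fps (W k))"
      unfolding D_def prod_F by (simp only: algebra_simps)
    also have "\<dots> = W' k" using W0 W_rec by (simp add: recip_fps)
    finally have "D * F k = 1" by (simp add: F_def recip_fps W'0 flip: mult.assoc)
    then have "F k * (D * recip_fps D) = recip_fps D"
      by (metis mult.assoc mult.commute mult_1)
    then show "F k = recip_fps (1 - fps_const (\<alpha> (k + m)) * fps_X * (\<Prod>i=1..m. F (k + i)))"
      using D0 by (simp add: recip_fps D_def)
  qed
  from branched_cf_eq[OF this] have "branched_cf m \<alpha> = W 0"
  proof -
    have "(1 :: 'a fps) * recip_fps 1 = 1" by (rule recip_fps) simp
    then show ?thesis using branched_cf_eq[OF \<open>branched_cf_family m \<alpha> F\<close>] by (simp add: F_def W'_def)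
  qed
  then show ?thesis by (simp add: W_def)
qed

section \<open>Row polynomials of exponential Riordan arrays\<close>

definition exp_toeplitz :: "(nat \<Rightarrow> real) \<Rightarrow> nat \<Rightarrow> nat \<Rightarrow> real" where
  "exp_toeplitz a n k = (if k \<le> n then fact n / fact k * a (n - k) else 0)"

lemma TP_exp_toeplitz:
  assumes "TP (\<lambda>i j. if j \<le> i then a (i - j) else 0)"
  shows "TP (exp_toeplitz a)"
proof -
  have "TP (\<lambda>n k. fact n * (if k \<le> n then a (n - k) else 0) * (1 / fact k))"
    by (rule TP_scale[OF assms]) auto
  also have "(\<lambda>n k. fact n * (if k \<le> n then a (n - k) else 0) * (1 / fact k)) = exp_toeplitz a"
    by (auto simp: exp_toeplitz_def fun_eq_iff)
  finally show ?thesis .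
qed

text \<open>
  The recursion says that \<open>S\<close> is the triangle \<open>n! [t\<^sup>n] f\<^sup>k / k!\<close> of the series with \<open>f' = a(f)\<close>.
  Then \<open>G x y\<close> is the exponential Riordan array of \<open>exp (x f)\<close> and \<open>f\<close>, homogenized by \<open>y\<close>, and
  \<open>P x y\<close> will turn out to be its production matrix.
\<close>

locale exp_riordan = real_algebra_cone Pos \<iota> for Pos and \<iota> :: "real \<Rightarrow> 'a::comm_ring_1" +
  fixes a :: "nat \<Rightarrow> real" and S :: "nat \<Rightarrow> nat \<Rightarrow> real"
  assumes S_0: "\<And>k. S 0 k = (if k = 0 then 1 else 0)"
    and S_Suc_0: "\<And>n. S (Suc n) 0 = 0"
    and S_Suc_Suc: "\<And>n k. S (Suc n) (Suc k) = (\<Sum>j\<le>n. S n j * exp_toeplitz a j k)"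
begin

definition T :: "'a \<Rightarrow> nat \<Rightarrow> nat \<Rightarrow> 'a" where
  "T y n k = \<iota> (exp_toeplitz a n k) * y ^ (n - k)"

definition P :: "'a \<Rightarrow> 'a \<Rightarrow> nat \<Rightarrow> nat \<Rightarrow> 'a" where
  "P x y n k = x * T y n k + (if k = 0 then 0 else T y n (k - 1))"

definition G :: "'a \<Rightarrow> 'a \<Rightarrow> nat \<Rightarrow> nat \<Rightarrow> 'a" where
  "G x y n k = (\<Sum>m\<le>n. of_nat (m choose k) * \<iota> (S n m) * x ^ (m - k) * y ^ (n - m))"

lemma T_high: "n < k \<Longrightarrow> T y n k = 0"
  by (simp add: T_def exp_toeplitz_def \<iota>_0)

lemma P_high: "Suc n < k \<Longrightarrow> P x y n k = 0"
  by (simp add: P_def T_high)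

lemma G_high: "n < k \<Longrightarrow> G x y n k = 0"
  by (simp add: G_def binomial_eq_0)

lemma G_0: "G x y 0 k = (if k = 0 then 1 else 0)"
  by (cases k) (simp_all add: G_def S_0 \<iota>_1)

lemma binomial_exp_toeplitz:
  assumes "k \<le> l" "l \<le> j"
  shows "real (j choose l) * exp_toeplitz a l k = exp_toeplitz a j (j - l + k) * real (j - l + k choose k)"
proof -
  have idx: "j - (j - l + k) = l - k" "j - l + k \<le> j" using assms by auto
  have eq: "real (j choose l) * (fact l / fact k) = fact j / fact (j - l + k) * real (j - l + k choose k)"
    using assms by (simp add: binomial_fact field_simps)
  have "real (j choose l) * exp_toeplitz a l k = real (j choose l) * (fact l / fact k) * a (l - k)"
    using assms by (simp add: exp_toeplitz_def)
  also have "\<dots> = exp_toeplitz a j (j - l + k) * real (j - l + k choose k)"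
    unfolding eq exp_toeplitz_def idx(1) using idx(2) by (simp only: if_True mult_ac)
  finally show ?thesis .
qed

text \<open>The matrices \<open>T y\<close> and the graded Pascal matrices commute, both being exponential Toeplitz.\<close>

lemma T_pascal_commute:
  assumes "j \<le> n"
  shows "(\<Sum>l\<le>n. of_nat (j choose l) * x ^ (j - l) * y ^ (n - j) * T y l k) =
    (\<Sum>m\<le>n. \<iota> (exp_toeplitz a j m) * of_nat (m choose k) * x ^ (m - k) * y ^ (n - m))"
proof -
  have "(\<Sum>l\<le>n. of_nat (j choose l) * x ^ (j - l) * y ^ (n - j) * T y l k) =
      (\<Sum>l\<in>{k..j}. of_nat (j choose l) * x ^ (j - l) * y ^ (n - j) * T y l k)"
    by (rule sum.mono_neutral_right) (use assms in \<open>auto simp: T_high binomial_eq_0 not_le\<close>)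
  also have "\<dots> = (\<Sum>m\<in>{k..j}. \<iota> (exp_toeplitz a j m) * of_nat (m choose k) * x ^ (m - k) * y ^ (n - m))"
  proof (rule sum.reindex_bij_witness[of _ "\<lambda>m. j - m + k" "\<lambda>l. j - l + k"])
    fix l assume l: "l \<in> {k..j}"
    have "of_nat (j choose l) * \<iota> (exp_toeplitz a l k) =
        \<iota> (exp_toeplitz a j (j - l + k)) * of_nat (j - l + k choose k)"
      using l arg_cong[OF binomial_exp_toeplitz[of k l j], of \<iota>] by (simp add: \<iota>_mult \<iota>_of_nat)
    moreover have "n - j + (l - k) = n - (j - l + k)" using l assms by auto
    then have "y ^ (n - j) * y ^ (l - k) = y ^ (n - (j - l + k))" by (simp flip: power_add)
    moreover have "(of_nat (j choose l) * \<iota> (exp_toeplitz a l k)) * x ^ (j - l) * (y ^ (n - j) * y ^ (l - k))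
      = of_nat (j choose l) * x ^ (j - l) * y ^ (n - j) * T y l k"
      by (simp add: T_def mult_ac)
    ultimately show "\<iota> (exp_toeplitz a j (j - l + k)) * of_nat (j - l + k choose k) * x ^ (j - l + k - k) *
        y ^ (n - (j - l + k)) = of_nat (j choose l) * x ^ (j - l) * y ^ (n - j) * T y l k"
      by simp
  qed auto
  also have "\<dots> = (\<Sum>m\<le>n. \<iota> (exp_toeplitz a j m) * of_nat (m choose k) * x ^ (m - k) * y ^ (n - m))"
    by (rule sum.mono_neutral_left) (use assms in \<open>auto simp: exp_toeplitz_def \<iota>_0 not_le binomial_eq_0\<close>)
  finally show ?thesis .
qed

lemma G_times_T:
  "(\<Sum>l\<le>n. G x y n l * T y l k) = (\<Sum>m\<le>n. \<iota> (S (Suc n) (Suc m)) * of_nat (m choose k) * x ^ (m - k) * y ^ (n - m))"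
proof -
  have "(\<Sum>l\<le>n. G x y n l * T y l k) =
      (\<Sum>j\<le>n. \<iota> (S n j) * (\<Sum>l\<le>n. of_nat (j choose l) * x ^ (j - l) * y ^ (n - j) * T y l k))"
    unfolding G_def sum_distrib_right sum_distrib_left by (subst sum.swap) (simp add: mult_ac)
  also have "\<dots> = (\<Sum>j\<le>n. \<iota> (S n j) *
      (\<Sum>m\<le>n. \<iota> (exp_toeplitz a j m) * of_nat (m choose k) * x ^ (m - k) * y ^ (n - m)))"
    by (intro sum.cong refl) (simp add: T_pascal_commute)
  also have "\<dots> = (\<Sum>m\<le>n. \<iota> (S (Suc n) (Suc m)) * of_nat (m choose k) * x ^ (m - k) * y ^ (n - m))"
    unfolding S_Suc_Suc \<iota>_sum \<iota>_mult sum_distrib_right sum_distrib_left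
    by (subst sum.swap) (simp add: mult_ac)
  finally show ?thesis .
qed

text \<open>
  By Pascal's rule, the shift of \<open>S\<close> turns into right multiplication by the bidiagonal factor
  of \<open>P\<close> once the Pascal matrix hidden in \<open>G\<close> has been moved past \<open>T\<close>.
\<close>

lemma G_Suc: "G x y (Suc n) k = (\<Sum>l\<le>n. G x y n l * P x y l k)"
proof -
  let ?Q = "\<lambda>k. \<Sum>m\<le>n. \<iota> (S (Suc n) (Suc m)) * of_nat (m choose k) * x ^ (m - k) * y ^ (n - m)"
  have "G x y (Suc n) k =
      (\<Sum>m\<le>n. of_nat (Suc m choose k) * \<iota> (S (Suc n) (Suc m)) * x ^ (Suc m - k) * y ^ (n - m))"
    unfolding G_def by (subst sum.atMost_Suc_shift) (simp add: S_Suc_0 \<iota>_0)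
  also have "\<dots> = x * ?Q k + (if k = 0 then 0 else ?Q (k - 1))"
  proof (cases k)
    case 0
    then show ?thesis by (simp add: sum_distrib_left mult_ac)
  next
    case (Suc k')
    have x: "of_nat (m choose k) * x ^ (m - k') = x * (of_nat (m choose k) * x ^ (m - k))" for m
    proof (cases "k \<le> m")
      case True
      then have "m - k' = Suc (m - k)" by (simp add: Suc)
      then show ?thesis by simp
    qed (simp add: not_le binomial_eq_0)
    have "of_nat (Suc m choose k) * \<iota> (S (Suc n) (Suc m)) * x ^ (Suc m - k) * y ^ (n - m) =
        x * (\<iota> (S (Suc n) (Suc m)) * of_nat (m choose k) * x ^ (m - k) * y ^ (n - m)) +
        \<iota> (S (Suc n) (Suc m)) * of_nat (m choose k') * x ^ (m - k') * y ^ (n - m)" for m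
    proof -
      have "of_nat (Suc m choose k) * \<iota> (S (Suc n) (Suc m)) * x ^ (Suc m - k) * y ^ (n - m) =
          \<iota> (S (Suc n) (Suc m)) * y ^ (n - m) * (of_nat (m choose k) * x ^ (m - k')) +
          \<iota> (S (Suc n) (Suc m)) * of_nat (m choose k') * x ^ (m - k') * y ^ (n - m)"
        by (simp add: Suc algebra_simps)
      then show ?thesis unfolding x by (simp add: mult_ac)
    qed
    then show ?thesis by (simp add: Suc sum.distrib sum_distrib_left)
  qed
  also have "\<dots> = x * (\<Sum>l\<le>n. G x y n l * T y l k) +
      (if k = 0 then 0 else (\<Sum>l\<le>n. G x y n l * T y l (k - 1)))"
    unfolding G_times_T ..
  also have "\<dots> = (\<Sum>l\<le>n. G x y n l * P x y l k)"
    by (simp add: P_def algebra_simps sum.distrib sum_distrib_left)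
  finally show ?thesis .
qed

lemma G_Suc_lessThan: "M > n \<Longrightarrow> G x y (Suc n) k = (\<Sum>l<M. G x y n l * P x y l k)"
  unfolding G_Suc by (rule sum.mono_neutral_left) (auto simp: G_high)

subsection \<open>The continued fraction\<close>

text \<open>
  The exponential Toeplitz matrix of the factor \<open>1 + z\<^sub>i t\<close> is bidiagonal and describes one step of a
  path from a height that is \<open>i - 1\<close> modulo \<open>m + 1\<close>; the remaining step of a round has the weight \<open>x\<close>
  for a fall. Hence \<open>m + 1\<close> steps amount to one multiplication by \<open>P\<close>.
\<close>

lemma path_weight_G:
  fixes x y :: 'a
  assumes a: "a = fps_nth (\<Prod>i=1..m. 1 + fps_const (z i) * fps_X)"
  defines "\<alpha> \<equiv> cf_coeffs m x (\<lambda>i. y * \<iota> (z i))"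
  shows "path_weight m \<alpha> ((m + 1) * n) ((m + 1) * k) = G x y n k"
proof -
  \<comment> \<open>The product of the first \<open>i\<close> bidiagonal factors of \<open>T y\<close>.\<close>
  define Ti where "Ti i n k =
    \<iota> (exp_toeplitz (fps_nth (\<Prod>l=1..i. 1 + fps_const (z l) * fps_X)) n k) * y ^ (n - k)" for i n k
  have \<alpha>0: "\<alpha> ((m + 1) * k + m) = x" for k
  proof -
    have "((m + 1) * k + m - m) mod (m + 1) = 0" by (simp only: add_diff_cancel_right' mod_mult_self1_is_0)
    then show ?thesis unfolding \<alpha>_def cf_coeffs_def by (simp only: Let_def if_P refl)
  qed
  have \<alpha>i: "\<alpha> ((m + 1) * k + Suc i + m) = of_nat (Suc k) * (y * \<iota> (z (Suc i)))" if "i < m" for k i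
  proof -
    have e: "(m + 1) * k + Suc i + m - m = Suc i + (m + 1) * k" by simp
    have "((m + 1) * k + Suc i + m - m) div (m + 1) = k" "((m + 1) * k + Suc i + m - m) mod (m + 1) = Suc i"
      unfolding e using that div_mult_self2[of "m + 1" "Suc i" k] mod_mult_self2[of "Suc i" "m + 1" k]
      by simp_all
    then show ?thesis unfolding \<alpha>_def cf_coeffs_def by (simp only: Let_def) simp
  qed
  have Ti_0: "Ti 0 n k = (if n = k then 1 else 0)" for n k
    by (auto simp: Ti_def exp_toeplitz_def \<iota>_0 \<iota>_1)
  have Ti_Suc: "Ti (Suc i) n k = Ti i n k + of_nat (Suc k) * (y * \<iota> (z (Suc i))) * Ti i n (Suc k)" for i n k
  proof -
    define b where "b = fps_nth (\<Prod>l=1..i. 1 + fps_const (z l) * fps_X)"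
    have "(\<Prod>l=1..Suc i. 1 + fps_const (z l) * fps_X) =
        (\<Prod>l=1..i. 1 + fps_const (z l) * fps_X) + fps_X * (fps_const (z (Suc i)) * (\<Prod>l=1..i. 1 + fps_const (z l) * fps_X))"
      by (simp add: algebra_simps)
    then have b: "fps_nth (\<Prod>l=1..Suc i. 1 + fps_const (z l) * fps_X) j =
        b j + (if j = 0 then 0 else z (Suc i) * b (j - 1))" for j
      by (simp add: b_def)
    consider "n < k" | "n = k" | "k < n" by linarith
    then show ?thesis
    proof cases
      case 1
      then show ?thesis by (simp add: Ti_def exp_toeplitz_def \<iota>_0)
    next
      case 2
      then show ?thesis unfolding Ti_def exp_toeplitz_def b by (simp add: b_def \<iota>_0)
    next
      case 3
      then obtain d where n: "n = Suc (k + d)" by (auto dest: less_imp_Suc_add)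
      have "fact n / fact k * (z (Suc i) * b d) = real (Suc k) * z (Suc i) * (fact n / fact (Suc k) * b d)"
        by (simp del: of_nat_Suc)
      then have "\<iota> (fact n / fact k * (z (Suc i) * b d)) =
          of_nat (Suc k) * \<iota> (z (Suc i)) * \<iota> (fact n / fact (Suc k) * b d)"
        by (simp only: \<iota>_mult \<iota>_of_nat)
      moreover have "Ti (Suc i) n k = \<iota> (fact n / fact k * b (Suc d)) * y ^ Suc d +
          \<iota> (fact n / fact k * (z (Suc i) * b d)) * y ^ Suc d"
        unfolding Ti_def exp_toeplitz_def b n by (simp add: distrib_left \<iota>_add distrib_right del: fact_Suc)
      moreover have "Ti i n k = \<iota> (fact n / fact k * b (Suc d)) * y ^ Suc d"
        "Ti i n (Suc k) = \<iota> (fact n / fact (Suc k) * b d) * y ^ d"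
        unfolding Ti_def exp_toeplitz_def b_def n by (simp_all del: fact_Suc)
      ultimately show ?thesis by (simp add: mult_ac)
    qed
  qed
  have "(\<forall>k. path_weight m \<alpha> ((m + 1) * n) ((m + 1) * k) = G x y n k) \<and>
      (\<forall>k. \<forall>i\<le>m. path_weight m \<alpha> ((m + 1) * n + i) ((m + 1) * k + i) = (\<Sum>j\<le>n. G x y n j * Ti i j k))"
    for n
  proof (induction n)
    have inner: "\<forall>k. \<forall>i\<le>m. path_weight m \<alpha> ((m + 1) * n + i) ((m + 1) * k + i) = (\<Sum>j\<le>n. G x y n j * Ti i j k)"
      if *: "\<And>k. path_weight m \<alpha> ((m + 1) * n) ((m + 1) * k) = G x y n k" for n
    proof (intro allI impI)
      fix k i assume "i \<le> m"
      then show "path_weight m \<alpha> ((m + 1) * n + i) ((m + 1) * k + i) = (\<Sum>j\<le>n. G x y n j * Ti i j k)"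
      proof (induction i arbitrary: k)
        case 0
        have "(\<Sum>j\<le>n. G x y n j * Ti 0 j k) = (\<Sum>j\<le>n. if j = k then G x y n k else 0)"
          by (intro sum.cong) (auto simp: Ti_0)
        also have "\<dots> = G x y n k" by (auto simp: G_high)
        finally show ?case using * by simp
      next
        case (Suc i)
        have "path_weight m \<alpha> ((m + 1) * n + Suc i) ((m + 1) * k + Suc i) =
            path_weight m \<alpha> ((m + 1) * n + i) ((m + 1) * k + i) +
            \<alpha> ((m + 1) * k + Suc i + m) * path_weight m \<alpha> ((m + 1) * n + i) ((m + 1) * k + Suc i + m)"
          by (simp only: add_Suc_right path_weight.simps) simp
        also have "(m + 1) * k + Suc i + m = (m + 1) * Suc k + i" by simp
        then have "path_weight m \<alpha> ((m + 1) * n + i) ((m + 1) * k + Suc i + m) = (\<Sum>j\<le>n. G x y n j * Ti i j (Suc k))"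
          using Suc by (simp only: Suc_leD)
        finally show ?case using Suc.IH[of k] Suc.prems \<alpha>i[of i k]
          by (simp add: Ti_Suc sum.distrib sum_distrib_left distrib_left mult_ac)
      qed
    qed
    {
      case 0
      have "path_weight m \<alpha> ((m + 1) * 0) ((m + 1) * k) = G x y 0 k" for k by (simp add: G_0)
      then show ?case using inner[of 0] by blast
    next
      case (Suc n)
      have Tm: "Ti m = T y" unfolding fun_eq_iff Ti_def T_def a[symmetric] by simp
      have pm: "path_weight m \<alpha> ((m + 1) * n + m) ((m + 1) * k + m) = (\<Sum>j\<le>n. G x y n j * T y j k)" for k
        using Suc Tm by simp
      have "path_weight m \<alpha> ((m + 1) * Suc n) ((m + 1) * k) = G x y (Suc n) k" for k
      proof -
        have N: "(m + 1) * Suc n = Suc ((m + 1) * n + m)" by simp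
        have "path_weight m \<alpha> ((m + 1) * Suc n) ((m + 1) * k) =
            (if k = 0 then 0 else path_weight m \<alpha> ((m + 1) * n + m) ((m + 1) * (k - 1) + m)) +
            \<alpha> ((m + 1) * k + m) * path_weight m \<alpha> ((m + 1) * n + m) ((m + 1) * k + m)"
          unfolding N by (cases k) (simp_all add: algebra_simps)
        also have "\<dots> = (if k = 0 then 0 else (\<Sum>j\<le>n. G x y n j * T y j (k - 1))) +
            x * (\<Sum>j\<le>n. G x y n j * T y j k)"
          by (simp only: pm \<alpha>0)
        also have "\<dots> = G x y (Suc n) k"
          unfolding G_Suc by (simp add: P_def algebra_simps sum.distrib sum_distrib_left)
        finally show ?thesis .
      qed
      then show ?case using inner[of "Suc n"] by blast
    }
  qed
  then show ?thesis by blast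
qed

theorem branched_cf_G:
  assumes "a = fps_nth (\<Prod>i=1..m. 1 + fps_const (z i) * fps_X)"
  shows "branched_cf m (cf_coeffs m x (\<lambda>i. y * \<iota> (z i))) = Abs_fps (\<lambda>n. G x y n 0)"
  unfolding branched_cf_path_weight using path_weight_G[OF assms, of x y _ 0] by simp

end

subsection \<open>Total positivity of the arrays and of the Hankel matrices of their row polynomials\<close>

locale PF_exp_riordan = exp_riordan Pos \<iota> a S for Pos and \<iota> :: "real \<Rightarrow> 'a::comm_ring_1" and a S +
  assumes toeplitz_TP: "TP (\<lambda>i j. if j \<le> i then a (i - j) else 0)"
begin

lemma all_minors_T: "Pos y \<Longrightarrow> all_minors Pos (T y)"
  unfolding T_def by (rule all_minors_graded[OF TP_exp_toeplitz[OF toeplitz_TP]])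
    (simp_all add: exp_toeplitz_def)

lemma all_minors_P:
  assumes "Pos x" "Pos y"
  shows "all_minors Pos (P x y)"
proof (rule all_minors_product[OF all_minors_T[OF assms(2)]])
  let ?W = "\<lambda>l k :: nat. if k = l then x else if k = Suc l then 1 else 0"
  show "all_minors Pos ?W"
    by (rule all_minors_staircase) (auto simp: assms Pos_0 Pos_1 split: if_splits)
  fix n k
  have "P x y n k = (\<Sum>l<M. T y n l * ?W l k)" if "M \<ge> Suc k" for M
  proof -
    have "(\<Sum>l<M. T y n l * ?W l k) =
        (\<Sum>l<M. if l = k then T y n k * x else 0) + (\<Sum>l<M. if l = k - 1 then if k = 0 then 0 else T y n l else 0)"
      unfolding sum.distrib[symmetric] by (intro sum.cong refl) auto
    also have "\<dots> = P x y n k" using that by (simp add: P_def mult.commute)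
    finally show ?thesis ..
  qed
  then show "\<exists>M0. \<forall>M\<ge>M0. P x y n k = (\<Sum>l<M. T y n l * ?W l k)" by blast
qed

theorem all_minors_G:
  assumes "Pos x" "Pos y"
  shows "all_minors Pos (G x y)"
  by (rule all_minors_iterated_rows[where G = "G x y", OF all_minors_P[OF assms] G_0])
     (metis G_Suc_lessThan Suc_le_lessD)

text \<open>
  The powers of \<open>P\<close> factor the Hankel matrix: its entry at \<open>(i, j)\<close> is row \<open>0\<close> of \<open>P\<^sup>i\<close>, which is
  row \<open>i\<close> of \<open>G\<close>, times the column \<open>P\<^sup>j (V 0)\<close>, which is \<open>V j\<close>.
\<close>

lemma all_minors_hankel_factorization:
  assumes xy: "Pos x" "Pos y" and V: "all_minors Pos V"
    and VS: "\<And>j k. V (Suc j) k = (\<Sum>l\<le>Suc k. P x y k l * V j l)"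
  shows "all_minors Pos (\<lambda>i j. \<Sum>m\<le>i + j. G x y (i + j) m * V 0 m)"
proof -
  have VS': "V (Suc j) k = (\<Sum>l<M. V j l * P x y k l)" if "M \<ge> Suc (Suc k)" for j k M
    unfolding VS using that
    by (intro sum.mono_neutral_cong_left) (auto simp: P_high mult.commute)
  have GV: "(\<Sum>m<Suc i. G x y i m * V j m) = (\<Sum>m\<le>i + j. G x y (i + j) m * V 0 m)" for i j
  proof (induction j arbitrary: i)
    case 0
    show ?case by (simp add: lessThan_Suc_atMost)
  next
    case (Suc j)
    have "(\<Sum>m<Suc i. G x y i m * V (Suc j) m) = (\<Sum>m<Suc i. G x y i m * (\<Sum>l<Suc (Suc i). V j l * P x y m l))"
      by (intro sum.cong refl arg_cong2[of _ _ _ _ "(*)"] VS') auto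
    also have "\<dots> = (\<Sum>l<Suc (Suc i). (\<Sum>m<Suc i. G x y i m * P x y m l) * V j l)"
      unfolding sum_distrib_left sum_distrib_right by (subst sum.swap) (simp only: mult_ac)
    also have "\<dots> = (\<Sum>l<Suc (Suc i). G x y (Suc i) l * V j l)"
      by (intro sum.cong refl) (simp only: G_Suc_lessThan[of i "Suc i", OF lessI])
    finally show ?case using Suc[of "Suc i"] by simp
  qed
  show ?thesis
  proof (rule all_minors_product[OF all_minors_G[OF xy] all_minors_transpose[OF V]])
    fix i j
    have "(\<Sum>m\<le>i + j. G x y (i + j) m * V 0 m) = (\<Sum>l<M. G x y i l * V j l)" if "M \<ge> Suc i" for M
      unfolding GV[symmetric] using that by (intro sum.mono_neutral_left) (auto simp: G_high)
    then show "\<exists>M0. \<forall>M\<ge>M0. (\<Sum>m\<le>i + j. G x y (i + j) m * V 0 m) = (\<Sum>l<M. G x y i l * V j l)" by blast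
  qed
qed

theorem all_minors_hankel_G:
  assumes "Pos x" "Pos y"
  shows "all_minors Pos (\<lambda>i j. G x y (i + j) 0)"
proof -
  define V where "V = rec_nat (\<lambda>k. if k = 0 then 1 else 0) (\<lambda>j v k. \<Sum>l\<le>Suc k. P x y k l * v l)"
  have V0: "V 0 k = (if k = 0 then 1 else 0)" for k by (simp add: V_def)
  have VS: "V (Suc j) k = (\<Sum>l\<le>Suc k. P x y k l * V j l)" for j k by (simp add: V_def)
  have VS': "V (Suc j) k = (\<Sum>l<M. V j l * P x y k l)" if "M \<ge> Suc (Suc k)" for j k M
    unfolding VS using that
    by (intro sum.mono_neutral_cong_left) (auto simp: P_high mult.commute)
  have V: "all_minors Pos V"
    by (rule all_minors_iterated_rows[where G = V, OF all_minors_transpose[OF all_minors_P[OF assms]] V0])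
       (use VS' in blast)
  have "(\<Sum>m\<le>n. G x y n m * V 0 m) = G x y n 0" for n
  proof -
    have "(\<Sum>m\<le>n. G x y n m * V 0 m) = (\<Sum>m\<le>n. if m = 0 then G x y n 0 else 0)"
      by (intro sum.cong) (auto simp: V0)
    then show ?thesis by simp
  qed
  then show ?thesis using all_minors_hankel_factorization[OF assms V VS] by simp
qed

definition shifted_row_poly :: "'a \<Rightarrow> 'a \<Rightarrow> nat \<Rightarrow> 'a" where
  "shifted_row_poly x y n = (\<Sum>m\<le>n. \<iota> (S (Suc n) (Suc m)) * x ^ m * y ^ (n - m))"

text \<open>
  With \<open>P = T W\<close> for the bidiagonal matrix \<open>W\<close>, the shifted polynomials are the column \<open>0\<close> of
  \<open>G T\<close>, and the columns \<open>P\<^sup>j T e\<^sub>0 = T (W T)\<^sup>j e\<^sub>0\<close> are again governed by a totally positive matrix.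
\<close>

theorem all_minors_hankel_shifted:
  assumes xy: "Pos x" "Pos y"
  shows "all_minors Pos (\<lambda>i j. shifted_row_poly x y (i + j))"
proof -
  define TV where "TV v m = (\<Sum>l\<le>m. T y m l * v l)" for v m
  define v where "v = rec_nat (\<lambda>k. if k = 0 then 1 else 0) (\<lambda>j w k. x * TV w k + TV w (Suc k))"
  define V where "V j = TV (v j)" for j
  have v0: "v 0 k = (if k = 0 then 1 else 0)" for k by (simp add: v_def)
  have vS: "v (Suc j) k = x * V j k + V j (Suc k)" for j k by (simp add: v_def V_def)
  have V_eq: "V j m = (\<Sum>l<M. v j l * T y m l)" if "M \<ge> Suc m" for j m M
    unfolding V_def TV_def using that
    by (intro sum.mono_neutral_cong_left) (auto simp: T_high mult.commute)
  define Q where "Q k l = x * T y k l + T y (Suc k) l" for k l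
  let ?W = "\<lambda>l k :: nat. if k = l then x else if k = Suc l then 1 else 0"
  have Q: "all_minors Pos Q"
  proof (rule all_minors_product[OF _ all_minors_T[OF xy(2)]])
    show "all_minors Pos ?W"
      by (rule all_minors_staircase) (auto simp: xy Pos_0 Pos_1 split: if_splits)
    fix n k
    have "Q n k = (\<Sum>l<M. ?W n l * T y l k)" if "M \<ge> Suc (Suc n)" for M
    proof -
      have "(\<Sum>l<M. ?W n l * T y l k) =
          (\<Sum>l<M. if l = n then x * T y n k else 0) + (\<Sum>l<M. if l = Suc n then T y (Suc n) k else 0)"
        unfolding sum.distrib[symmetric] by (intro sum.cong refl) auto
      also have "\<dots> = Q n k" using that by (simp add: Q_def)
      finally show ?thesis ..
    qed
    then show "\<exists>M0. \<forall>M\<ge>M0. Q n k = (\<Sum>l<M. ?W n l * T y l k)" by blast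
  qed
  have "v (Suc j) k = (\<Sum>l<M. v j l * Q k l)" if "M \<ge> Suc (Suc k)" for j k M
    unfolding vS using that V_eq[of k M j] V_eq[of "Suc k" M j]
    by (simp add: Q_def sum_distrib_left sum.distrib distrib_left mult_ac)
  then have "all_minors Pos v"
    by (intro all_minors_iterated_rows[where G = v, OF all_minors_transpose[OF Q] v0]) blast
  then have V: "all_minors Pos V"
    by (rule all_minors_product[OF _ all_minors_transpose[OF all_minors_T[OF xy(2)]]])
       (use V_eq in blast)
  have "V (Suc j) k = (\<Sum>l\<le>Suc k. P x y k l * V j l)" for j k
  proof -
    have "V (Suc j) k = (\<Sum>l\<le>k. T y k l * (x * V j l)) + (\<Sum>l\<le>k. T y k l * V j (Suc l))"
      unfolding V_def[of "Suc j"] TV_def vS by (simp add: distrib_left sum.distrib)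
    also have "(\<Sum>l\<le>k. T y k l * (x * V j l)) = (\<Sum>l\<le>Suc k. x * T y k l * V j l)"
      by (simp add: T_high mult_ac)
    also have "(\<Sum>l\<le>k. T y k l * V j (Suc l)) =
        (\<Sum>l\<le>Suc k. (if l = 0 then 0 else T y k (l - 1)) * V j l)"
      by (subst sum.atMost_Suc_shift) simp
    finally show ?thesis by (simp only: P_def distrib_right sum.distrib)
  qed
  moreover have "(\<Sum>m\<le>n. G x y n m * V 0 m) = shifted_row_poly x y n" for n
  proof -
    have "V 0 m = T y m 0" for m
    proof -
      have "V 0 m = (\<Sum>l\<le>m. if l = 0 then T y m 0 else 0)"
        unfolding V_def TV_def by (intro sum.cong) (auto simp: v0)
      then show ?thesis by simp
    qed
    then show ?thesis by (simp add: G_times_T shifted_row_poly_def)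
  qed
  ultimately show ?thesis using all_minors_hankel_factorization[OF xy V] by simp
qed

end

section \<open>The Stieltjes moment problem\<close>

subsection \<open>The moment functional on polynomials\<close>

definition moment_functional :: "(nat \<Rightarrow> real) \<Rightarrow> real poly \<Rightarrow> real" where
  "moment_functional a p = (\<Sum>i\<le>degree p. coeff p i * a i)"

lemma moment_functional_eq: "degree p \<le> N \<Longrightarrow> moment_functional a p = (\<Sum>i\<le>N. coeff p i * a i)"
  unfolding moment_functional_def
  by (rule sum.mono_neutral_left) (auto simp: coeff_eq_0)

lemma moment_functional_0: "moment_functional a 0 = 0"
  by (simp add: moment_functional_def)

lemma moment_functional_add:
  "moment_functional a (p + r) = moment_functional a p + moment_functional a r"
proof -
  let ?N = "max (degree p) (degree r)"
  show ?thesis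
    unfolding moment_functional_eq[of p ?N, OF max.cobounded1]
      moment_functional_eq[of r ?N, OF max.cobounded2] moment_functional_eq[OF degree_add_le_max]
    by (simp add: distrib_right sum.distrib)
qed

lemma moment_functional_smult: "moment_functional a (Polynomial.smult c p) = c * moment_functional a p"
  unfolding moment_functional_eq[OF degree_smult_le] moment_functional_def
  by (simp add: sum_distrib_left mult_ac)

lemma moment_functional_sum:
  "moment_functional a (sum h I) = (\<Sum>i\<in>I. moment_functional a (h i))"
  by (induction I rule: infinite_finite_induct) (auto simp: moment_functional_0 moment_functional_add)

lemma moment_functional_monom: "moment_functional a (monom c n) = c * a n"
proof -
  have "coeff (monom c n) i * a i = (if i = n then c * a n else 0)" for i by (simp add: coeff_monom)
  then show ?thesis unfolding moment_functional_eq[OF degree_monom_le] by simp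
qed

lemma moment_functional_mult:
  "moment_functional a (monom 1 s * p * r) =
    (\<Sum>i\<le>degree p. \<Sum>j\<le>degree r. coeff p i * coeff r j * a (s + i + j))"
proof -
  have "monom 1 s * p * r =
      monom 1 s * (\<Sum>i\<le>degree p. monom (coeff p i) i) * (\<Sum>j\<le>degree r. monom (coeff r j) j)"
    by (simp add: poly_as_sum_of_monoms)
  also have "\<dots> = (\<Sum>i\<le>degree p. \<Sum>j\<le>degree r. monom (coeff p i * coeff r j) (s + i + j))"
    by (simp only: mult.assoc sum_product) (simp add: sum_distrib_left mult_monom add.assoc)
  finally show ?thesis by (simp add: moment_functional_sum moment_functional_monom)
qed

lemma poly_nonneg_at_point:
  fixes p :: "real poly"
  assumes "a \<ge> 0" "\<And>x. x \<ge> 0 \<Longrightarrow> x \<noteq> a \<Longrightarrow> poly p x \<ge> 0"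
  shows "poly p a \<ge> 0"
proof (rule tendsto_lowerbound)
  show "(poly p \<longlongrightarrow> poly p a) (at_right a)"
    by (intro tendsto_poly tendsto_ident_at)
  show "\<forall>\<^sub>F x in at_right a. 0 \<le> poly p x"
    unfolding eventually_at_right_field using assms by (intro exI[of _ "a + 1"]) auto
qed simp

lemma poly_attains_min:
  fixes p :: "real poly"
  assumes nonneg: "\<And>x. x \<ge> 0 \<Longrightarrow> poly p x \<ge> 0" and deg: "degree p > 0"
  obtains a where "a \<ge> 0" "\<And>x. x \<ge> 0 \<Longrightarrow> poly p a \<le> poly p x"
proof -
  have "lead_coeff p > 0"
  proof (rule ccontr)
    assume "\<not> lead_coeff p > 0"
    moreover have "lead_coeff p \<noteq> 0" using deg by auto
    ultimately have "lead_coeff p < 0" by linarith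
    then have lc: "lead_coeff (- p) > 0" by simp
    from poly_pinfty_gt_lc[OF this] obtain R where "\<forall>x\<ge>R. poly (- p) x \<ge> lead_coeff (- p)" by blast
    then have "poly (- p) (max R 0) \<ge> lead_coeff (- p)" by (rule allE[of _ "max R 0"]) simp
    then have "poly (- p) (max R 0) > 0" using lc by (rule order_less_le_trans[rotated])
    then show False using nonneg[of "max R 0"] by simp
  qed
  moreover have "degree (p - [:poly p 0:]) = degree p"
    using degree_add_eq_left[of "- [:poly p 0:]" p] deg by (simp only: degree_minus degree_pCons_0 diff_conv_add_uminus)
  ultimately have lc: "lead_coeff (p - [:poly p 0:]) > 0" using deg by (auto simp: coeff_pCons split: nat.split)
  from poly_pinfty_gt_lc[OF this] obtain R where R: "\<forall>x\<ge>R. poly (p - [:poly p 0:]) x \<ge> lead_coeff (p - [:poly p 0:])" by blast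
  have far: "poly p x \<ge> poly p 0" if "x \<ge> R" for x
    using R[rule_format, OF that] lc by simp
  have "\<exists>a\<in>{0..max R 0}. \<forall>x\<in>{0..max R 0}. poly p a \<le> poly p x"
    by (rule continuous_attains_inf) (auto intro!: continuous_intros)
  then obtain a where a: "a \<ge> 0" "\<And>x. 0 \<le> x \<Longrightarrow> x \<le> max R 0 \<Longrightarrow> poly p a \<le> poly p x" by auto
  show thesis
  proof
    show "a \<ge> 0" by fact
    fix x :: real assume "x \<ge> 0"
    then show "poly p a \<le> poly p x"
      using a(2)[of x] a(2)[of 0] far[of x] by (cases "x \<le> max R 0") (auto simp: le_max_iff_disj)
  qed
qed

text \<open>
  A polynomial \<open>p \<ge> 0\<close> on the half-line attains its minimum \<open>c\<close> at some \<open>b \<ge> 0\<close>, and \<open>p - c\<close>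
  is \<open>X\<close> or \<open>(X - b)\<^sup>2\<close> times a polynomial of the same kind of lower degree, according as
  \<open>b = 0\<close> or \<open>b > 0\<close>. The factors \<open>u\<^sup>2\<close> and \<open>X u\<^sup>2\<close> absorb what is split off.
\<close>

lemma moment_functional_nonneg:
  assumes psd: "\<And>u. moment_functional a (u * u) \<ge> 0"
    and psd1: "\<And>u. moment_functional a ([:0, 1:] * (u * u)) \<ge> 0"
    and p: "\<And>x. x \<ge> 0 \<Longrightarrow> poly p x \<ge> 0"
  shows "moment_functional a p \<ge> 0"
proof -
  have "(\<forall>u. moment_functional a (p * (u * u)) \<ge> 0) \<and> (\<forall>u. moment_functional a ([:0, 1:] * p * (u * u)) \<ge> 0)"
    using p
  proof (induction "degree p" arbitrary: p rule: less_induct)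
    case less
    show ?case
    proof (cases "degree p = 0")
      case True
      then obtain c where c: "p = [:c:]" by (rule degree_eq_zeroE)
      then have "c \<ge> 0" using less.prems[of 0] by simp
      moreover have "p * r = Polynomial.smult c r" "[:0, 1:] * p * r = Polynomial.smult c ([:0, 1:] * r)" for r
        by (simp_all add: c)
      ultimately show ?thesis
        by (simp only: moment_functional_smult mult_nonneg_nonneg psd psd1 simp_thms)
    next
      case False
      then obtain b where b: "b \<ge> 0" "\<And>x. x \<ge> 0 \<Longrightarrow> poly p b \<le> poly p x"
        using poly_attains_min[of p] less.prems by blast
      define c where "c = poly p b"
      have c: "c \<ge> 0" using less.prems b by (simp add: c_def)
      have "poly (p - [:c:]) b = 0" by (simp add: c_def)
      then have "[:- b, 1:] dvd p - [:c:]" by (simp only: poly_eq_0_iff_dvd)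
      then obtain q where q: "p - [:c:] = [:- b, 1:] * q" by (rule dvdE)
      have pq: "p = [:c:] + [:- b, 1:] * q" using q by (simp add: algebra_simps)
      have q0: "q \<noteq> 0" using False pq by (cases "q = 0") auto
      have "degree (p - [:c:]) = Suc (degree q)"
        unfolding q using q0 by (subst degree_mult_eq) auto
      then have degq: "degree p = Suc (degree q)"
        using degree_add_eq_left[of "[:c:]" "p - [:c:]"] by simp
      have sign: "(x - b) * poly q x \<ge> 0" if "x \<ge> 0" for x
        using b(2)[OF that] pq by (simp add: c_def[symmetric] algebra_simps)
      show ?thesis
      proof (cases "b = 0")
        case True
        have "poly q x \<ge> 0" if "x \<ge> 0" "x \<noteq> 0" for x
          using sign[of x] that True by (simp add: zero_le_mult_iff)
        then have "poly q x \<ge> 0" if "x \<ge> 0" for x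
          using poly_nonneg_at_point[of 0 q] that by (cases "x = 0") auto
        then have IH: "moment_functional a (q * (u * u)) \<ge> 0"
            "moment_functional a ([:0, 1:] * q * (u * u)) \<ge> 0" for u
          using less.hyps[of q] degq by auto
        have "p * (u * u) = Polynomial.smult c (u * u) + [:0, 1:] * q * (u * u)" for u
          by (simp add: pq True algebra_simps)
        moreover have "[:0, 1:] * p * (u * u) =
            Polynomial.smult c ([:0, 1:] * (u * u)) + q * (([:0, 1:] * u) * ([:0, 1:] * u))" for u
          by (simp add: pq True algebra_simps)
        ultimately show ?thesis
          using c by (simp only: moment_functional_add moment_functional_smult)
            (intro conjI allI add_nonneg_nonneg mult_nonneg_nonneg psd psd1 IH)
      next
        case False
        with b have bpos: "b > 0" by simp
        have right: "poly q x \<ge> 0" if "x > b" for x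
          using sign[of x] that bpos by (simp add: zero_le_mult_iff)
        have left: "poly q x \<le> 0" if "0 < x" "x < b" for x
          using sign[of x] that by (simp add: zero_le_mult_iff)
        have "poly q b = 0"
        proof (rule antisym)
          show "poly q b \<ge> 0"
          proof (rule tendsto_lowerbound)
            show "(poly q \<longlongrightarrow> poly q b) (at_right b)" by (intro tendsto_poly tendsto_ident_at)
            show "\<forall>\<^sub>F x in at_right b. 0 \<le> poly q x"
              unfolding eventually_at_right_field
              using right by (intro exI[of _ "b + 1"]) auto
          qed simp
          show "poly q b \<le> 0"
          proof (rule tendsto_upperbound)
            show "(poly q \<longlongrightarrow> poly q b) (at_left b)" by (intro tendsto_poly tendsto_ident_at)
            show "\<forall>\<^sub>F x in at_left b. 0 \<ge> poly q x"
              unfolding eventually_at_left_field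
              using left bpos by (intro exI[of _ 0]) auto
          qed simp
        qed
        then have "[:- b, 1:] dvd q" by (simp only: poly_eq_0_iff_dvd)
        then obtain r where r: "q = [:- b, 1:] * r" by (rule dvdE)
        have "r \<noteq> 0" using q0 r by auto
        then have "degree q = Suc (degree r)" unfolding r by (subst degree_mult_eq) auto
        then have degr: "degree r < degree p" using degq by simp
        have "poly r x \<ge> 0" if "x \<ge> 0" "x \<noteq> b" for x
        proof -
          have "(x - b)\<^sup>2 * poly r x \<ge> 0" using sign[of x] that by (simp add: r power2_eq_square algebra_simps)
          moreover have "(x - b)\<^sup>2 > 0" using that by simp
          ultimately show ?thesis by (metis mult_le_0_iff not_less order_less_imp_le zero_le_mult_iff)
        qed
        then have "poly r x \<ge> 0" if "x \<ge> 0" for x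
          using poly_nonneg_at_point[of b r] that b by (cases "x = b") auto
        then have IH: "moment_functional a (r * (u * u)) \<ge> 0"
            "moment_functional a ([:0, 1:] * r * (u * u)) \<ge> 0" for u
          using less.hyps[of r] degr by auto
        have smult: "Polynomial.smult c v = [:c:] * v" for v by simp
        have "p * (u * u) = Polynomial.smult c (u * u) + r * (([:- b, 1:] * u) * ([:- b, 1:] * u))" for u
          unfolding pq r smult by (simp only: distrib_right distrib_left mult_ac)
        moreover have "[:0, 1:] * p * (u * u) = Polynomial.smult c ([:0, 1:] * (u * u)) +
            [:0, 1:] * r * (([:- b, 1:] * u) * ([:- b, 1:] * u))" for u
          unfolding pq r smult by (simp only: distrib_right distrib_left mult_ac)
        ultimately show ?thesis
          using c by (simp only: moment_functional_add moment_functional_smult)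
            (intro conjI allI add_nonneg_nonneg mult_nonneg_nonneg psd psd1 IH)
      qed
    qed
  qed
  then have "moment_functional a (p * (1 * 1)) \<ge> 0" by blast
  then show ?thesis by simp
qed

subsection \<open>Approximation of finitely many moments by atomic measures\<close>

definition atomic_moments :: "(nat \<Rightarrow> real) set" where
  "atomic_moments = {m. \<exists>n w x. (\<forall>i<n. w i \<ge> 0 \<and> x i \<ge> 0) \<and> m = (\<lambda>k. \<Sum>i<n::nat. w i * x i ^ k)}"

lemma atomic_moments_0: "(\<lambda>_. 0) \<in> atomic_moments"
  unfolding atomic_moments_def by (auto intro!: exI[of _ 0])

lemma atomic_moments_add_atom:
  assumes "m \<in> atomic_moments" "w' \<ge> 0" "x' \<ge> 0"
  shows "(\<lambda>k. m k + w' * x' ^ k) \<in> atomic_moments"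
proof -
  obtain n w x where *: "\<forall>i<n. w i \<ge> 0 \<and> x i \<ge> 0" "m = (\<lambda>k. \<Sum>i<n::nat. w i * x i ^ k)"
    using assms(1) unfolding atomic_moments_def by blast
  show ?thesis unfolding atomic_moments_def
    using * assms by (intro CollectI exI[of _ "Suc n"] exI[of _ "w(n := w')"] exI[of _ "x(n := x')"]) auto
qed

lemma atomic_moments_scale:
  assumes "m \<in> atomic_moments" "c \<ge> 0"
  shows "(\<lambda>k. c * m k) \<in> atomic_moments"
proof -
  obtain n w x where *: "\<forall>i<n. w i \<ge> 0 \<and> x i \<ge> 0" "m = (\<lambda>k. \<Sum>i<n::nat. w i * x i ^ k)"
    using assms(1) unfolding atomic_moments_def by blast
  show ?thesis unfolding atomic_moments_def
    using * assms
    by (intro CollectI exI[of _ n] exI[of _ "\<lambda>i. c * w i"] exI[of _ x]) (auto simp: sum_distrib_left mult_ac)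
qed

text \<open>
  An almost closest point \<open>m\<close> of the cone of atomic moment vectors to \<open>a\<close> almost satisfies the
  variational inequalities of a closest one: testing with atoms at \<open>x\<close>, the polynomial \<open>p\<close> with
  coefficients \<open>m k - a k\<close> is almost nonnegative on the half-line, so that \<open>moment_functional a p\<close>
  is almost nonnegative, while scaling of \<open>m\<close> shows this value to be almost \<open>- d\<close> for
  the infimum \<open>d\<close> of the squared distances.
\<close>

lemma atomic_moments_dense:
  fixes a :: "nat \<Rightarrow> real"
  assumes L: "\<And>p. (\<And>x. x \<ge> 0 \<Longrightarrow> poly p x \<ge> 0) \<Longrightarrow> moment_functional a p \<ge> 0"
    and \<delta>: "\<delta> > 0"
  shows "\<exists>m\<in>atomic_moments. (\<Sum>k\<le>N. (m k - a k)\<^sup>2) < \<delta>"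
proof -
  define D where "D m = (\<Sum>k\<le>N. (m k - a k)\<^sup>2)" for m
  define d where "d = Inf (D ` atomic_moments)"
  have D0: "D m \<ge> 0" for m unfolding D_def by (intro sum_nonneg) auto
  have bdd: "bdd_below (D ` atomic_moments)" using D0 by (intro bdd_belowI[of _ 0]) auto
  have ne: "D ` atomic_moments \<noteq> {}" using atomic_moments_0 by auto
  have dle: "d \<le> D m" if "m \<in> atomic_moments" for m
    unfolding d_def using that bdd by (intro cInf_lower) auto
  have d0: "d \<ge> 0" unfolding d_def using ne D0 by (intro cInf_greatest) auto
  define A where "A = (\<Sum>k\<le>N. a k)"
  define B where "B = 2 * (d + 1) + 2 * (\<Sum>k\<le>N. (a k)\<^sup>2)"
  have key: "d \<le> \<epsilon> * ((1 + B) / 2 + A)" if \<epsilon>: "0 < \<epsilon>" "\<epsilon> \<le> 1" for \<epsilon>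
  proof -
    have "\<exists>z\<in>D ` atomic_moments. z < d + \<epsilon>\<^sup>2"
      unfolding d_def by (rule cInf_lessD[OF ne]) (use \<epsilon> in simp)
    then obtain m where m: "m \<in> atomic_moments" "D m < d + \<epsilon>\<^sup>2" by auto
    define u where "u k = m k - a k" for k
    define p where "p = (\<Sum>k\<le>N. monom (u k) k) + Polynomial.smult \<epsilon> (\<Sum>k\<le>N. monom 1 k)"
    have Du: "D m = (\<Sum>k\<le>N. (u k)\<^sup>2)" by (simp add: D_def u_def)
    have "poly p x \<ge> 0" if x: "x \<ge> 0" for x
    proof -
      define w where "w = (\<Sum>k\<le>N. x ^ k)"
      define v where "v = (\<Sum>k\<le>N. u k * x ^ k)"
      have "x ^ k \<ge> 0" for k using x by simp
      have "(\<Sum>k\<in>{0}. x ^ k) \<le> w" unfolding w_def using x by (intro sum_mono2) auto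
      then have w1: "w \<ge> 1" by simp
      \<comment> \<open>This weight makes the quadratic term at most \<open>\<epsilon>\<^sup>2\<close>, the defect of \<open>m\<close> from being closest.\<close>
      define t where "t = \<epsilon> / w"
      have t: "t > 0" "t * w = \<epsilon>" using \<epsilon> w1 by (auto simp: t_def)
      have "(\<Sum>k\<le>N. (x ^ k)\<^sup>2) \<le> (\<Sum>k\<le>N. x ^ k * w)"
        unfolding power2_eq_square
      proof (intro sum_mono mult_left_mono)
        fix k assume "k \<in> {..N}"
        then show "x ^ k \<le> w" unfolding w_def using x by (intro member_le_sum) auto
      qed (use x in auto)
      also have "\<dots> = w\<^sup>2" by (simp add: w_def power2_eq_square sum_distrib_right[symmetric])
      finally have vw: "(\<Sum>k\<le>N. (x ^ k)\<^sup>2) \<le> w\<^sup>2" .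
      have "d \<le> D (\<lambda>k. m k + t * x ^ k)"
        using t x by (intro dle atomic_moments_add_atom m) auto
      also have "D (\<lambda>k. m k + t * x ^ k) = (\<Sum>k\<le>N. (u k)\<^sup>2 + 2 * t * (u k * x ^ k) + t\<^sup>2 * (x ^ k)\<^sup>2)"
        unfolding D_def u_def by (intro sum.cong refl) (simp add: power2_eq_square algebra_simps)
      also have "\<dots> = D m + 2 * t * v + t\<^sup>2 * (\<Sum>k\<le>N. (x ^ k)\<^sup>2)"
        by (simp add: sum.distrib sum_distrib_left Du v_def)
      also have "\<dots> \<le> D m + 2 * t * v + t\<^sup>2 * w\<^sup>2" using vw by (intro add_left_mono mult_left_mono) auto
      also have "t\<^sup>2 * w\<^sup>2 = \<epsilon>\<^sup>2" using t by (simp flip: power_mult_distrib)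
      finally have "0 \<le> 2 * t * v + 2 * \<epsilon>\<^sup>2" using m by linarith
      also have "\<dots> = 2 * t * (v + \<epsilon> * w)" using t(2) by (simp add: power2_eq_square algebra_simps)
      finally have "v + \<epsilon> * w \<ge> 0" using t(1) by (simp add: zero_le_mult_iff)
      then show ?thesis by (simp add: p_def v_def w_def poly_sum poly_monom)
    qed
    then have "moment_functional a p \<ge> 0" by (rule L)
    then have 1: "(\<Sum>k\<le>N. u k * a k) + \<epsilon> * A \<ge> 0"
      by (simp add: p_def moment_functional_add moment_functional_smult moment_functional_sum
          moment_functional_monom A_def)
    have "(\<Sum>k\<le>N. (m k)\<^sup>2) \<le> (\<Sum>k\<le>N. 2 * (u k)\<^sup>2 + 2 * (a k)\<^sup>2)"
    proof (rule sum_mono)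
      fix k
      have "2 * (u k)\<^sup>2 + 2 * (a k)\<^sup>2 - (m k)\<^sup>2 = (u k - a k)\<^sup>2"
        by (simp add: u_def power2_eq_square algebra_simps)
      then show "(m k)\<^sup>2 \<le> 2 * (u k)\<^sup>2 + 2 * (a k)\<^sup>2" by (smt (verit) zero_le_power2)
    qed
    also have "\<dots> = 2 * D m + 2 * (\<Sum>k\<le>N. (a k)\<^sup>2)" by (simp add: sum.distrib sum_distrib_left Du)
    also have "\<epsilon>\<^sup>2 \<le> 1" using \<epsilon> by (simp add: power_le_one)
    then have "D m \<le> d + 1" using m(2) by linarith
    then have "2 * D m + 2 * (\<Sum>k\<le>N. (a k)\<^sup>2) \<le> B" unfolding B_def by simp
    finally have mB: "(\<Sum>k\<le>N. (m k)\<^sup>2) \<le> B" .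
    define s where "s = (\<Sum>k\<le>N. u k * m k)"
    \<comment> \<open>The other test direction is the contraction of \<open>m\<close>.\<close>
    have "d \<le> D (\<lambda>k. (1 - \<epsilon>) * m k)"
      using \<epsilon> by (intro dle atomic_moments_scale m) auto
    also have "D (\<lambda>k. (1 - \<epsilon>) * m k) = (\<Sum>k\<le>N. (u k)\<^sup>2 - 2 * \<epsilon> * (u k * m k) + \<epsilon>\<^sup>2 * (m k)\<^sup>2)"
      unfolding D_def u_def by (intro sum.cong refl) (simp add: power2_eq_square algebra_simps)
    also have "\<dots> = D m - 2 * \<epsilon> * s + \<epsilon>\<^sup>2 * (\<Sum>k\<le>N. (m k)\<^sup>2)"
      by (simp add: sum.distrib sum_subtractf sum_distrib_left Du s_def)
    also have "\<dots> \<le> D m - 2 * \<epsilon> * s + \<epsilon>\<^sup>2 * B" using mB by (intro add_left_mono mult_left_mono) auto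
    finally have "0 \<le> \<epsilon>\<^sup>2 + \<epsilon>\<^sup>2 * B - 2 * \<epsilon> * s" using m(2) by linarith
    also have "\<dots> = \<epsilon> * (\<epsilon> * (1 + B) - 2 * s)" by (simp add: power2_eq_square algebra_simps)
    finally have 2: "2 * s \<le> \<epsilon> * (1 + B)" using \<epsilon> by (simp add: zero_le_mult_iff)
    have "(\<Sum>k\<le>N. u k * a k) = s - D m"
      unfolding s_def Du sum_subtractf[symmetric]
      by (intro sum.cong refl) (simp add: u_def power2_eq_square algebra_simps)
    then have "d \<le> s + \<epsilon> * A" using 1 dle[OF m(1)] by linarith
    also have "\<dots> \<le> \<epsilon> * (1 + B) / 2 + \<epsilon> * A" using 2 by simp
    also have "\<dots> = \<epsilon> * ((1 + B) / 2 + A)" by (simp add: algebra_simps)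
    finally show ?thesis .
  qed
  have "d \<le> 0"
  proof (rule tendsto_lowerbound)
    show "((\<lambda>\<epsilon>. \<epsilon> * ((1 + B) / 2 + A)) \<longlongrightarrow> 0) (at_right 0)"
      by (intro tendsto_eq_intros) auto
    show "\<forall>\<^sub>F \<epsilon> in at_right 0. d \<le> \<epsilon> * ((1 + B) / 2 + A)"
      unfolding eventually_at_right_field using key by (intro exI[of _ 1]) auto
  qed simp
  with \<delta> have "Inf (D ` atomic_moments) < \<delta>" by (simp add: d_def)
  from cInf_lessD[OF ne this] show ?thesis by (auto simp: D_def)
qed

subsection \<open>Limits of moment sequences\<close>

text \<open>
  A point of the cone is the moment sequence of a finite discrete measure, here normalized to
  total mass \<open>1\<close>.
\<close>

lemma atomic_moments_distribution:
  assumes "m \<in> atomic_moments" "m 0 > 0"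
  obtains M where "real_distribution M" "AE x in M. x \<ge> 0"
    "\<And>k. has_bochner_integral M (\<lambda>x. x ^ k) (m k / m 0)"
proof -
  obtain n w x where wx: "\<And>i. i < n \<Longrightarrow> w i \<ge> 0" "\<And>i. i < n \<Longrightarrow> x i \<ge> 0"
    and m: "m = (\<lambda>k. \<Sum>i<n::nat. w i * x i ^ k)"
    using assms(1) unfolding atomic_moments_def by blast
  define Q where "Q = point_measure {..<n} (\<lambda>i. w i / m 0)"
  define M where "M = distr Q borel x"
  have nn: "w i / m 0 \<ge> 0" if "i < n" for i using wx(1)[OF that] assms(2) by simp
  have sp: "space Q = {..<n}" by (simp add: Q_def space_point_measure)
  have meas: "x \<in> measurable Q borel"
    by (simp add: Q_def measurable_def space_point_measure sets_point_measure)
  have "emeasure Q (space Q) = (\<Sum>i<n. ennreal (w i / m 0))"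
    unfolding sp unfolding Q_def by (subst emeasure_point_measure_finite) auto
  also have "\<dots> = ennreal (\<Sum>i<n. w i / m 0)" using nn by (intro sum_ennreal) auto
  also have "(\<Sum>i<n. w i / m 0) = 1"
  proof -
    have "(\<Sum>i<n. w i / m 0) = (\<Sum>i<n. w i * x i ^ 0) / m 0" by (simp add: sum_divide_distrib)
    also have "(\<Sum>i<n. w i * x i ^ 0) = m 0" by (simp add: m)
    finally show ?thesis using assms(2) by simp
  qed
  finally have "prob_space Q" by (intro prob_spaceI) simp
  then have P: "prob_space M" unfolding M_def using meas by (rule prob_space.prob_space_distr)
  show thesis
  proof
    show "real_distribution M"
      using P by (simp add: real_distribution_def real_distribution_axioms_def M_def)
    have "AE i in Q. x i \<ge> 0" using wx(2) by (auto intro!: AE_I2 simp: sp)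
    then show "AE x in M. x \<ge> 0" unfolding M_def using meas by (subst AE_distr_iff) auto
    fix k
    have "integrable Q (\<lambda>i. x i ^ k)" unfolding Q_def by (rule integrable_point_measure_finite) simp
    moreover have "integral\<^sup>L Q (\<lambda>i. x i ^ k) = m k / m 0"
      unfolding Q_def using nn
      by (subst lebesgue_integral_point_measure_finite) (auto simp: m sum_divide_distrib)
    ultimately have "has_bochner_integral Q (\<lambda>i. x i ^ k) (m k / m 0)"
      by (simp add: has_bochner_integral_iff)
    then show "has_bochner_integral M (\<lambda>x. x ^ k) (m k / m 0)"
      unfolding M_def using meas by (intro has_bochner_integral_distr) auto
  qed
qed

text \<open>
  Weak convergence of a subsequence only concerns bounded continuous functions, so \<open>x\<^sup>k\<close> is
  truncated at height \<open>R\<close>. On the half-line the truncation error is at most \<open>x\<^sup>2\<^sup>k / R\<close>, and the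
  moments of order \<open>2k\<close> are bounded, so that no mass of \<open>x\<^sup>k\<close> is lost in the limit.
\<close>

lemma real_distribution_moments_limit:
  fixes a :: "nat \<Rightarrow> real"
  assumes dist: "\<And>n. real_distribution (\<mu> n)" and supp: "\<And>n. AE x in \<mu> n. x \<ge> 0"
    and int: "\<And>n k. integrable (\<mu> n) (\<lambda>x. x ^ k)"
    and lim: "\<And>k. (\<lambda>n. \<integral>x. x ^ k \<partial>\<mu> n) \<longlonglongrightarrow> a k"
  shows "\<exists>M. real_distribution M \<and> (AE x in M. x \<ge> 0) \<and> (\<forall>k. has_bochner_integral M (\<lambda>x. x ^ k) (a k))"
proof -
  have tight: "tight \<mu>"
    unfolding tight_def
  proof (intro conjI allI impI dist)
    fix \<epsilon> :: real assume \<epsilon>: "\<epsilon> > 0"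
    have "Bseq (\<lambda>n. \<integral>x. x ^ 1 \<partial>\<mu> n)" using lim[of 1] by (intro convergent_imp_Bseq convergentI)
    then obtain C where C: "C > 0" "\<And>n. \<bar>\<integral>x. x ^ 1 \<partial>\<mu> n\<bar> \<le> C" by (auto simp: Bseq_def)
    define b where "b = 2 * C / \<epsilon>"
    have b: "b > 0" using C \<epsilon> by (simp add: b_def)
    have "measure (\<mu> n) {-1<..b} > 1 - \<epsilon>" for n
    proof -
      interpret real_distribution "\<mu> n" by fact
      have i: "integrable (\<mu> n) (\<lambda>x. x)" using int[of n 1] by simp
      have "(\<integral>x. x \<partial>\<mu> n) / b \<le> C / b" using C(2)[of n] b by (intro divide_right_mono) auto
      also have "C / b = \<epsilon> / 2" using C \<epsilon> by (simp add: b_def)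
      also have "\<dots> < \<epsilon>" using \<epsilon> by simp
      \<comment> \<open>On the half-line, \<open>1 - x / b\<close> is a minorant of the indicator function of \<open>(-1, b]\<close>.\<close>
      finally have "1 - \<epsilon> < 1 - (\<integral>x. x \<partial>\<mu> n) / b" by simp
      also have "\<dots> = (\<integral>x. 1 - x / b \<partial>\<mu> n)"
        using i by (subst Bochner_Integration.integral_diff) (use prob_space in auto)
      also have "\<dots> \<le> (\<integral>x. indicator {-1<..b} x \<partial>\<mu> n)"
      proof (rule integral_mono_AE)
        show "integrable (\<mu> n) (\<lambda>x. 1 - x / b)" using i by simp
        show "AE x in \<mu> n. 1 - x / b \<le> indicator {-1<..b} x"
          using supp[of n]
        proof eventually_elim
          case (elim x)
          then show ?case using b by (auto simp: indicator_def divide_simps)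
        qed
      qed (auto simp: emeasure_finite less_top[symmetric])
      also have "\<dots> = measure (\<mu> n) {-1<..b}" by simp
      finally show ?thesis .
    qed
    then show "\<exists>a b. a < b \<and> (\<forall>n. measure (\<mu> n) {a<..b} > 1 - \<epsilon>)"
      using b by (intro exI[of _ "-1"] exI[of _ b]) auto
  qed
  obtain r M where r: "strict_mono r" and M: "real_distribution M"
    and wc: "weak_conv_m (\<mu> \<circ> id \<circ> r) M"
    using tight_imp_convergent_subsubsequence[OF tight strict_mono_id] by blast
  interpret M: real_distribution M by fact
  have wlim: "(\<lambda>n. integral\<^sup>L (\<mu> (r n)) g) \<longlonglongrightarrow> integral\<^sup>L M g"
    if "\<And>x. isCont g x" "\<And>x. norm (g x) \<le> B" for g :: "real \<Rightarrow> real" and B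
    using weak_conv_imp_integral_bdd_continuous_conv[of "\<mu> \<circ> id \<circ> r" M g B] dist M wc that by simp
  have lim': "(\<lambda>n. \<integral>x. x ^ k \<partial>\<mu> (r n)) \<longlonglongrightarrow> a k" for k
    using LIMSEQ_subseq_LIMSEQ[OF lim[of k] r] by (simp add: o_def)
  have suppM: "AE x in M. x \<ge> 0"
  proof -
    \<comment> \<open>A bounded continuous function that vanishes exactly on the half-line.\<close>
    define h where "h x = min 1 (max 0 (- x))" for x :: real
    have hm: "h \<in> borel_measurable borel" unfolding h_def by measurable
    have "integral\<^sup>L (\<mu> n) h = 0" for n
    proof -
      have "integral\<^sup>L (\<mu> n) h = integral\<^sup>L (\<mu> n) (\<lambda>_. 0)"
      proof (rule integral_cong_AE)
        interpret real_distribution "\<mu> n" by fact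
        show "h \<in> borel_measurable (\<mu> n)" using hm by simp
        show "AE x in \<mu> n. h x = 0" using supp[of n] by eventually_elim (simp add: h_def)
      qed simp
      then show ?thesis by simp
    qed
    moreover have "(\<lambda>n. integral\<^sup>L (\<mu> (r n)) h) \<longlonglongrightarrow> integral\<^sup>L M h"
      unfolding h_def by (rule wlim[of _ 1]) (auto intro!: continuous_intros)
    ultimately have "integral\<^sup>L M h = 0" by (simp add: LIMSEQ_const_iff)
    moreover have "integrable M h"
      by (rule M.integrable_const_bound[of _ 1]) (use hm in \<open>auto simp: h_def\<close>)
    ultimately have "AE x in M. h x = 0"
      by (subst integral_nonneg_eq_0_iff_AE[symmetric]) (auto simp: h_def)
    then show ?thesis by eventually_elim (auto simp: h_def min_def max_def split: if_splits)
  qed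
  have "has_bochner_integral M (\<lambda>x. x ^ k) (a k)" for k
  proof -
    define g where "g R x = min (\<bar>x\<bar> ^ k) (real R)" for R :: nat and x :: real
    have gm: "g R \<in> borel_measurable borel" for R unfolding g_def by measurable
    have g0: "0 \<le> g R x" "g R x \<le> real R" for R x by (auto simp: g_def)
    have gi: "integrable N (g R)" if "real_distribution N" for N R
    proof -
      interpret N: real_distribution N by fact
      show ?thesis by (rule N.integrable_const_bound[of _ "real R"]) (use gm g0 in auto)
    qed
    have gl: "(\<lambda>n. integral\<^sup>L (\<mu> (r n)) (g R)) \<longlonglongrightarrow> integral\<^sup>L M (g R)" for R
    proof (rule wlim)
      show "isCont (g R) x" for x unfolding g_def by (intro continuous_intros)
      show "norm (g R x) \<le> real R" for x using g0[of R x] by simp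
    qed
    have upper: "integral\<^sup>L M (g R) \<le> a k" for R
    proof (rule LIMSEQ_le[OF gl lim'], intro exI allI impI)
      fix n
      show "integral\<^sup>L (\<mu> (r n)) (g R) \<le> (\<integral>x. x ^ k \<partial>\<mu> (r n))"
        by (rule integral_mono_AE[OF gi[OF dist] int]) (use supp[of "r n"] in \<open>auto simp: g_def\<close>)
    qed
    have lower: "a k - a (2 * k) / real R \<le> integral\<^sup>L M (g R)" if R: "R > 0" for R
    proof -
      have conv: "(\<lambda>n. (\<integral>x. x ^ k \<partial>\<mu> (r n)) - (\<integral>x. x ^ (2 * k) \<partial>\<mu> (r n)) / real R) \<longlonglongrightarrow> a k - a (2 * k) / real R"
        using R by (intro tendsto_intros lim') auto
      show ?thesis
      proof (rule LIMSEQ_le[OF conv gl], intro exI allI impI)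
      fix n
      have "(\<integral>x. x ^ k \<partial>\<mu> (r n)) - (\<integral>x. x ^ (2 * k) \<partial>\<mu> (r n)) / real R =
          (\<integral>x. x ^ k - x ^ (2 * k) / real R \<partial>\<mu> (r n))"
        using int by (subst Bochner_Integration.integral_diff) auto
      also have "\<dots> \<le> integral\<^sup>L (\<mu> (r n)) (g R)"
      proof (rule integral_mono_AE)
        show "integrable (\<mu> (r n)) (\<lambda>x. x ^ k - x ^ (2 * k) / real R)" using int by auto
        show "AE x in \<mu> (r n). x ^ k - x ^ (2 * k) / real R \<le> g R x"
          using supp[of "r n"]
        proof eventually_elim
          case (elim x)
          define z where "z = x ^ k"
          have z: "z \<ge> 0" using elim by (simp add: z_def)
          have "z - z\<^sup>2 / R \<le> min z R"
          proof (cases "z \<le> R")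
            case True
            then show ?thesis using R by simp
          next
            case False
            then have "z * R \<le> z * z" using z by (intro mult_left_mono) auto
            then have "z - z\<^sup>2 / R \<le> 0" using R by (simp add: field_simps power2_eq_square)
            then show ?thesis using z R by (simp add: min_def)
          qed
          then show ?case using elim by (simp add: g_def z_def power_mult[symmetric] mult.commute)
        qed
      qed (rule gi[OF dist])
      finally show "(\<integral>x. x ^ k \<partial>\<mu> (r n)) - (\<integral>x. x ^ (2 * k) \<partial>\<mu> (r n)) / real R \<le> integral\<^sup>L (\<mu> (r n)) (g R)" .
      qed
    qed
    have "has_bochner_integral M (\<lambda>x. \<bar>x\<bar> ^ k) (a k)"
    proof (rule has_bochner_integral_monotone_convergence)
      show "integrable M (g i)" for i by (rule gi) fact
      show "AE x in M. mono (\<lambda>n. g n x)" by (auto simp: mono_def g_def min_def)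
      show "AE x in M. (\<lambda>i. g i x) \<longlonglongrightarrow> \<bar>x\<bar> ^ k"
      proof (rule AE_I2)
        fix x :: real
        obtain N :: nat where "\<bar>x\<bar> ^ k \<le> real N" using real_arch_simple by blast
        then show "(\<lambda>i. g i x) \<longlonglongrightarrow> \<bar>x\<bar> ^ k"
          by (intro tendsto_eventually eventually_sequentiallyI[of N]) (auto simp: g_def)
      qed
      show "(\<lambda>i. integral\<^sup>L M (g i)) \<longlonglongrightarrow> a k"
      proof (rule tendsto_sandwich)
        show "\<forall>\<^sub>F R in sequentially. a k - a (2 * k) / real R \<le> integral\<^sup>L M (g R)"
          using lower by (intro eventually_sequentiallyI[of 1]) auto
        show "(\<lambda>R. a k - a (2 * k) / real R) \<longlonglongrightarrow> a k"
          using tendsto_diff[OF tendsto_const lim_const_over_n, of "a k" "a (2 * k)"] by simp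
      qed (auto simp: upper)
      show "(\<lambda>x. \<bar>x\<bar> ^ k) \<in> borel_measurable M" by measurable
    qed
    then show ?thesis
      by (rule has_bochner_integralI_AE) (use suppM in auto)
  qed
  with M suppM show ?thesis by blast
qed

subsection \<open>Stieltjes' theorem\<close>

lemma SM_I:
  assumes sets: "sets M = sets borel" and supp: "AE x in M. x \<ge> (0::real)" and c: "c \<ge> 0"
    and int: "\<And>k. has_bochner_integral M (\<lambda>x. x ^ k) (a k)"
  shows "SM (\<lambda>k. c * a k)"
  unfolding SM_def
proof (intro exI[of _ "density (restrict_space M {0..}) (\<lambda>_. ennreal c)"] conjI allI)
  show "sets (density (restrict_space M {0..}) (\<lambda>_. ennreal c)) = sets (restrict_space borel {0..})"
    using sets by (simp add: sets_restrict_space)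
  fix k
  have [measurable]: "(\<lambda>x. x) \<in> borel_measurable M" using sets by (simp add: measurable_cong_sets[OF sets refl])
  have "has_bochner_integral M (\<lambda>x. indicator {0..} x *\<^sub>R (c *\<^sub>R x ^ k)) (c * a k)"
  proof (rule has_bochner_integralI_AE)
    show "has_bochner_integral M (\<lambda>x. c * x ^ k) (c * a k)"
      by (rule has_bochner_integral_mult_right) (rule int)
    show "(\<lambda>x. indicator {0..} x *\<^sub>R (c *\<^sub>R x ^ k)) \<in> borel_measurable M"
      using sets by (intro borel_measurable_scaleR borel_measurable_indicator) auto
    show "AE x in M. c * x ^ k = indicator {0..} x *\<^sub>R (c *\<^sub>R x ^ k)"
      using supp by eventually_elim simp
  qed
  moreover have "{0..} \<inter> space M \<in> sets M" using sets sets_eq_imp_space_eq[OF sets] by simp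
  ultimately have "has_bochner_integral (restrict_space M {0..}) (\<lambda>x. c *\<^sub>R x ^ k) (c * a k)"
    by (simp only: has_bochner_integral_iff integrable_restrict_space integral_restrict_space)
  then show "has_bochner_integral (density (restrict_space M {0..}) (\<lambda>_. ennreal c)) (\<lambda>x. x ^ k) (c * a k)"
    using c by (intro has_bochner_integral_density) (auto intro!: measurable_restrict_space1)
qed

text \<open>
  The two conditions make the moment functional nonnegative on all polynomials that are
  nonnegative on the half-line. So for each \<open>n\<close> there is an atomic measure with the moments up to
  order \<open>n\<close> within \<open>1 / sqrt (n + 1)\<close> of the given ones, and a weak limit solves the problem.
\<close>

theorem Stieltjes_moment_theorem:
  fixes a :: "nat \<Rightarrow> real"
  assumes psd0: "\<And>N c. (\<Sum>i<N. \<Sum>j<N. c i * c j * a (i + j)) \<ge> 0"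
    and psd1: "\<And>N c. (\<Sum>i<N. \<Sum>j<N. c i * c j * a (Suc (i + j))) \<ge> 0"
  shows "SM a"
proof -
  have L: "moment_functional a p \<ge> 0" if "\<And>x. x \<ge> 0 \<Longrightarrow> poly p x \<ge> 0" for p
  proof (rule moment_functional_nonneg)
    fix u
    show "moment_functional a (u * u) \<ge> 0"
      using moment_functional_mult[of a 0 u u] psd0[of "coeff u" "Suc (degree u)"]
      by (simp add: lessThan_Suc_atMost monom_0)
    have "[:0, 1:] = monom (1::real) 1" by (simp add: monom_altdef)
    then show "moment_functional a ([:0, 1:] * (u * u)) \<ge> 0"
      using moment_functional_mult[of a 1 u u] psd1[of "coeff u" "Suc (degree u)"]
      by (simp add: lessThan_Suc_atMost mult.assoc)
  qed fact
  have a0: "a 0 \<ge> 0" using psd0[of "\<lambda>_. 1" 1] by simp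
  show ?thesis
  proof (cases "a 0 = 0")
    case True
    have "a k = 0" for k
    proof -
      \<comment> \<open>The square \<open>(t + X\<^sup>k)\<^sup>2\<close> has a nonnegative value for every \<open>t\<close>, which is affine in \<open>t\<close> if \<open>a 0 = 0\<close>.\<close>
      have *: "moment_functional a [:t\<^sup>2:] + moment_functional a (monom (2 * t) k) + moment_functional a (monom 1 (2 * k)) \<ge> 0" for t
        unfolding moment_functional_add[symmetric]
      proof (rule L)
        fix x :: real
        have "poly ([:t\<^sup>2:] + monom (2 * t) k + monom 1 (2 * k)) x = (t + x ^ k)\<^sup>2"
          by (simp add: poly_monom power2_sum power_even_eq)
        then show "poly ([:t\<^sup>2:] + monom (2 * t) k + monom 1 (2 * k)) x \<ge> 0" by simp
      qed
      have **: "2 * t * a k + a (2 * k) \<ge> 0" for t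
        using *[of t] True moment_functional_monom[of a "t\<^sup>2" 0]
        by (simp add: moment_functional_monom monom_0)
      show ?thesis
      proof (rule ccontr)
        assume "a k \<noteq> 0"
        then show False using **[of "- (a (2 * k) + 1) / (2 * a k)"] by (simp add: field_simps)
      qed
    qed
    then have "a = (\<lambda>k. 0 * 0)" by auto
    moreover have "SM (\<lambda>k. 0 * (0::real))"
      by (rule SM_I[of "null_measure borel"]) (auto simp: AE_iff_null null_sets_def)
    ultimately show ?thesis by simp
  next
    case False
    with a0 have pos: "a 0 > 0" by simp
    \<comment> \<open>The bound by \<open>(a 0)\<^sup>2\<close> keeps the total mass \<open>m 0\<close> positive.\<close>
    have "\<exists>m\<in>atomic_moments. (\<Sum>k\<le>n. (m k - a k)\<^sup>2) < min ((a 0)\<^sup>2) (1 / real (Suc n))" for n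
      by (rule atomic_moments_dense[OF L]) (use pos in auto)
    then obtain m where m: "\<And>n. m n \<in> atomic_moments"
      "\<And>n. (\<Sum>k\<le>n. (m n k - a k)\<^sup>2) < min ((a 0)\<^sup>2) (1 / real (Suc n))" by metis
    have close: "(m n k - a k)\<^sup>2 < (a 0)\<^sup>2" "(m n k - a k)\<^sup>2 < 1 / real (Suc n)" if "k \<le> n" for n k
    proof -
      have "(m n k - a k)\<^sup>2 \<le> (\<Sum>k\<le>n. (m n k - a k)\<^sup>2)"
        using that by (intro member_le_sum) auto
      then show "(m n k - a k)\<^sup>2 < (a 0)\<^sup>2" "(m n k - a k)\<^sup>2 < 1 / real (Suc n)"
        using m(2)[of n] by auto
    qed
    have m0: "m n 0 > 0" for n
    proof -
      have "\<bar>m n 0 - a 0\<bar> < a 0"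
        by (rule power2_less_imp_less) (use close(1)[of 0 n] pos in auto)
      then show ?thesis by linarith
    qed
    have mlim: "(\<lambda>n. m n k) \<longlonglongrightarrow> a k" for k
    proof -
      have "(\<lambda>n. (m n k - a k)\<^sup>2) \<longlonglongrightarrow> 0"
      proof (rule tendsto_sandwich[of "\<lambda>_. 0" _ _ "\<lambda>n. 1 / real (Suc n)"])
        show "\<forall>\<^sub>F n in sequentially. (m n k - a k)\<^sup>2 \<le> 1 / real (Suc n)"
          using close(2) by (intro eventually_sequentiallyI[of k]) (auto intro: less_imp_le)
        show "(\<lambda>n. 1 / real (Suc n)) \<longlonglongrightarrow> 0" using LIMSEQ_inverse_real_of_nat by (simp add: inverse_eq_divide)
      qed auto
      then have "(\<lambda>n. sqrt ((m n k - a k)\<^sup>2)) \<longlonglongrightarrow> sqrt 0" by (rule tendsto_real_sqrt)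
      then have "(\<lambda>n. m n k - a k) \<longlonglongrightarrow> 0" by (simp add: tendsto_rabs_zero_iff)
      then show ?thesis by (simp add: LIM_zero_iff)
    qed
    have "\<exists>M. real_distribution M \<and> (AE x in M. x \<ge> 0) \<and>
        (\<forall>k. has_bochner_integral M (\<lambda>x. x ^ k) (m n k / m n 0))" for n
      using atomic_moments_distribution[OF m(1) m0] by metis
    then obtain \<mu> where \<mu>: "\<And>n. real_distribution (\<mu> n)" "\<And>n. AE x in \<mu> n. x \<ge> 0"
      "\<And>n k. has_bochner_integral (\<mu> n) (\<lambda>x. x ^ k) (m n k / m n 0)" by metis
    have "\<exists>M. real_distribution M \<and> (AE x in M. x \<ge> 0) \<and> (\<forall>k. has_bochner_integral M (\<lambda>x. x ^ k) (a k / a 0))"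
    proof (rule real_distribution_moments_limit[OF \<mu>(1,2)])
      show "integrable (\<mu> n) (\<lambda>x. x ^ k)" for n k using \<mu>(3) by (auto simp: has_bochner_integral_iff)
      have "(\<lambda>n. m n k / m n 0) \<longlonglongrightarrow> a k / a 0" for k using pos by (intro tendsto_divide mlim) auto
      moreover have "(\<integral>x. x ^ k \<partial>\<mu> n) = m n k / m n 0" for n k
        using \<mu>(3) by (auto simp: has_bochner_integral_iff)
      ultimately show "(\<lambda>n. \<integral>x. x ^ k \<partial>\<mu> n) \<longlonglongrightarrow> a k / a 0" for k by simp
    qed
    then obtain M where M: "real_distribution M" "AE x in M. x \<ge> 0"
      "\<And>k. has_bochner_integral M (\<lambda>x. x ^ k) (a k / a 0)" by blast
    have "SM (\<lambda>k. a 0 * (a k / a 0))"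
      using M a0 by (intro SM_I[of M]) (auto simp: real_distribution.events_eq_borel)
    then show ?thesis using pos by simp
  qed
qed

theorem SM_if_hankel_TP:
  assumes "TP (\<lambda>i j. a (i + j))"
  shows "SM a"
proof (rule Stieltjes_moment_theorem)
  fix N and c :: "nat \<Rightarrow> real"
  show "(\<Sum>i<N. \<Sum>j<N. c i * c j * a (i + j)) \<ge> 0"
    by (rule principal_minors_imp_psd)
       (use assms in \<open>auto simp: TP_def all_minors_def add.commute\<close>)
  show "(\<Sum>i<N. \<Sum>j<N. c i * c j * a (Suc (i + j))) \<ge> 0"
  proof (rule principal_minors_imp_psd)
    fix n and r :: "nat \<Rightarrow> nat" assume "strict_mono_on {..<n} r"
    then have "minor (\<lambda>i j. a (i + j)) n (\<lambda>i. Suc (r i)) r \<ge> 0"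
      using assms by (auto simp: TP_def all_minors_def strict_mono_on_def)
    then show "minor (\<lambda>i j. a (Suc (i + j))) n r r \<ge> 0" by (simp add: minor_def)
  qed (simp add: add.commute)
qed

subsection \<open>Operations that preserve Stieltjes moment sequences\<close>

lemma SM_nonneg:
  assumes "SM a" and "\<And>x. x \<ge> 0 \<Longrightarrow> (\<Sum>k\<in>I. c k * x ^ e k) \<ge> 0"
  shows "(\<Sum>k\<in>I. c k * a (e k)) \<ge> 0"
proof -
  obtain \<mu> :: "real measure" where \<mu>: "sets \<mu> = sets (restrict_space borel {0..})"
    "\<And>k. has_bochner_integral \<mu> (\<lambda>x. x ^ k) (a k)" using assms(1) unfolding SM_def by blast
  have sp: "space \<mu> = {0..}"
    using sets_eq_imp_space_eq[OF \<mu>(1)] by (simp add: space_restrict_space)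
  have "has_bochner_integral \<mu> (\<lambda>x. \<Sum>k\<in>I. c k * x ^ e k) (\<Sum>k\<in>I. c k * a (e k))"
    by (intro has_bochner_integral_sum has_bochner_integral_mult_right \<mu>(2))
  moreover have "integral\<^sup>L \<mu> (\<lambda>x. \<Sum>k\<in>I. c k * x ^ e k) \<ge> 0"
    using assms(2) sp by (intro Bochner_Integration.integral_nonneg_AE AE_I2) auto
  ultimately show ?thesis by (simp add: has_bochner_integral_iff)
qed

lemma SM_nonneg2:
  assumes "SM a" "SM b" and "\<And>x y. x \<ge> 0 \<Longrightarrow> y \<ge> 0 \<Longrightarrow> (\<Sum>k\<in>I. c k * x ^ d k * y ^ e k) \<ge> 0"
  shows "(\<Sum>k\<in>I. c k * a (d k) * b (e k)) \<ge> 0"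
proof -
  have "(\<Sum>k\<in>I. (c k * b (e k)) * x ^ d k) \<ge> 0" if "x \<ge> 0" for x
  proof -
    have "(\<Sum>k\<in>I. (c k * x ^ d k) * b (e k)) \<ge> 0"
      by (rule SM_nonneg[OF assms(2)]) (use assms(3) that in \<open>auto simp: mult.assoc\<close>)
    then show ?thesis by (simp add: mult_ac)
  qed
  from SM_nonneg[OF assms(1) this] show ?thesis by (simp add: mult_ac)
qed

lemma SM_mult:
  assumes "SM a" "SM b"
  shows "SM (\<lambda>k. a k * b k)"
proof (rule Stieltjes_moment_theorem)
  fix N and c :: "nat \<Rightarrow> real"
  have "(\<Sum>k\<in>{..<N} \<times> {..<N}. (c (fst k) * c (snd k)) * a (s + (fst k + snd k)) * b (s + (fst k + snd k))) \<ge> 0" for s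
  proof (rule SM_nonneg2[OF assms])
    fix x y :: real assume xy: "x \<ge> 0" "y \<ge> 0"
    have "(\<Sum>k\<in>{..<N} \<times> {..<N}. c (fst k) * c (snd k) * x ^ (s + (fst k + snd k)) * y ^ (s + (fst k + snd k))) =
        (x * y) ^ s * (\<Sum>i<N. c i * (x * y) ^ i)\<^sup>2"
      by (simp add: power2_eq_square sum_product sum_distrib_left sum.cartesian_product case_prod_unfold
          power_add power_mult_distrib mult_ac)
    then show "(\<Sum>k\<in>{..<N} \<times> {..<N}. c (fst k) * c (snd k) * x ^ (s + (fst k + snd k)) * y ^ (s + (fst k + snd k))) \<ge> 0"
      using xy by simp
  qed
  note * = this[of 0] this[of 1]
  show "(\<Sum>i<N. \<Sum>j<N. c i * c j * (a (i + j) * b (i + j))) \<ge> 0"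
    using *(1) by (simp add: sum.cartesian_product case_prod_unfold mult.assoc)
  show "(\<Sum>i<N. \<Sum>j<N. c i * c j * (a (Suc (i + j)) * b (Suc (i + j)))) \<ge> 0"
    using *(2) by (simp add: sum.cartesian_product case_prod_unfold mult.assoc)
qed

text \<open>
  The factorials are the moments of the exponential distribution, the Erlang distribution of
  shape parameter \<open>0\<close>.
\<close>

lemma SM_fact: "SM fact"
proof -
  let ?M = "density lborel (\<lambda>x. ennreal (erlang_density 0 1 x))"
  interpret prob_space ?M by (rule prob_space_erlang_density) simp
  have "distributed ?M lborel (\<lambda>x. x) (erlang_density 0 1)"
    by (auto simp: distributed_def distr_id2)
  from has_bochner_integral_erlang_ith_moment[OF _ this]
  have "has_bochner_integral ?M (\<lambda>x. x ^ k) (fact k)" for k by simp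
  moreover have "AE x in ?M. x \<ge> 0"
    by (subst AE_density) (auto simp: erlang_density_def)
  ultimately have "SM (\<lambda>k. 1 * fact k)" by (intro SM_I[of ?M]) auto
  then show ?thesis by simp
qed

text \<open>
  Integrating the positive semidefinite forms of the Hankel matrices of the homogeneous row
  polynomials against the two measures gives those of the convolution.
\<close>

lemma convolution_preserves_SM_if_row_polynomials_TP:
  assumes "\<And>s t. s \<ge> 0 \<Longrightarrow> t \<ge> 0 \<Longrightarrow> TP (\<lambda>i j. \<Sum>k\<le>i + j. A (i + j) k * s ^ k * t ^ (i + j - k))"
  shows "convolution_preserves_SM A"
  unfolding convolution_preserves_SM_def
proof (intro allI impI, elim conjE)
  fix x y assume xy: "SM x" "SM y"
  show "SM (Defs.convolution A x y)"
  proof (rule Stieltjes_moment_theorem)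
    fix N and c :: "nat \<Rightarrow> real"
    have "(\<Sum>i<N. \<Sum>j<N. c i * c j * Defs.convolution A x y (e + (i + j))) \<ge> 0" for e
    proof -
      let ?I = "SIGMA p:{..<N} \<times> {..<N}. {..e + (fst p + snd p)}"
      let ?n = "\<lambda>q. e + (fst (fst q) + snd (fst q))"
      have expand: "(\<Sum>i<N. \<Sum>j<N. c i * c j * (\<Sum>k\<le>e + (i + j). A (e + (i + j)) k * X k * Y (e + (i + j) - k))) =
          (\<Sum>q\<in>?I. (c (fst (fst q)) * c (snd (fst q)) * A (?n q) (snd q)) * X (snd q) * Y (?n q - snd q))" for X Y
      proof -
        have "(\<Sum>i<N. \<Sum>j<N. c i * c j * (\<Sum>k\<le>e + (i + j). A (e + (i + j)) k * X k * Y (e + (i + j) - k))) =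
            (\<Sum>p\<in>{..<N} \<times> {..<N}. \<Sum>k\<le>e + (fst p + snd p). (c (fst p) * c (snd p) * A (e + (fst p + snd p)) k) *
              X k * Y (e + (fst p + snd p) - k))"
          by (simp add: sum.cartesian_product' sum_distrib_left mult_ac)
        also have "\<dots> = (\<Sum>q\<in>?I. (c (fst (fst q)) * c (snd (fst q)) * A (?n q) (snd q)) * X (snd q) * Y (?n q - snd q))"
          by (subst sum.Sigma) (auto simp: case_prod_unfold)
        finally show ?thesis .
      qed
      have "(\<Sum>q\<in>?I. (c (fst (fst q)) * c (snd (fst q)) * A (?n q) (snd q)) * x (snd q) * y (?n q - snd q)) \<ge> 0"
      proof (rule SM_nonneg2[OF xy])
        fix s t :: real assume st: "s \<ge> 0" "t \<ge> 0"
        define a where "a n = (\<Sum>k\<le>n. A n k * s ^ k * t ^ (n - k))" for n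
        have "SM a" using assms[OF st] by (intro SM_if_hankel_TP) (simp add: a_def)
        have "(\<Sum>k\<in>{..<N} \<times> {..<N}. (c (fst k) * c (snd k)) * a (e + (fst k + snd k))) \<ge> 0"
        proof (rule SM_nonneg[OF \<open>SM a\<close>])
          fix z :: real assume z: "z \<ge> 0"
          have "(\<Sum>k\<in>{..<N} \<times> {..<N}. c (fst k) * c (snd k) * z ^ (e + (fst k + snd k))) =
              z ^ e * (\<Sum>i<N. c i * z ^ i)\<^sup>2"
            by (simp add: power2_eq_square sum_product sum_distrib_left sum.cartesian_product case_prod_unfold
                power_add mult_ac)
          then show "(\<Sum>k\<in>{..<N} \<times> {..<N}. c (fst k) * c (snd k) * z ^ (e + (fst k + snd k))) \<ge> 0"
            using z by simp
        qed
        then show "(\<Sum>q\<in>?I. (c (fst (fst q)) * c (snd (fst q)) * A (?n q) (snd q)) * s ^ snd q * t ^ (?n q - snd q)) \<ge> 0"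
          unfolding expand[of "\<lambda>k. s ^ k" "\<lambda>k. t ^ k", symmetric]
          by (simp add: a_def sum.cartesian_product case_prod_unfold)
      qed
      then show ?thesis unfolding Defs.convolution_def expand[symmetric] .
    qed
    from this[of 0] this[of 1]
    show "(\<Sum>i<N. \<Sum>j<N. c i * c j * Defs.convolution A x y (i + j)) \<ge> 0"
      "(\<Sum>i<N. \<Sum>j<N. c i * c j * Defs.convolution A x y (Suc (i + j))) \<ge> 0" by simp_all
  qed
qed

section \<open>Exponential generating functions over real algebras\<close>

text \<open>
  The iteration matrix of \<open>h\<close>: composition of series becomes multiplication of these matrices.
\<close>

definition assoc_tri :: "real fps \<Rightarrow> nat \<Rightarrow> nat \<Rightarrow> real" where
  "assoc_tri h n k = fact n / fact k * fps_nth (h ^ k) n"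

lemma assoc_tri_high: "fps_nth h 0 = 0 \<Longrightarrow> n < k \<Longrightarrow> assoc_tri h n k = 0"
  using startsby_zero_power_prefix[of h k] by (simp add: assoc_tri_def)

lemma const_poly_sum: "[:sum h I:] = (\<Sum>i\<in>I. [:h i:])"
  by (rule poly_eqI) (simp add: coeff_sum coeff_pCons split: nat.split)

lemma const_poly_power: "[:b ^ k:] = [:b:] ^ k" for b :: "'a::comm_semiring_1"
proof (induction k)
  case (Suc k)
  have "[:b ^ Suc k:] = [:b:] * [:b ^ k:]" by (simp add: mult.commute)
  then show ?case by (simp only: Suc power_Suc)
qed (simp add: one_pCons)

locale real_idom_algebra = real_algebra \<iota> for \<iota> :: "real \<Rightarrow> 'a::{idom_divide,ring_char_0}"
begin

definition map_fps :: "real fps \<Rightarrow> 'a fps" where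
  "map_fps F = Abs_fps (\<lambda>n. \<iota> (fps_nth F n))"

lemma map_fps_power: "map_fps F ^ k = map_fps (F ^ k)"
proof (induction k)
  case 0
  show ?case by (simp add: map_fps_def fps_eq_iff \<iota>_0 \<iota>_1)
next
  case (Suc k)
  have "map_fps F * map_fps (F ^ k) = map_fps (F * F ^ k)"
    by (simp add: map_fps_def fps_eq_iff fps_mult_nth \<iota>_sum \<iota>_mult)
  then show ?case by (simp add: Suc)
qed

lemma \<iota>_fact: "\<iota> (fact n) = fact n"
  by (metis \<iota>_of_nat of_nat_fact)

lemma one_div_fact: "1 div fact k = \<iota> (1 / fact k)"
proof -
  have "fact k * \<iota> (1 / fact k) = 1"
    by (simp flip: \<iota>_fact \<iota>_mult add: \<iota>_1)
  then show ?thesis by (metis fact_nonzero nonzero_mult_div_cancel_left)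
qed

lemma exp_fps_compose:
  "exp_fps (fps_const c * map_fps h) = Abs_fps (\<lambda>k. \<iota> (1 / fact k) * c ^ k) oo map_fps h"
  by (simp add: exp_fps_def fps_eq_iff fps_compose_nth one_div_fact power_mult_distrib mult.assoc)

lemma exp_fps_add:
  assumes "fps_nth h 0 = 0"
  shows "exp_fps (fps_const c * map_fps h) * exp_fps (fps_const d * map_fps h) =
    exp_fps (fps_const (c + d) * map_fps h)"
proof -
  have "Abs_fps (\<lambda>k. \<iota> (1 / fact k) * c ^ k) * Abs_fps (\<lambda>k. \<iota> (1 / fact k) * d ^ k) =
      Abs_fps (\<lambda>k. \<iota> (1 / fact k) * (c + d) ^ k)"
  proof (rule fps_ext)
    fix n
    have "\<iota> (1 / fact i) * \<iota> (1 / fact (n - i)) = \<iota> (1 / fact n) * of_nat (n choose i)" if "i \<le> n" for i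
    proof -
      have "1 / fact i * (1 / fact (n - i)) = 1 / fact n * real (n choose i)"
        using that by (simp add: binomial_fact)
      then show ?thesis by (metis \<iota>_mult \<iota>_of_nat)
    qed
    moreover have "\<iota> (1 / fact i) * c ^ i * (\<iota> (1 / fact (n - i)) * d ^ (n - i)) =
        (\<iota> (1 / fact i) * \<iota> (1 / fact (n - i))) * (c ^ i * d ^ (n - i))" for i
      by (simp only: mult_ac)
    ultimately have "(\<Sum>i=0..n. \<iota> (1 / fact i) * c ^ i * (\<iota> (1 / fact (n - i)) * d ^ (n - i))) =
        (\<Sum>i=0..n. (\<iota> (1 / fact n) * of_nat (n choose i)) * (c ^ i * d ^ (n - i)))"
      by (intro sum.cong refl) simp
    then show "fps_nth (Abs_fps (\<lambda>k. \<iota> (1 / fact k) * c ^ k) * Abs_fps (\<lambda>k. \<iota> (1 / fact k) * d ^ k)) n =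
        fps_nth (Abs_fps (\<lambda>k. \<iota> (1 / fact k) * (c + d) ^ k)) n"
      by (simp add: fps_mult_nth binomial_ring sum_distrib_left atLeast0AtMost mult.assoc)
  qed
  moreover have "fps_nth (map_fps h) 0 = 0" using assms by (simp add: map_fps_def \<iota>_0)
  ultimately show ?thesis
    unfolding exp_fps_compose by (subst fps_compose_mult_distrib[symmetric]) simp_all
qed

lemma exp_fps_nth:
  "fps_nth (exp_fps (fps_const c * map_fps h)) n = (\<Sum>k\<le>n. \<iota> (1 / fact k * fps_nth (h ^ k) n) * c ^ k)"
  unfolding exp_fps_compose fps_compose_nth map_fps_power \<iota>_mult
  by (simp add: map_fps_def atLeast0AtMost mult_ac)

lemma egf_coeff_exp_fps:
  "egf_coeff (exp_fps (fps_const c * map_fps h)) n = (\<Sum>k\<le>n. \<iota> (assoc_tri h n k) * c ^ k)"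
proof -
  have "fact n * (\<iota> (1 / fact k * fps_nth (h ^ k) n) * c ^ k) = \<iota> (assoc_tri h n k) * c ^ k" for k
    unfolding assoc_tri_def by (simp flip: \<iota>_fact \<iota>_mult mult.assoc)
  then show ?thesis unfolding egf_coeff_def exp_fps_nth sum_distrib_left by (intro sum.cong refl)
qed

lemma poly_algebra: "real_idom_algebra (\<lambda>x. [:\<iota> x:])"
  by unfold_locales (simp_all add: \<iota>_1 \<iota>_add \<iota>_mult one_pCons)

text \<open>
  The factors \<open>exp (c h)\<close> and \<open>exp (q h)\<close> of the generating function combine to \<open>exp ((c + q) h)\<close>.
\<close>

lemma S_poly_exp:
  assumes "fps_nth h 0 = 0"
  shows "S_poly (map_fps h) (exp_fps (fps_const c * map_fps h)) n =
    (\<Sum>m\<le>n. [:\<iota> (assoc_tri h n m):] * [:c, 1:] ^ m)"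
proof -
  interpret poly: real_idom_algebra "\<lambda>x. [:\<iota> x:]" by (rule poly_algebra)
  have h: "const_fps (map_fps h) = poly.map_fps h"
    by (simp add: const_fps_def map_fps_def poly.map_fps_def)
  have "const_fps (exp_fps (fps_const c * map_fps h)) = exp_fps (fps_const [:c:] * poly.map_fps h)"
  proof (rule fps_ext)
    fix n
    show "fps_nth (const_fps (exp_fps (fps_const c * map_fps h))) n =
        fps_nth (exp_fps (fps_const [:c:] * poly.map_fps h)) n"
      unfolding poly.exp_fps_nth by (simp add: const_fps_def exp_fps_nth const_poly_sum mult.commute flip: const_poly_power)
  qed
  then have "S_poly (map_fps h) (exp_fps (fps_const c * map_fps h)) n =
      egf_coeff (exp_fps (fps_const ([:c:] + [:0, 1:]) * poly.map_fps h)) n"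
    unfolding S_poly_def h by (simp only: poly.exp_fps_add[OF assms])
  also have "[:c:] + [:0, 1:] = [:c, 1:]" by simp
  finally show ?thesis by (simp only: poly.egf_coeff_exp_fps)
qed

lemma coeff_linear_power: "coeff ([:c, 1:] ^ m) k = of_nat (m choose k) * c ^ (m - k)"
  for c :: "'b::comm_ring_1"
proof (induction m arbitrary: k)
  case 0
  show ?case by (cases k) auto
next
  case (Suc m)
  show ?case
  proof (cases k)
    case 0
    then show ?thesis by (simp add: Suc)
  next
    case (Suc k')
    have "of_nat (m choose k) * c ^ (m - k') = c * (of_nat (m choose k) * c ^ (m - k))"
    proof (cases "k \<le> m")
      case True
      then have "m - k' = Suc (m - k)" by (simp add: Suc)
      then show ?thesis by simp
    qed (simp add: binomial_eq_0)
    then show ?thesis using Suc.IH by (simp add: Suc distrib_right)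
  qed
qed

lemma S_tri_exp:
  assumes "fps_nth h 0 = 0"
  shows "S_tri (map_fps h) (exp_fps (fps_const c * map_fps h)) n k =
    (\<Sum>m\<le>n. of_nat (m choose k) * \<iota> (assoc_tri h n m) * c ^ (m - k))"
  unfolding S_tri_def S_poly_exp[OF assms]
  by (simp add: coeff_sum coeff_linear_power mult_ac)

lemma S_star_poly_exp:
  assumes "fps_nth h 0 = 0"
  shows "S_star_poly (map_fps h) (exp_fps (fps_const c * map_fps h)) n =
    (\<Sum>m\<le>n. [:\<iota> (assoc_tri h n m):] * ([:0, 1:] * [:c:] + 1) ^ m * [:0, 1:] ^ (n - m))"
proof -
  let ?q = "[:0, 1:] :: 'a poly"
  have mono: "monom b k = [:b:] * ?q ^ k" for b k by (simp add: monom_altdef)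
  have "monom (S_tri (map_fps h) (exp_fps (fps_const c * map_fps h)) n k) (n - k) =
      (\<Sum>m\<le>n. [:\<iota> (assoc_tri h n m):] * (of_nat (m choose k) * (?q * [:c:]) ^ (m - k)) * ?q ^ (n - m))"
    if "k \<le> n" for k
  proof -
    have "monom (of_nat (m choose k) * \<iota> (assoc_tri h n m) * c ^ (m - k)) (n - k) =
        [:\<iota> (assoc_tri h n m):] * (of_nat (m choose k) * (?q * [:c:]) ^ (m - k)) * ?q ^ (n - m)"
      if "m \<le> n" for m
    proof (cases "k \<le> m")
      case True
      then have "n - k = (m - k) + (n - m)" using that by simp
      then have q: "?q ^ (n - k) = ?q ^ (m - k) * ?q ^ (n - m)" by (simp only: power_add)
      have "monom (of_nat (m choose k) * \<iota> (assoc_tri h n m) * c ^ (m - k)) (n - k) =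
          ([:of_nat (m choose k):] * [:\<iota> (assoc_tri h n m):] * [:c:] ^ (m - k)) * ?q ^ (n - k)"
        unfolding mono const_poly_power[symmetric] by (simp add: mult_ac)
      also have "[:of_nat (m choose k):] = (of_nat (m choose k) :: 'a poly)" by (simp add: of_nat_poly)
      finally show ?thesis unfolding q by (simp only: power_mult_distrib mult_ac)
    qed (simp add: binomial_eq_0)
    then show ?thesis by (simp add: S_tri_exp[OF assms] monom_sum)
  qed
  then have "S_star_poly (map_fps h) (exp_fps (fps_const c * map_fps h)) n =
      (\<Sum>m\<le>n. [:\<iota> (assoc_tri h n m):] * (\<Sum>k\<le>n. of_nat (m choose k) * (?q * [:c:]) ^ (m - k)) * ?q ^ (n - m))"
    unfolding S_star_poly_def sum_distrib_left sum_distrib_right by (subst sum.swap) simp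
  also have "\<dots> = (\<Sum>m\<le>n. [:\<iota> (assoc_tri h n m):] * (?q * [:c:] + 1) ^ m * ?q ^ (n - m))"
  proof (intro sum.cong refl)
    fix m assume "m \<in> {..n}"
    then have "(\<Sum>k\<le>n. of_nat (m choose k) * (?q * [:c:]) ^ (m - k)) =
        (\<Sum>k\<le>m. of_nat (m choose k) * (?q * [:c:]) ^ (m - k))"
      by (intro sum.mono_neutral_right) (auto simp: binomial_eq_0)
    also have "\<dots> = (1 + ?q * [:c:]) ^ m" by (subst binomial_ring) simp
    finally show "[:\<iota> (assoc_tri h n m):] * (\<Sum>k\<le>n. of_nat (m choose k) * (?q * [:c:]) ^ (m - k)) * ?q ^ (n - m) =
        [:\<iota> (assoc_tri h n m):] * (?q * [:c:] + 1) ^ m * ?q ^ (n - m)" by (simp only: add.commute)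
  qed
  finally show ?thesis .
qed

end

lemma real_idom_algebra_id: "real_idom_algebra (\<lambda>x. x)"
  by unfold_locales auto

text \<open>
  All triangles of \<open>h\<close> in question are read off from a fixed series in \<open>q h\<close>, with \<open>\<gamma>\<^sub>k\<close> equal to \<open>1 / k!\<close>,
  \<open>1 / k\<close> or \<open>1\<close>; they differ by scalings of the columns.
\<close>

lemma coeff_compose_linear:
  fixes h :: "real fps"
  assumes "fps_nth h 0 = 0"
  shows "coeff (fps_nth (Abs_fps (\<lambda>i. [:\<gamma> i:]) oo (fps_const [:0, 1:] * const_fps h)) n) k =
    \<gamma> k * fps_nth (h ^ k) n"
proof -
  interpret id: real_idom_algebra "\<lambda>x. x" by (rule real_idom_algebra_id)
  interpret const: real_idom_algebra "\<lambda>x. [:x:]" by (rule id.poly_algebra)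
  have "const_fps h = const.map_fps h" by (simp add: const_fps_def const.map_fps_def)
  then have "(fps_const [:0, 1:] * const_fps h) ^ i = fps_const ([:0, 1:] ^ i) * const.map_fps (h ^ i)" for i
    by (simp add: power_mult_distrib const.map_fps_power)
  then have "fps_nth (Abs_fps (\<lambda>i. [:\<gamma> i:]) oo (fps_const [:0, 1:] * const_fps h)) n =
      (\<Sum>i=0..n. [:\<gamma> i:] * ([:0, 1:] ^ i * [:fps_nth (h ^ i) n:]))"
    by (simp add: fps_compose_nth const.map_fps_def)
  also have "\<dots> = (\<Sum>i=0..n. monom (\<gamma> i * fps_nth (h ^ i) n) i)"
    by (intro sum.cong refl) (simp add: monom_altdef mult_ac)
  also have "coeff \<dots> k = (\<Sum>i=0..n. if i = k then \<gamma> k * fps_nth (h ^ k) n else 0)"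
    unfolding coeff_sum by (intro sum.cong) (auto simp: coeff_monom)
  also have "\<dots> = \<gamma> k * fps_nth (h ^ k) n"
    using startsby_zero_power_prefix[OF assms, of k] by (auto simp: not_le)
  finally show ?thesis .
qed

lemma coeff_fact_mult: "coeff (fact n * p) k = fact n * coeff p k" for p :: "real poly"
proof -
  have "(fact n :: real poly) = [:fact n:]" by (metis of_nat_fact of_nat_poly)
  then show ?thesis by simp
qed

lemma S_tri_1:
  assumes "fps_nth h 0 = 0"
  shows "S_tri h 1 n k = assoc_tri h n k"
proof -
  have "const_fps 1 = (1 :: real poly fps)" by (auto simp: const_fps_def fps_eq_iff one_pCons)
  then have "S_tri h 1 n k = fact n * coeff (fps_nth (Abs_fps (\<lambda>i. [:1 / fact i:]) oo (fps_const [:0, 1:] * const_fps h)) n) k"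
    by (simp add: S_tri_def S_poly_def egf_coeff_def exp_fps_def one_div_fact_poly coeff_fact_mult)
  then show ?thesis by (simp only: coeff_compose_linear[OF assms] assoc_tri_def) simp
qed

lemma L_tri_assoc_tri:
  assumes "fps_nth h 0 = 0"
  shows "L_tri h n k = assoc_tri h n k * (if k = 0 then 1 else fact (k - 1))"
proof -
  let ?H = "fps_const [:0, 1:] * const_fps h"
  define \<gamma> where "\<gamma> i = (if i = 0 then 0 else 1 / real i)" for i :: nat
  have c: "(- 1) ^ (i - 1) div of_nat i = ([:(- 1) ^ (i - 1) / real i:] :: real poly)" if "i > 0" for i :: nat
  proof -
    have "of_nat i * [:(- 1) ^ (i - 1) / real i:] = ([:(- 1) ^ (i - 1):] :: real poly)"
      using that by (simp add: of_nat_poly)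
    also have "[:(- 1) ^ (i - 1) :: real:] = (- 1) ^ (i - 1)"
      by (simp only: const_poly_power) (simp add: one_pCons)
    finally show ?thesis using that by (metis nonzero_mult_div_cancel_left of_nat_0_eq_iff less_numeral_extra(3))
  qed
  have "- log_fps (1 - ?H) = Abs_fps (\<lambda>i. [:\<gamma> i:]) oo ?H"
  proof (rule fps_ext)
    fix n
    have "fps_nth (- log_fps (1 - ?H)) n =
        (\<Sum>i=0..n. - ((if i = 0 then 0 else (- 1) ^ (i - 1) div of_nat i) * fps_nth ((- ?H) ^ i) n))"
      by (simp add: log_fps_def fps_compose_nth sum_negf)
    also have "\<dots> = (\<Sum>i=0..n. [:\<gamma> i:] * fps_nth (?H ^ i) n)"
    proof (intro sum.cong refl)
      fix i
      show "- ((if i = 0 then 0 else (- 1) ^ (i - 1) div of_nat i) * fps_nth ((- ?H) ^ i) n) =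
          [:\<gamma> i:] * fps_nth (?H ^ i) n"
      proof (cases i)
        case 0
        then show ?thesis by (simp add: \<gamma>_def)
      next
        case (Suc i')
        have "(- ?H) ^ i = fps_const ((- 1) ^ i) * ?H ^ i"
          by (subst power_minus) (simp flip: fps_const_power fps_const_neg)
        then have "fps_nth ((- ?H) ^ i) n = (- 1) ^ i * fps_nth (?H ^ i) n" by simp
        then show ?thesis
          using c[of i] by (cases "even i'") (simp_all add: Suc \<gamma>_def)
      qed
    qed
    finally show "fps_nth (- log_fps (1 - ?H)) n = fps_nth (Abs_fps (\<lambda>i. [:\<gamma> i:]) oo ?H) n"
      by (simp add: fps_compose_nth)
  qed
  then have *: "coeff (egf_coeff (- log_fps (1 - ?H)) n) k = fact n * (\<gamma> k * fps_nth (h ^ k) n)"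
    by (simp only: egf_coeff_def coeff_fact_mult coeff_compose_linear[OF assms])
  show ?thesis
  proof (cases k)
    case 0
    then show ?thesis using * by (cases n) (simp_all add: L_tri_def \<gamma>_def assoc_tri_def)
  next
    case (Suc k')
    then show ?thesis using * by (simp add: L_tri_def \<gamma>_def assoc_tri_def del: of_nat_Suc power_Suc)
  qed
qed

lemma Lt_tri_assoc_tri:
  assumes "fps_nth h 0 = 0"
  shows "Lt_tri h n k = assoc_tri h n k * fact k"
proof -
  let ?H = "fps_const [:0, 1:] * const_fps h"
  have H0: "fps_nth ?H 0 = 0" using assms by (simp add: const_fps_def)
  define E :: "real poly fps" where "E = Abs_fps (\<lambda>_. 1)"
  have "(1 - fps_X) * E = 1"
    by (simp add: E_def fps_eq_iff left_diff_distrib split: nat.split)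
  then have "((1 - fps_X) oo ?H) * (E oo ?H) = 1"
    using fps_compose_mult_distrib[OF H0, of "1 - fps_X" E] by simp
  moreover have "(1 - fps_X) oo ?H = 1 - ?H" using H0 by (simp add: fps_compose_sub_distrib)
  ultimately have inv: "(1 - ?H) * (E oo ?H) = 1" by simp
  have recip: "(1 - ?H) * recip_fps (1 - ?H) = 1" using H0 by (intro recip_fps) simp
  have "recip_fps (1 - ?H) = ((1 - ?H) * (E oo ?H)) * recip_fps (1 - ?H)" unfolding inv by simp
  also have "\<dots> = ((1 - ?H) * recip_fps (1 - ?H)) * (E oo ?H)" by (simp only: mult_ac)
  also have "\<dots> = E oo ?H" unfolding recip by simp
  finally have "recip_fps (1 - ?H) = Abs_fps (\<lambda>i. [:1:]) oo ?H" by (simp add: E_def one_pCons)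
  then show ?thesis
    unfolding Lt_tri_def egf_coeff_def by (simp only: coeff_fact_mult coeff_compose_linear[OF assms]) (simp add: assoc_tri_def)
qed

section \<open>Coefficientwise nonnegative polynomials\<close>

lemma real_algebra_cone_real: "real_algebra_cone (\<lambda>x::real. x \<ge> 0) (\<lambda>x. x)"
  by unfold_locales auto

lemma real_algebra_cone_poly: "real_algebra_cone coeffs_nonneg1 (\<lambda>x. [:x:])"
  by unfold_locales
     (auto simp: coeffs_nonneg1_def coeff_mult one_pCons coeff_pCons split: nat.split intro!: sum_nonneg)

lemma real_algebra_cone_poly_poly: "real_algebra_cone coeffs_nonneg2 (\<lambda>x. [:[:x:]:])"
  by unfold_locales
     (auto simp: coeffs_nonneg2_def coeff_mult coeff_sum one_pCons coeff_pCons split: nat.split intro!: sum_nonneg)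

section \<open>The arrays of a series\<close>

locale PF_inverse_derivative =
  fixes f :: "real fps"
  assumes f0: "fps_nth f 0 = 0" and f1: "egf_coeff f 1 \<noteq> 0"
    and PF: "PF_function (inverse (fps_deriv (fps_inv f)))"
begin

definition \<Phi> :: "real fps" where "\<Phi> = inverse (fps_deriv (fps_inv f))"

lemma f1': "fps_nth f 1 \<noteq> 0"
  using f1 by (simp add: egf_coeff_def)

lemma inv0: "fps_nth (fps_inv f) 0 = 0"
  by (simp add: fps_inv_def)

text \<open>
  This is the chain rule for the composition of \<open>f\<close> with its inverse, and links the hypothesis to \<open>f\<close>.
\<close>

lemma deriv_eq: "fps_deriv f = \<Phi> oo f"
proof -
  have "fps_nth (fps_deriv f oo fps_inv f) 0 \<noteq> 0" using f1' by simp
  then have "\<Phi> = fps_deriv f oo fps_inv f"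
    unfolding \<Phi>_def fps_inv_deriv[OF f0 f1'] by (rule fps_inverse_idempotent)
  then have "\<Phi> oo f = fps_deriv f oo (fps_inv f oo f)"
    using fps_compose_assoc[OF f0 inv0] by simp
  then show ?thesis using fps_inv[OF f0 f1'] by simp
qed

lemma \<Phi>_TP: "TP (\<lambda>i j. if j \<le> i then fps_nth \<Phi> (i - j) else 0)"
  using PF unfolding PF_function_def \<Phi>_def .

text \<open>
  The coefficient \<open>f'(0) = \<Phi>(0)\<close> is nonzero and an entry of a totally positive matrix.
\<close>

lemma f1_pos: "fps_nth f 1 > 0"
proof -
  have "strict_mono_on {..<Suc 0} (\<lambda>i::nat. i)" by (auto simp: strict_mono_on_def)
  then have "minor (\<lambda>i j. if j \<le> i then fps_nth \<Phi> (i - j) else 0) (Suc 0) (\<lambda>i. i) (\<lambda>i. i) \<ge> 0"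
    using \<Phi>_TP unfolding TP_def all_minors_def by blast
  then have "fps_nth \<Phi> 0 \<ge> 0" by (simp add: minor_1)
  moreover have "fps_nth (fps_deriv f) 0 = fps_nth \<Phi> 0" unfolding deriv_eq by simp
  ultimately show ?thesis using f1' by simp
qed

text \<open>The differential equation \<open>f' = \<Phi> \<circ> f\<close>, read off in the powers of \<open>f\<close>.\<close>

lemma assoc_tri_Suc_Suc:
  "assoc_tri f (Suc n) (Suc k) = (\<Sum>j\<le>n. assoc_tri f n j * exp_toeplitz (fps_nth \<Phi>) j k)"
proof -
  have "fps_deriv (f ^ Suc k) = fps_const (real (Suc k)) * (f ^ k * (\<Phi> oo f))"
    by (subst fps_deriv_power) (simp add: deriv_eq mult_ac)
  also have "f ^ k * (\<Phi> oo f) = (fps_X ^ k * \<Phi>) oo f"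
    using f0 by (simp add: fps_compose_mult_distrib flip: fps_compose_power)
  finally have "fps_nth (fps_deriv (f ^ Suc k)) n =
      real (Suc k) * (\<Sum>j\<le>n. fps_nth (fps_X ^ k * \<Phi>) j * fps_nth (f ^ j) n)"
    by (simp only: fps_mult_left_const_nth fps_compose_nth atLeast0AtMost)
  then have "real (Suc n) * fps_nth (f ^ Suc k) (Suc n) =
      real (Suc k) * (\<Sum>j\<le>n. fps_nth (fps_X ^ k * \<Phi>) j * fps_nth (f ^ j) n)"
    by (simp only: fps_deriv_nth Suc_eq_plus1)
  also have "(\<Sum>j\<le>n. fps_nth (fps_X ^ k * \<Phi>) j * fps_nth (f ^ j) n) =
      (\<Sum>j\<le>n. fact k / fact n * (assoc_tri f n j * exp_toeplitz (fps_nth \<Phi>) j k))"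
    by (intro sum.cong refl) (auto simp: fps_X_power_mult_nth assoc_tri_def exp_toeplitz_def)
  finally have "real (Suc n) * fps_nth (f ^ Suc k) (Suc n) =
      real (Suc k) * (fact k / fact n * (\<Sum>j\<le>n. assoc_tri f n j * exp_toeplitz (fps_nth \<Phi>) j k))"
    by (simp only: sum_distrib_left)
  then show ?thesis by (simp add: assoc_tri_def field_simps del: power_Suc of_nat_Suc)
qed

lemma riordan:
  assumes "real_algebra_cone Pos \<iota>"
  shows "PF_exp_riordan Pos \<iota> (fps_nth \<Phi>) (assoc_tri f)"
proof -
  interpret real_algebra_cone Pos \<iota> by fact
  show ?thesis
  proof
    show "assoc_tri f 0 k = (if k = 0 then 1 else 0)" for k
      using assoc_tri_high[OF f0, of 0 k] by (cases k) (auto simp: assoc_tri_def)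
    show "assoc_tri f (Suc n) 0 = 0" for n by (simp add: assoc_tri_def)
  qed (simp_all add: assoc_tri_Suc_Suc \<Phi>_TP)
qed

sublocale real: PF_exp_riordan "\<lambda>x::real. x \<ge> 0" "\<lambda>x. x" "fps_nth \<Phi>" "assoc_tri f"
  by (rule riordan[OF real_algebra_cone_real])

sublocale poly: PF_exp_riordan coeffs_nonneg1 "\<lambda>x. [:x:]" "fps_nth \<Phi>" "assoc_tri f"
  by (rule riordan[OF real_algebra_cone_poly])

sublocale poly2: PF_exp_riordan coeffs_nonneg2 "\<lambda>x. [:[:x:]:]" "fps_nth \<Phi>" "assoc_tri f"
  by (rule riordan[OF real_algebra_cone_poly_poly])

definition g :: "real poly fps" where "g = exp_fps (fps_const lam1 * const_fps f)"

lemma S_poly_G: "S_poly (const_fps f) g n = poly2.G (lam2 + q2) 1 n 0"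
  and S_tri_G: "S_tri (const_fps f) g n k = poly.G lam1 1 n k"
  and S_star_poly_G: "S_star_poly (const_fps f) g n = poly2.G (q2 * lam2 + 1) q2 n 0"
proof -
  interpret id: real_idom_algebra "\<lambda>x. x" by (rule real_idom_algebra_id)
  interpret const: real_idom_algebra "\<lambda>x. [:x:]" by (rule id.poly_algebra)
  have f: "const_fps f = const.map_fps f" by (simp add: const_fps_def const.map_fps_def)
  have q: "[:lam1, 1:] = lam2 + q2" by simp
  show "S_poly (const_fps f) g n = poly2.G (lam2 + q2) 1 n 0"
    unfolding g_def f const.S_poly_exp[OF f0] poly2.G_def q by simp
  show "S_tri (const_fps f) g n k = poly.G lam1 1 n k"
    unfolding g_def f const.S_tri_exp[OF f0] poly.G_def by simp
  show "S_star_poly (const_fps f) g n = poly2.G (q2 * lam2 + 1) q2 n 0"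
    unfolding g_def f const.S_star_poly_exp[OF f0] poly2.G_def by simp
qed

lemma S_tri_exp_G: "S_tri f (exp_fps (fps_const l * f)) n k = real.G l 1 n k"
proof -
  interpret id: real_idom_algebra "\<lambda>x. x" by (rule real_idom_algebra_id)
  have f: "id.map_fps f = f" by (simp add: id.map_fps_def fps_eq_iff)
  show ?thesis using id.S_tri_exp[OF f0, of l n k] unfolding f real.G_def by simp
qed

lemma G_0_1: "real.G 0 1 = assoc_tri f"
proof (intro ext)
  fix n k
  have "real.G 0 1 n k = (\<Sum>m\<le>n. if m = k then assoc_tri f n k else 0)"
    unfolding real.G_def by (intro sum.cong refl) (auto simp: power_0_left binomial_eq_0 not_le)
  also have "\<dots> = assoc_tri f n k" using assoc_tri_high[OF f0, of n k] by (auto simp: not_le)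
  finally show "real.G 0 1 n k = assoc_tri f n k" .
qed

subsection \<open>The polynomial sequences\<close>

lemma pos_lam2_q2: "coeffs_nonneg2 (lam2 + q2)" "coeffs_nonneg2 (q2 * lam2 + 1)" "coeffs_nonneg2 q2"
  by (auto simp: coeffs_nonneg2_def coeff_pCons one_pCons split: nat.split)

lemma SM2_S_poly: "SM2 (S_poly (const_fps f) g)"
  unfolding SM2_def TP2_def S_poly_G
  by (rule poly2.all_minors_hankel_G[OF pos_lam2_q2(1) poly2.Pos_1])

lemma SM2_S_star_poly: "SM2 (S_star_poly (const_fps f) g)"
  unfolding SM2_def TP2_def S_star_poly_G
  by (rule poly2.all_minors_hankel_G[OF pos_lam2_q2(2,3)])

lemma TP1_S_tri: "TP1 (S_tri (const_fps f) g)"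
proof -
  have "coeffs_nonneg1 lam1" by (auto simp: coeffs_nonneg1_def coeff_pCons split: nat.split)
  then show ?thesis
    unfolding TP1_def S_tri_G[abs_def] by (rule poly.all_minors_G[OF _ poly.Pos_1])
qed

lemma hankel_f: "TP (\<lambda>i j. egf_coeff f (i + j + 1))"
proof -
  have "real.shifted_row_poly 0 1 n = egf_coeff f (n + 1)" for n
  proof -
    have "real.shifted_row_poly 0 1 n = (\<Sum>m\<le>n. if m = 0 then assoc_tri f (Suc n) 1 else 0)"
      unfolding real.shifted_row_poly_def by (intro sum.cong) auto
    then show ?thesis by (simp add: assoc_tri_def egf_coeff_def)
  qed
  then show ?thesis
    using real.all_minors_hankel_shifted[of 0 1] by (simp add: TP_def)
qed

subsection \<open>The triangles\<close>

lemma TP_assoc_tri: "TP (assoc_tri f)"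
  using real.all_minors_G[of 0 1] by (simp add: TP_def G_0_1)

text \<open>
  The triangle of the compositional inverse of \<open>f\<close> is the inverse matrix of the triangle of \<open>f\<close>.
\<close>

lemma TP_assoc_tri_inv: "TP (\<lambda>n k. (- 1) ^ n * assoc_tri (fps_inv f) n k * (- 1) ^ k)"
proof (rule TP_signed_inverse[OF TP_assoc_tri assoc_tri_high[OF f0]])
  show "assoc_tri f n n > 0" for n
    using f1_pos startsby_zero_power_nth_same[OF f0, of n] by (simp add: assoc_tri_def)
  fix n k
  have "(\<Sum>j\<le>n. assoc_tri f n j * assoc_tri (fps_inv f) j k) =
      fact n / fact k * (\<Sum>j\<le>n. fps_nth (fps_inv f ^ k) j * fps_nth (f ^ j) n)"
    unfolding sum_distrib_left by (intro sum.cong refl) (simp add: assoc_tri_def)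
  also have "(\<Sum>j\<le>n. fps_nth (fps_inv f ^ k) j * fps_nth (f ^ j) n) = fps_nth ((fps_inv f oo f) ^ k) n"
    by (simp add: fps_compose_power[OF f0] fps_compose_nth atLeast0AtMost)
  also have "(fps_inv f oo f) ^ k = fps_X ^ k" using fps_inv[OF f0 f1'] by simp
  finally show "(\<Sum>j\<le>n. assoc_tri f n j * assoc_tri (fps_inv f) j k) = (if n = k then 1 else 0)"
    by (simp add: fps_X_power_nth)
qed

lemma TP_assoc_tri_scaled:
  assumes "\<And>k. e k \<ge> 0"
  shows "TP (\<lambda>n k. assoc_tri f n k * e k)"
    and "TP (\<lambda>n k. (- 1) ^ (n - k) * (assoc_tri (fps_inv f) n k * e k))"
proof -
  show "TP (\<lambda>n k. assoc_tri f n k * e k)"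
    using TP_scale[OF TP_assoc_tri, of "\<lambda>_. 1" e] assms by simp
  have sign: "(- 1) ^ (n - k) * (assoc_tri (fps_inv f) n k * e k) =
      (- 1) ^ n * assoc_tri (fps_inv f) n k * (- 1) ^ k * e k" for n k
  proof (cases "k \<le> n")
    case True
    then have "n = n - k + k" by simp
    then have "(- 1 :: real) ^ n = (- 1) ^ (n - k) * (- 1) ^ k" by (metis power_add)
    moreover have "(- 1 :: real) ^ k * (- 1) ^ k = 1" by (simp flip: power_add)
    ultimately show ?thesis by (simp add: mult.assoc mult.left_commute)
  next
    case False
    then show ?thesis using assoc_tri_high[OF inv0] by simp
  qed
  show "TP (\<lambda>n k. (- 1) ^ (n - k) * (assoc_tri (fps_inv f) n k * e k))"
    unfolding sign using TP_scale[OF TP_assoc_tri_inv, of "\<lambda>_. 1" e] assms by simp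
qed

lemma TP_triangles:
  "TP (L_tri f)" "TP (Lt_tri f)"
  "TP (\<lambda>n k. (- 1) ^ (n - k) * S_tri (fps_inv f) 1 n k)"
  "TP (\<lambda>n k. (- 1) ^ (n - k) * L_tri (fps_inv f) n k)"
  "TP (\<lambda>n k. (- 1) ^ (n - k) * Lt_tri (fps_inv f) n k)"
  unfolding L_tri_assoc_tri[OF f0, abs_def] Lt_tri_assoc_tri[OF f0, abs_def]
    L_tri_assoc_tri[OF inv0] Lt_tri_assoc_tri[OF inv0] S_tri_1[OF inv0]
  using TP_assoc_tri_scaled[of "\<lambda>k. if k = 0 then 1 else fact (k - 1)"] TP_assoc_tri_scaled[of fact]
    TP_assoc_tri_scaled[of "\<lambda>_. 1"] by simp_all

subsection \<open>The convolutions\<close>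

text \<open>
  Homogenizing the row polynomials of the array of \<open>exp (l f)\<close> and \<open>f\<close> only changes the point at
  which those of the triangle of \<open>f\<close> are evaluated, from \<open>(s, t)\<close> to \<open>(s + l t, t)\<close>.
\<close>

lemma convolution_S_tri:
  assumes "l \<ge> 0"
  shows "convolution_preserves_SM (S_tri f (exp_fps (fps_const l * f)))"
proof (rule convolution_preserves_SM_if_row_polynomials_TP)
  fix s t :: real assume st: "s \<ge> 0" "t \<ge> 0"
  have "(\<Sum>k\<le>n. real.G l 1 n k * s ^ k * t ^ (n - k)) = real.G (s + l * t) t n 0" for n
  proof -
    have "(\<Sum>k\<le>n. real.G l 1 n k * s ^ k * t ^ (n - k)) =
        (\<Sum>m\<le>n. assoc_tri f n m * (\<Sum>k\<le>n. real (m choose k) * l ^ (m - k) * s ^ k * t ^ (n - k)))"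
      unfolding real.G_def sum_distrib_left sum_distrib_right by (subst sum.swap) (simp add: mult_ac)
    also have "\<dots> = (\<Sum>m\<le>n. assoc_tri f n m * ((s + l * t) ^ m * t ^ (n - m)))"
    proof (intro sum.cong refl arg_cong2[of _ _ _ _ "(*)"])
      fix m assume m: "m \<in> {..n}"
      have "(\<Sum>k\<le>n. real (m choose k) * l ^ (m - k) * s ^ k * t ^ (n - k)) =
          (\<Sum>k\<le>m. real (m choose k) * l ^ (m - k) * s ^ k * t ^ (n - k))"
        using m by (intro sum.mono_neutral_right) (auto simp: binomial_eq_0)
      also have "\<dots> = (\<Sum>k\<le>m. real (m choose k) * s ^ k * (l * t) ^ (m - k) * t ^ (n - m))"
      proof (intro sum.cong refl)
        fix k assume "k \<in> {..m}"
        then have "n - k = (m - k) + (n - m)" using m by simp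
        then have "t ^ (n - k) = t ^ (m - k) * t ^ (n - m)" by (simp only: power_add)
        then show "real (m choose k) * l ^ (m - k) * s ^ k * t ^ (n - k) =
            real (m choose k) * s ^ k * (l * t) ^ (m - k) * t ^ (n - m)"
          by (simp add: power_mult_distrib)
      qed
      also have "\<dots> = (s + l * t) ^ m * t ^ (n - m)" by (simp add: binomial_ring sum_distrib_right)
      finally show "(\<Sum>k\<le>n. real (m choose k) * l ^ (m - k) * s ^ k * t ^ (n - k)) = (s + l * t) ^ m * t ^ (n - m)" .
    qed
    finally show ?thesis by (simp add: real.G_def mult.assoc)
  qed
  then show "TP (\<lambda>i j. \<Sum>k\<le>i + j. S_tri f (exp_fps (fps_const l * f)) (i + j) k * s ^ k * t ^ (i + j - k))"
    using real.all_minors_hankel_G[of "s + l * t" t] assms st by (simp add: TP_def S_tri_exp_G)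
qed

lemma convolution_S_tri_1: "convolution_preserves_SM (assoc_tri f)"
  using convolution_S_tri[of 0, unfolded S_tri_exp_G[abs_def] G_0_1] by simp

lemma convolution_shifted: "convolution_preserves_SM (\<lambda>n k. S_tri f 1 (n + 1) (k + 1))"
  unfolding S_tri_1[OF f0]
proof (rule convolution_preserves_SM_if_row_polynomials_TP)
  fix s t :: real assume "s \<ge> 0" "t \<ge> 0"
  then show "TP (\<lambda>i j. \<Sum>k\<le>i + j. assoc_tri f (i + j + 1) (k + 1) * s ^ k * t ^ (i + j - k))"
    using real.all_minors_hankel_shifted[of s t] by (simp add: TP_def real.shifted_row_poly_def)
qed

text \<open>The factor \<open>k!\<close> of the ordered triangle is itself a Stieltjes moment sequence.\<close>

lemma convolution_Lt_tri: "convolution_preserves_SM (Lt_tri f)"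
  unfolding convolution_preserves_SM_def
proof (intro allI impI, elim conjE)
  fix x y assume "SM x" "SM y"
  then have "SM (Defs.convolution (assoc_tri f) (\<lambda>k. fact k * x k) y)"
    using convolution_S_tri_1 SM_mult[OF SM_fact] unfolding convolution_preserves_SM_def by blast
  then show "SM (Defs.convolution (Lt_tri f) x y)"
    by (simp add: Defs.convolution_def[abs_def] Lt_tri_assoc_tri[OF f0] mult_ac)
qed

subsection \<open>The branched continued fractions\<close>

lemma branched_cf_S:
  assumes "\<Phi> = (\<Prod>i=1..m. 1 + fps_const (x i) * fps_X)"
  shows "Abs_fps (S_poly (const_fps f) g) = branched_cf m (cf_coeffs m (lam2 + q2) (\<lambda>i. [:[:x i:]:]))"
    and "Abs_fps (S_star_poly (const_fps f) g) =
      branched_cf m (cf_coeffs m (q2 * lam2 + 1) (\<lambda>i. q2 * [:[:x i:]:]))"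
proof -
  have a: "fps_nth \<Phi> = fps_nth (\<Prod>i=1..m. 1 + fps_const (x i) * fps_X)" using assms by simp
  show "Abs_fps (S_poly (const_fps f) g) = branched_cf m (cf_coeffs m (lam2 + q2) (\<lambda>i. [:[:x i:]:]))"
    using poly2.branched_cf_G[OF a, of "lam2 + q2" 1] by (simp only: S_poly_G[abs_def] mult_1)
  show "Abs_fps (S_star_poly (const_fps f) g) =
      branched_cf m (cf_coeffs m (q2 * lam2 + 1) (\<lambda>i. q2 * [:[:x i:]:]))"
    using poly2.branched_cf_G[OF a, of "q2 * lam2 + 1" q2] by (simp only: S_star_poly_G[abs_def])
qed

end

theorem theorem1p6:
  fixes f :: "real fps" and g :: "real poly fps"
  assumes f0: "fps_nth f 0 = 0"
    and f1: "egf_coeff f 1 \<noteq> 0"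
    and g: "g = exp_fps (fps_const lam1 * const_fps f)"
    and PF: "PF_function (inverse (fps_deriv (fps_inv f)))"
  shows
    "(SM2 (S_poly (const_fps f) g) \<and> SM2 (S_star_poly (const_fps f) g) \<and>
      log_convex2 3 (S_poly (const_fps f) g) \<and> log_convex2 3 (S_star_poly (const_fps f) g)) \<and>
     (SM (\<lambda>n. egf_coeff f (n + 1)) \<and> log_convex 3 (\<lambda>n. egf_coeff f (n + 1))) \<and>
     TP1 (S_tri (const_fps f) g) \<and>
     (TP (L_tri f) \<and> TP (Lt_tri f) \<and>
      TP (\<lambda>n k. (- 1) ^ (n - k) * S_tri (fps_inv f) 1 n k) \<and>
      TP (\<lambda>n k. (- 1) ^ (n - k) * L_tri (fps_inv f) n k) \<and>
      TP (\<lambda>n k. (- 1) ^ (n - k) * Lt_tri (fps_inv f) n k)) \<and>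
     ((\<forall>l::real. l \<ge> 0 \<longrightarrow>
         convolution_preserves_SM (S_tri f (exp_fps (fps_const l * f)))) \<and>
      convolution_preserves_SM (\<lambda>n k. S_tri f 1 (n + 1) (k + 1)) \<and>
      convolution_preserves_SM (Lt_tri f)) \<and>
     (\<forall>m (x :: nat \<Rightarrow> real). m \<ge> 1 \<and>
         inverse (fps_deriv (fps_inv f)) = (\<Prod>i=1..m. 1 + fps_const (x i) * fps_X) \<longrightarrow>
       Abs_fps (S_poly (const_fps f) g) =
         branched_cf m (cf_coeffs m (lam2 + q2) (\<lambda>i. [:[:x i:]:])) \<and>
       Abs_fps (S_star_poly (const_fps f) g) =
         branched_cf m (cf_coeffs m (q2 * lam2 + 1) (\<lambda>i. q2 * [:[:x i:]:])))"
proof -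
  interpret F: PF_inverse_derivative f using f0 f1 PF by unfold_locales
  have g: "g = F.g" by (simp add: g F.g_def)
  show ?thesis
    unfolding g
  proof (intro conjI allI impI)
    show "log_convex2 3 (S_poly (const_fps f) F.g)" "log_convex2 3 (S_star_poly (const_fps f) F.g)"
      using F.SM2_S_poly F.SM2_S_star_poly F.poly2.log_convex_3_if_hankel_positive
      by (auto simp: log_convex2_def SM2_def TP2_def)
    show "SM (\<lambda>n. egf_coeff f (n + 1))"
      using F.hankel_f by (intro SM_if_hankel_TP) simp
    show "log_convex 3 (\<lambda>n. egf_coeff f (n + 1))"
      using F.hankel_f F.real.log_convex_3_if_hankel_positive[of "\<lambda>n. egf_coeff f (n + 1)"]
      by (simp add: log_convex_def TP_def)
    show "convolution_preserves_SM (\<lambda>n k. S_tri f 1 (n + 1) (k + 1))"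
      by (rule F.convolution_shifted)
  next
    fix m and x :: "nat \<Rightarrow> real"
    assume "m \<ge> 1 \<and> inverse (fps_deriv (fps_inv f)) = (\<Prod>i=1..m. 1 + fps_const (x i) * fps_X)"
    then have \<Phi>: "F.\<Phi> = (\<Prod>i=1..m. 1 + fps_const (x i) * fps_X)" by (simp add: F.\<Phi>_def)
    show "Abs_fps (S_poly (const_fps f) F.g) = branched_cf m (cf_coeffs m (lam2 + q2) (\<lambda>i. [:[:x i:]:]))"
      by (rule F.branched_cf_S(1)[OF \<Phi>])
    show "Abs_fps (S_star_poly (const_fps f) F.g) =
        branched_cf m (cf_coeffs m (q2 * lam2 + 1) (\<lambda>i. q2 * [:[:x i:]:]))"
      by (rule F.branched_cf_S(2)[OF \<Phi>])
  qed (intro F.SM2_S_poly F.SM2_S_star_poly F.TP1_S_tri F.TP_triangles F.convolution_S_tri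
      F.convolution_Lt_tri; assumption)+
qed

end
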